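(* Let $S$ be a homogeneous numerical semigroup with Cohen-Macaulay tangent cone $G(S)$. Then $S$ is of homogeneous type.
   Context: Let $S$ be a numerical semigroup (submonoid of $(\mathbb N,+)$ with finite complement) minimally generated by $n_1,\ldots,n_d$ with $n_1$ the smallest generator. Let $\Bbbk$ be a field, $P=\Bbbk[x_1,\ldots,x_d]$, $R=\Bbbk[S]=\Bbbk[t^{n_1},\ldots,t^{n_d}]\cong P/I_S$, where $I_S$ is the kernel of $P\to\Bbbk[t]$, $x_i\mapsto t^{n_i}$. $G(S)$ is the associated graded ring of $R$ with respect to the ideal $(t^{n_1},\ldots,t^{n_d})$; $G(S)\cong P/(I_S)_*$, where $(I_S)_*$ is generated by the lowest-degree homogeneous components of the nonzero elements of $I_S$ (standard grading). $\mathrm{AP}(S,n_1)=\{x\in S: x-n_1\notin S\}$. $S$ is homogeneous if for each $0\ne s\in\mathrm{AP}(S,n_1)$ all tuples $\mathbf a\in\mathbb N^d$ with $\sum a_in_i=s$ have the same sum $\sum_i a_i$. $S$ is of homogeneous type if $\beta_i(R)=\beta_i(G(S))$ for all $i\ge 1$, where $\beta_i(M)=\dim_\Bbbk \mathrm{Tor}_i^P(M,\Bbbk)$ denote the Betti numbers over $P$. *)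

theory Defs
  imports
    "HOL-Library.Extended_Nat"
    "HOL-Library.Poly_Mapping"
    "HOL-Computational_Algebra.Polynomial"
    "HOL-Algebra.Algebra"
    "Jordan_Normal_Form.Matrix_Kernel"
    "Jordan_Normal_Form.DL_Rank"
begin

section \<open>Numerical semigroups\<close>

definition numerical_semigroup :: "nat set \<Rightarrow> bool" where
  "numerical_semigroup S \<longleftrightarrow>
     0 \<in> S \<and> (\<forall>x\<in>S. \<forall>y\<in>S. x + y \<in> S) \<and> finite (- S)"

definition semigroup_span :: "('n::finite \<Rightarrow> nat) \<Rightarrow> 'n set \<Rightarrow> nat set" where
  "semigroup_span g J = {\<Sum>j\<in>J. a j * g j | a. True}"

text \<open>The generators \<open>n\<^sub>1, \<dots>, n\<^sub>d\<close> are a family \<open>g\<close> indexed by a finite type with \<open>d\<close> elements.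
  Minimality of the family forces \<open>g\<close> to be injective with positive values.\<close>

definition minimally_generates :: "('n::finite \<Rightarrow> nat) \<Rightarrow> nat set \<Rightarrow> bool" where
  "minimally_generates g S \<longleftrightarrow>
     semigroup_span g UNIV = S \<and> (\<forall>J. J \<subset> UNIV \<longrightarrow> semigroup_span g J \<noteq> S)"

definition least_generator :: "('n::finite \<Rightarrow> nat) \<Rightarrow> nat" where
  "least_generator g = Min (range g)"

text \<open>\<open>x - n \<notin> S\<close> is read in the integers, hence not written with truncated subtraction.\<close>

definition apery_set :: "nat set \<Rightarrow> nat \<Rightarrow> nat set" where
  "apery_set S n = {x \<in> S. \<forall>y\<in>S. x \<noteq> y + n}"

definition homogeneous_semigroup :: "('n::finite \<Rightarrow> nat) \<Rightarrow> nat set \<Rightarrow> bool" where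
  "homogeneous_semigroup g S \<longleftrightarrow>
     (\<forall>s \<in> apery_set S (least_generator g). s \<noteq> 0 \<longrightarrow>
        (\<forall>a b. (\<Sum>i\<in>UNIV. a i * g i) = s \<and> (\<Sum>i\<in>UNIV. b i * g i) = s \<longrightarrow>
           (\<Sum>i\<in>UNIV. a i) = (\<Sum>i\<in>UNIV. b i)))"


section \<open>Cohen-Macaulay rings\<close>

definition regular_sequence :: "('a, 'b) ring_scheme \<Rightarrow> 'a list \<Rightarrow> bool" where
  "regular_sequence A xs \<longleftrightarrow>
     set xs \<subseteq> carrier A \<and> Idl\<^bsub>A\<^esub> (set xs) \<noteq> carrier A \<and>
     (\<forall>i<length xs. \<forall>y\<in>carrier A.
        xs ! i \<otimes>\<^bsub>A\<^esub> y \<in> Idl\<^bsub>A\<^esub> (set (take i xs)) \<longrightarrow> y \<in> Idl\<^bsub>A\<^esub> (set (take i xs)))"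

definition ideal_depth :: "('a, 'b) ring_scheme \<Rightarrow> 'a set \<Rightarrow> enat" where
  "ideal_depth A I = Sup {enat (length xs) | xs. regular_sequence A xs \<and> set xs \<subseteq> I}"

definition prime_height :: "('a, 'b) ring_scheme \<Rightarrow> 'a set \<Rightarrow> enat" where
  "prime_height A p = Sup {enat n | n. \<exists>q. (\<forall>i\<le>n. primeideal (q i) A) \<and>
     (\<forall>i<n. q i \<subset> q (Suc i)) \<and> q n = p}"

text \<open>Eisenbud's form of the definition: depth equals codimension at every maximal ideal.  For a
  Noetherian ring these are the depth and the dimension of the localisation.\<close>

definition cohen_macaulay :: "('a, 'b) ring_scheme \<Rightarrow> bool" where
  "cohen_macaulay A \<longleftrightarrow> cring A \<and> noetherian_ring A \<and>
     (\<forall>m. maximalideal m A \<longrightarrow> ideal_depth A m = prime_height A m)"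


section \<open>Associated graded rings\<close>

text \<open>The subset \<open>B\<close> of a type-class ring with the inherited operations.\<close>

definition ring_on :: "'a::comm_ring_1 set \<Rightarrow> 'a ring" where
  "ring_on B = class_ring\<lparr>carrier := B\<rparr>"

primrec ideal_power :: "('a, 'b) ring_scheme \<Rightarrow> 'a set \<Rightarrow> nat \<Rightarrow> 'a set" where
  "ideal_power A I 0 = carrier A"
| "ideal_power A I (Suc j) = ideal_prod A I (ideal_power A I j)"

text \<open>With \<open>T\<close> the polynomial variable, \<open>\<Oplus>\<^sub>j I\<^sup>j T\<^sup>j\<close> is the Rees algebra of \<open>I\<close>,
  \<open>\<Oplus>\<^sub>j I\<^sup>j\<^sup>+\<^sup>1 T\<^sup>j\<close> is an ideal of it, and their quotient is
  \<open>\<Oplus>\<^sub>j I\<^sup>j / I\<^sup>j\<^sup>+\<^sup>1\<close> with its usual multiplication.\<close>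

definition rees_algebra :: "'a::comm_ring_1 set \<Rightarrow> 'a set \<Rightarrow> 'a poly ring" where
  "rees_algebra B I = ring_on {f. \<forall>j. coeff f j \<in> ideal_power (ring_on B) I j}"

definition rees_ideal :: "'a::comm_ring_1 set \<Rightarrow> 'a set \<Rightarrow> 'a poly set" where
  "rees_ideal B I = {f. \<forall>j. coeff f j \<in> ideal_power (ring_on B) I (Suc j)}"

definition assoc_graded :: "'a::comm_ring_1 set \<Rightarrow> 'a set \<Rightarrow> 'a poly set ring" where
  "assoc_graded B I = rees_algebra B I Quot rees_ideal B I"


section \<open>Betti numbers over a polynomial ring\<close>

text \<open>The polynomial ring over \<open>'k\<close> with variables indexed by \<open>'n\<close>, i.e. the monoid algebra of
  the exponent vectors.\<close>

type_synonym ('n, 'k) pring = "('n \<Rightarrow>\<^sub>0 nat) \<Rightarrow>\<^sub>0 'k"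

text \<open>Substitution of \<open>x i\<close> for the \<open>i\<close>-th variable, coefficients being mapped by \<open>c\<close>.\<close>

definition psubst ::
    "('k \<Rightarrow> 'a) \<Rightarrow> ('n \<Rightarrow> 'a) \<Rightarrow> ('n::finite, 'k::field) pring \<Rightarrow> 'a::comm_ring_1" where
  "psubst c x p = (\<Sum>m\<in>Poly_Mapping.keys p.
     c (Poly_Mapping.lookup p m) * (\<Prod>i\<in>UNIV. x i ^ Poly_Mapping.lookup m i))"

text \<open>The ring \<open>A\<close> as a module along a ring homomorphism \<open>h\<close> into \<open>A\<close>.\<close>

definition module_along :: "('r \<Rightarrow> 'a) \<Rightarrow> 'a ring \<Rightarrow> ('r, 'a) module" where
  "module_along h A = ring.extend A (module.fields (\<lambda>r a. h r \<otimes>\<^bsub>A\<^esub> a))"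

text \<open>The exact sequence \<open>\<dots> \<rightarrow> P\<^bsup>b 2\<^esup> \<rightarrow> P\<^bsup>b 1\<^esup> \<rightarrow> P\<^bsup>b 0\<^esup> \<rightarrow> M \<rightarrow> 0\<close>, the matrix \<open>D i\<close> describing
  the map \<open>P\<^bsup>b (i+1)\<^esup> \<rightarrow> P\<^bsup>b i\<^esup>\<close>.\<close>

definition free_resolution ::
    "(('n::finite, 'k::field) pring, 'm) module \<Rightarrow> (nat \<Rightarrow> nat) \<Rightarrow>
     (nat \<Rightarrow> ('n, 'k) pring mat) \<Rightarrow> (('n, 'k) pring vec \<Rightarrow> 'm) \<Rightarrow> bool" where
  "free_resolution M b D e \<longleftrightarrow>
     mod_hom class_ring (module_vec TYPE(('n, 'k) pring) (b 0)) M e \<and>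
     e ` carrier_vec (b 0) = carrier M \<and>
     (\<forall>i. D i \<in> carrier_mat (b i) (b (Suc i))) \<and>
     {v \<in> carrier_vec (b 0). e v = \<zero>\<^bsub>M\<^esub>} = (\<lambda>v. D 0 *\<^sub>v v) ` carrier_vec (b 1) \<and>
     (\<forall>i. mat_kernel (D i) = (\<lambda>v. D (Suc i) *\<^sub>v v) ` carrier_vec (b (Suc (Suc i))))"

text \<open>Tensoring \<open>P\<^bsup>b (i+1)\<^esup> \<rightarrow> P\<^bsup>b i\<^esup>\<close> with the residue field \<open>k = P/(x\<^sub>1, \<dots>, x\<^sub>d)\<close>
  replaces the entries of its matrix by their constant terms.\<close>

definition mod_variables :: "('n::finite, 'k::field) pring mat \<Rightarrow> 'k mat" where
  "mod_variables = map_mat (\<lambda>p. Poly_Mapping.lookup p 0)"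

text \<open>The dimension of the homology (cycles modulo boundaries) at \<open>k\<^bsup>b i\<^esup>\<close> of the complex
  obtained from a resolution by tensoring with \<open>k\<close>.\<close>

fun homology_dim :: "(nat \<Rightarrow> nat) \<Rightarrow> (nat \<Rightarrow> ('n::finite, 'k::field) pring mat) \<Rightarrow> nat \<Rightarrow> nat" where
  "homology_dim b D 0 = b 0 - vec_space.rank (b 0) (mod_variables (D 0))"
| "homology_dim b D (Suc i) =
     kernel_dim (mod_variables (D i)) - vec_space.rank (b (Suc i)) (mod_variables (D (Suc i)))"

text \<open>The dimension of \<open>Tor\<^sub>i(M, k)\<close>, computed from any resolution of \<open>M\<close> by finitely generated free
  modules.  For finitely generated \<open>M\<close> such a resolution exists, and the value is independent of it.\<close>

definition betti :: "(('n::finite, 'k::field) pring, 'm) module \<Rightarrow> nat \<Rightarrow> nat" where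
  "betti M i = (THE c. \<exists>b D e. free_resolution M b D e \<and> c = homology_dim b D i)"


section \<open>Semigroup rings and tangent cones\<close>

definition semigroup_carrier :: "nat set \<Rightarrow> 'k::field poly set" where
  "semigroup_carrier S = {f. \<forall>j. coeff f j \<noteq> 0 \<longrightarrow> j \<in> S}"

definition semigroup_ring :: "nat set \<Rightarrow> 'k::field poly ring" where
  "semigroup_ring S = ring_on (semigroup_carrier S)"

definition max_ideal :: "('n::finite \<Rightarrow> nat) \<Rightarrow> nat set \<Rightarrow> 'k::field poly set" where
  "max_ideal g S = Idl\<^bsub>semigroup_ring S\<^esub> (range (\<lambda>i. monom 1 (g i)))"

definition tangent_cone :: "('n::finite \<Rightarrow> nat) \<Rightarrow> nat set \<Rightarrow> 'k::field poly poly set ring" where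
  "tangent_cone g S = assoc_graded (semigroup_carrier S) (max_ideal g S)"

text \<open>\<open>P\<close> acts on the semigroup ring by \<open>x\<^sub>i \<mapsto> t\<^bsup>n\<^sub>i\<^esup>\<close>, and on the tangent cone by sending \<open>x\<^sub>i\<close>
  to the initial form of \<open>t\<^bsup>n\<^sub>i\<^esup>\<close>, i.e. to the class of \<open>t\<^bsup>n\<^sub>i\<^esup> T\<close> in degree one.\<close>

definition semigroup_module ::
    "('n::finite \<Rightarrow> nat) \<Rightarrow> nat set \<Rightarrow> (('n, 'k::field) pring, 'k poly) module" where
  "semigroup_module g S =
     module_along (psubst (\<lambda>c. [:c:]) (\<lambda>i. monom 1 (g i))) (semigroup_ring S)"

definition tangent_cone_module ::
    "('n::finite \<Rightarrow> nat) \<Rightarrow> nat set \<Rightarrow> (('n, 'k::field) pring, 'k poly poly set) module" where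
  "tangent_cone_module g S =
     module_along
       (\<lambda>p. rees_ideal (semigroup_carrier S) (max_ideal g S)
              +>\<^bsub>rees_algebra (semigroup_carrier S) (max_ideal g S)\<^esub>
            psubst (\<lambda>c. [:[:c:]:]) (\<lambda>i. monom (monom 1 (g i)) 1) p)
       (tangent_cone g S)"

definition homogeneous_type ::
    "'k::field itself \<Rightarrow> ('n::finite \<Rightarrow> nat) \<Rightarrow> nat set \<Rightarrow> bool" where
  "homogeneous_type k g S \<longleftrightarrow>
     (\<forall>i\<ge>1. betti (semigroup_module g S :: (('n, 'k) pring, 'k poly) module) i =
            betti (tangent_cone_module g S :: (('n, 'k) pring, 'k poly poly set) module) i)"

end

theory Submission
  imports Defs
begin

text \<open>Let \<open>x\<^sub>1\<close> be the variable of the least generator \<open>n\<^sub>1\<close>.  It is regular on \<open>P\<close> and on \<open>k[S]\<close>, and, when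
  \<open>G(S)\<close> is Cohen-Macaulay, also on \<open>G(S)\<close>: otherwise some monomial class of \<open>G(S)\<close> is killed by \<open>x\<^sub>1\<close>, hence by
  all elements of high degree, as these are multiples of \<open>x\<^sub>1\<close>; but the irrelevant ideal has positive height and so
  contains a regular element.  Both \<open>k[S]/x\<^sub>1\<close> and \<open>G(S)/x\<^sub>1\<close> have the Apery set as a basis, and homogeneity says
  precisely that the variables act on the two in the same way.  Reduced modulo \<open>x\<^sub>1\<close>, resolutions \<open>F\<close> of \<open>k[S]\<close> and
  \<open>F'\<close> of \<open>G(S)\<close> therefore resolve the same module, so there are maps between \<open>F\<close> and \<open>F'\<close> that are mutually
  inverse up to homotopy modulo \<open>x\<^sub>1\<close>.  Tensoring with \<open>k\<close> kills \<open>x\<^sub>1\<close>, so \<open>F \<otimes> k\<close> and \<open>F' \<otimes> k\<close> have the same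
  homology.  Finite free resolutions exist because \<open>P\<close> is Noetherian, by Dickson's lemma applied to leading terms.\<close>

section \<open>Dimensions of subspaces of coordinate spaces\<close>

text \<open>Everything about k[S] and G(S) is governed by \<open>order\<close>, the greatest length
  of an expression of s in the generators. For s in S, t^s lies in the j-th power of the maximal
  ideal iff j is at most order s. Hence G(S) has a basis e_s in degree order s, with e_s e_u =
  e_(s+u) if the orders add up and e_s e_u = 0 otherwise. The danger is that a product survives in
  k[S]/x_1 but vanishes in G(S)/x_1; inside the Apery set homogeneity makes orders add up and
  excludes this. The Cohen-Macaulay property enters only as order (s + n_1) = order s + 1. The two
  modules have different types, and P/x_1 is not a type. So matrices stay over P and are compared up
  to congruence modulo x_1, and each M/x_1 M is represented by the image of M in one common group,
  the span of the t^s with s in the Apery set. Betti numbers are a definite description over all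
  finite free resolutions, so independence of the resolution has to be proved as well. Comparing
  every resolution of one module with every resolution of the other yields independence and equality
  together.\<close>

lemma (in vectorspace) subspace_fin_dim:
  assumes "subspace K W V" "fin_dim"
  shows "vectorspace.fin_dim K (vs W)"
proof -
  interpret W: vectorspace K "vs W" using assms(1) by (rule subspace_is_vs)
  have sub: "submodule K W V" using assms(1) by (simp add: subspace_def)
  have WV: "W \<subseteq> carrier V" using sub by (simp add: submodule_def)
  \<comment> \<open>Sets independent in W stay independent in V, so the dimension of V bounds their
    size; a maximal one exists and is a basis of W.\<close>
  have small: "finite A \<and> card A \<le> dim" if "A \<subseteq> W" "W.lin_indpt A" for A
  proof -
    have "lin_indpt A" using span_li_not_depend(2)[OF that(1) sub] that(2) by simp
    with that(1) WV show ?thesis using li_le_dim[OF assms(2)] by blast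
  qed
  have "\<exists>A. finite A \<and> maximal A (\<lambda>S. S \<subseteq> carrier (vs W) \<and> W.lin_indpt S)"
    by (rule maximal_exists[where N = dim and B = "{}"]) (use small in \<open>auto simp: W.lin_dep_def\<close>)
  then obtain A where "finite A" "maximal A (\<lambda>S. S \<subseteq> carrier (vs W) \<and> W.lin_indpt S)" by blast
  then show ?thesis
    using W.max_li_is_basis[of A] unfolding W.fin_dim_def W.basis_def by auto
qed

text \<open>Closure conditions spelled out on plain sets of vectors, so that subspaces of several
  spaces k^n can be handled side by side without a locale interpretation for each.\<close>

definition lin_subspace :: "nat \<Rightarrow> 'k::field vec set \<Rightarrow> bool" where
  "lin_subspace n U \<longleftrightarrow> U \<subseteq> carrier_vec n \<and> 0\<^sub>v n \<in> U \<and>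
     (\<forall>u\<in>U. \<forall>v\<in>U. u + v \<in> U) \<and> (\<forall>c. \<forall>u\<in>U. c \<cdot>\<^sub>v u \<in> U)"

definition subspace_dim :: "nat \<Rightarrow> 'k::field vec set \<Rightarrow> nat" where
  "subspace_dim n U = vectorspace.dim class_ring ((module_vec TYPE('k) n)\<lparr>carrier := U\<rparr>)"

lemma lin_subspaceD:
  assumes "lin_subspace n (U :: 'k::field vec set)"
  shows "VectorSpace.subspace class_ring U (module_vec TYPE('k) n)"
  using assms unfolding VectorSpace.subspace_def submodule_def lin_subspace_def
  by (auto simp: module_vec_simps vec_vs vec_module)

lemma subspace_dim_mono:
  assumes U: "lin_subspace n U" and W: "lin_subspace n (W :: 'k::field vec set)" and UW: "U \<subseteq> W"
  shows "subspace_dim n U \<le> subspace_dim n W"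
proof -
  interpret V: vec_space "TYPE('k)" n .
  have sU: "VectorSpace.subspace class_ring U V.V" and sW: "VectorSpace.subspace class_ring W V.V"
    using U W by (auto dest: lin_subspaceD)
  interpret Wv: vectorspace class_ring "V.vs W" by (rule V.subspace_is_vs[OF sW])
  have UsW: "VectorSpace.subspace class_ring U (V.vs W)" by (rule V.nested_subspaces[OF sW sU UW])
  have fW: "Wv.fin_dim" by (rule V.subspace_fin_dim[OF sW V.fin_dim])
  show ?thesis
    using Wv.subspace_dim[OF UsW fW Wv.subspace_fin_dim[OF UsW fW]] by (simp add: subspace_dim_def)
qed

lemma rank_nullity_subspace:
  fixes f :: "'k::field vec \<Rightarrow> 'k vec"
  assumes U: "lin_subspace n U" and f: "\<And>u. u \<in> U \<Longrightarrow> f u \<in> carrier_vec m"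
    and add: "\<And>u v. u \<in> U \<Longrightarrow> v \<in> U \<Longrightarrow> f (u + v) = f u + f v"
    and smult: "\<And>c u. u \<in> U \<Longrightarrow> f (c \<cdot>\<^sub>v u) = c \<cdot>\<^sub>v f u"
  shows "subspace_dim m (f ` U) + subspace_dim n {u \<in> U. f u = 0\<^sub>v m} = subspace_dim n U"
proof -
  interpret V: vec_space "TYPE('k)" n .
  interpret V': vec_space "TYPE('k)" m .
  have sU: "VectorSpace.subspace class_ring U V.V" using U by (rule lin_subspaceD)
  interpret Uv: vectorspace class_ring "V.vs U" by (rule V.subspace_is_vs[OF sU])
  have "f \<in> module_hom class_ring (V.vs U) V'.V"
    using f add smult by (auto simp: module_hom_def)
  then interpret L: linear_map class_ring "V.vs U" V'.V f
    by (intro linear_map.intro mod_hom.intro mod_hom_axioms.intro Uv.vectorspace_axioms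
        V'.vectorspace_axioms
         Uv.module_axioms V'.module_axioms)
  show ?thesis
    using L.rank_nullity[OF V.subspace_fin_dim[OF sU V.fin_dim]]
    by (simp add: subspace_dim_def L.im_def L.ker_def)
qed

lemma subspace_dim_carrier [simp]: "subspace_dim n (carrier_vec n :: 'k::field vec set) = n"
proof -
  interpret V: vec_space "TYPE('k)" n .
  have "(module_vec TYPE('k) n)\<lparr>carrier := carrier_vec n\<rparr> = V.V"
    by (simp add: module_vec_def)
  then show ?thesis unfolding subspace_dim_def by (simp only: V.dim_is_n)
qed

lemma lin_subspace_carrier [simp]: "lin_subspace n (carrier_vec n)"
  by (auto simp: lin_subspace_def)

lemma lin_subspace_kernel:
  "A \<in> carrier_mat m n \<Longrightarrow> lin_subspace n (mat_kernel (A :: 'k::field mat))"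
  by (auto simp: lin_subspace_def mat_kernel mult_add_distrib_mat_vec mult_mat_vec)

lemma lin_subspace_image:
  assumes A: "A \<in> carrier_mat n m"
  shows "lin_subspace n ((\<lambda>v. A *\<^sub>v v) ` carrier_vec m :: 'k::field vec set)"
proof -
  have "0\<^sub>v n = A *\<^sub>v 0\<^sub>v m" using A by auto
  then show ?thesis using A
    by (auto simp: lin_subspace_def mult_add_distrib_mat_vec[symmetric] mult_mat_vec[symmetric])
qed

lemma kernel_dim_subspace_dim:
  "A \<in> carrier_mat m n \<Longrightarrow> kernel_dim A = subspace_dim n (mat_kernel A)"
  by (auto simp: kernel_dim_def subspace_dim_def)

lemma rank_subspace_dim:
  fixes A :: "'k::field mat"
  assumes A: "A \<in> carrier_mat n m"
  shows "vec_space.rank n A = subspace_dim n ((\<lambda>v. A *\<^sub>v v) ` carrier_vec m)"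
proof -
  interpret V: vec_space "TYPE('k)" n .
  have "V.span (set (cols A)) = (\<lambda>v. A *\<^sub>v v) ` carrier_vec m"
    using V.col_space_eq[OF A] A by (auto simp: V.col_space_def)
  then show ?thesis by (simp add: V.rank_def subspace_dim_def)
qed

lemma rank_plus_kernel_dim:
  fixes A :: "'k::field mat"
  assumes A: "A \<in> carrier_mat n m"
  shows "vec_space.rank n A + kernel_dim A = m"
proof -
  have "{u \<in> carrier_vec m. A *\<^sub>v u = 0\<^sub>v n} = mat_kernel A" using A by (auto simp: mat_kernel)
  then show ?thesis
    using rank_nullity_subspace[OF lin_subspace_carrier, of m "\<lambda>v. A *\<^sub>v v" n] A
    by (simp add: rank_subspace_dim kernel_dim_subspace_dim mult_add_distrib_mat_vec mult_mat_vec)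
qed

lemma subspace_dim_zero [simp]: "subspace_dim n {0\<^sub>v n :: 'k::field vec} = 0"
proof -
  have "kernel_dim (1\<^sub>m n :: 'k mat) = 0"
    using kernel_one_mat[where 'a='k, of n] by (simp add: kernel_dim_def)
  moreover have "mat_kernel (1\<^sub>m n :: 'k mat) = {0\<^sub>v n}" by (auto simp: mat_kernel_def)
  ultimately show ?thesis using kernel_dim_subspace_dim[OF one_carrier_mat, of n] by metis
qed

lemma smult_zero_vec: "v \<in> carrier_vec n \<Longrightarrow> (0::'k::field) \<cdot>\<^sub>v v = 0\<^sub>v n"
  by (intro eq_vecI) auto

lemma subspace_dim_inj_image:
  fixes f :: "'k::field vec \<Rightarrow> 'k vec"
  assumes U: "lin_subspace n U" and f: "\<And>u. u \<in> U \<Longrightarrow> f u \<in> carrier_vec m"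
    and add: "\<And>u v. u \<in> U \<Longrightarrow> v \<in> U \<Longrightarrow> f (u + v) = f u + f v"
    and smult: "\<And>c u. u \<in> U \<Longrightarrow> f (c \<cdot>\<^sub>v u) = c \<cdot>\<^sub>v f u"
    and inj: "\<And>u. u \<in> U \<Longrightarrow> f u = 0\<^sub>v m \<Longrightarrow> u = 0\<^sub>v n"
  shows "subspace_dim m (f ` U) = subspace_dim n U"
proof -
  have 0: "0\<^sub>v n \<in> U" using U by (simp add: lin_subspace_def)
  have "(0::'k) \<cdot>\<^sub>v 0\<^sub>v n = 0\<^sub>v n" by auto
  then have "f (0\<^sub>v n) = 0 \<cdot>\<^sub>v f (0\<^sub>v n)" using smult[OF 0, of 0] by simp
  then have "f (0\<^sub>v n) = 0\<^sub>v m" by (rule trans) (rule smult_zero_vec[OF f[OF 0]])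
  then have "{u \<in> U. f u = 0\<^sub>v m} = {0\<^sub>v n}" using inj 0 by blast
  then show ?thesis using rank_nullity_subspace[OF U f add smult] by simp
qed

text \<open>The last hypothesis says that \<open>ph\<close> is injective from Z modulo the image of
  \<open>d\<close> to Z' modulo the image of \<open>d'\<close>; the conclusion compares the
  dimensions of these quotients, written without subtraction. No quotient space is formed: the map
  (z, w) to ph z + d' w from Z x k^m' to Z' has a kernel that projects into the image of
  \<open>d\<close>, and rank-nullity is applied to it several times.\<close>

lemma homology_dim_le:
  fixes Z :: "'k::field vec set"
  assumes Z: "lin_subspace n Z" and Z': "lin_subspace n' Z'"
    and d: "d \<in> carrier_mat n m" and d': "d' \<in> carrier_mat n' m'"
    and dZ': "(\<lambda>v. d' *\<^sub>v v) ` carrier_vec m' \<subseteq> Z'"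
    and ph: "ph \<in> carrier_mat n' n"
    and phZ: "\<And>z. z \<in> Z \<Longrightarrow> ph *\<^sub>v z \<in> Z'"
    and inj: "\<And>z. z \<in> Z \<Longrightarrow> ph *\<^sub>v z \<in> (\<lambda>v. d' *\<^sub>v v) ` carrier_vec m'
        \<Longrightarrow> z \<in> (\<lambda>v. d *\<^sub>v v) ` carrier_vec m"
  shows "subspace_dim n Z + vec_space.rank n' d' \<le> subspace_dim n' Z' + vec_space.rank n d"
proof -
  \<comment> \<open>Z x k^m', coded by concatenated vectors of length n + m'.\<close>
  define U where "U = {v \<in> carrier_vec (n + m'). vec_first v n \<in> Z}"
  have Zc: "Z \<subseteq> carrier_vec n" and Zz: "0\<^sub>v n \<in> Z" using Z by (auto simp: lin_subspace_def)
  have first_add: "vec_first (u + v) n = vec_first u n + vec_first v n"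
    and last_add: "vec_last (u + v) m' = vec_last u m' + vec_last v m'"
    if "u \<in> carrier_vec (n + m')" "v \<in> carrier_vec (n + m')" for u v :: "'k vec"
    using that by (auto simp: vec_first_def vec_last_def)
  have first_smult: "vec_first (c \<cdot>\<^sub>v u) n = c \<cdot>\<^sub>v vec_first u n"
    and last_smult: "vec_last (c \<cdot>\<^sub>v u) m' = c \<cdot>\<^sub>v vec_last u m'"
    if "u \<in> carrier_vec (n + m')" for u :: "'k vec" and c
    using that by (auto simp: vec_first_def vec_last_def)
  have split: "u = vec_first u n @\<^sub>v vec_last u m'" if "u \<in> carrier_vec (n + m')" for u :: "'k vec"
    using that by simp
  have fl: "vec_first (z @\<^sub>v w) n = z" "vec_last (z @\<^sub>v w) m' = w"
    if "z \<in> carrier_vec n" "w \<in> carrier_vec m'" for z w :: "'k vec"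
    using that by (auto simp: vec_first_def vec_last_def)
  have U: "lin_subspace (n + m') U"
  proof -
    have "vec_first (0\<^sub>v (n + m')) n = (0\<^sub>v n :: 'k vec)" by (auto simp: vec_first_def)
    then show ?thesis using Z by (auto simp: lin_subspace_def U_def first_add first_smult)
  qed
  have Uc: "u \<in> U \<Longrightarrow> u \<in> carrier_vec (n + m')" for u by (simp add: U_def)
  have sub: "lin_subspace (n + m') {v \<in> W. f v = 0\<^sub>v k}"
    if W: "lin_subspace (n + m') W" and WU: "W \<subseteq> U" and f: "\<And>u. u \<in> U \<Longrightarrow> f u \<in> carrier_vec k"
      and add: "\<And>u v. u \<in> U \<Longrightarrow> v \<in> U \<Longrightarrow> f (u + v) = f u + f v"
      and smult: "\<And>c u. u \<in> U \<Longrightarrow> f (c \<cdot>\<^sub>v u) = c \<cdot>\<^sub>v f u" for W k and f :: "'k vec \<Rightarrow> 'k vec"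
  proof -
    have 0: "0\<^sub>v (n + m') \<in> W" using W by (simp add: lin_subspace_def)
    have "(0::'k) \<cdot>\<^sub>v 0\<^sub>v (n + m') = 0\<^sub>v (n + m')" by auto
    then have "f (0\<^sub>v (n + m')) = 0 \<cdot>\<^sub>v f (0\<^sub>v (n + m'))"
      using smult[of "0\<^sub>v (n + m')" 0] 0 WU by auto
    then have "f (0\<^sub>v (n + m')) = 0\<^sub>v k" by (rule trans)
        (rule smult_zero_vec[OF f[OF subsetD[OF WU 0]]])
    then show ?thesis using W WU add smult f by (auto simp: lin_subspace_def subset_iff)
  qed
  have ph0: "ph *\<^sub>v 0\<^sub>v n = 0\<^sub>v n'" using ph by (intro eq_vecI) auto
  define T where "T = (\<lambda>v. ph *\<^sub>v vec_first v n + d' *\<^sub>v vec_last v m')"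
  have Tc: "T u \<in> carrier_vec n'" if "u \<in> U" for u using that ph d' by (auto simp: T_def)
  have Tadd: "T (u + v) = T u + T v" if "u \<in> U" "v \<in> U" for u v
    using that ph d' Uc by (auto simp: T_def first_add last_add mult_add_distrib_mat_vec[of _ n' n]
        mult_add_distrib_mat_vec[of _ n' m']
        assoc_add_vec[of _ n'] comm_add_vec[of _ n'] intro!: eq_vecI)
  have Tsmult: "T (c \<cdot>\<^sub>v u) = c \<cdot>\<^sub>v T u" if "u \<in> U" for c u
    using that ph d' Uc by (auto simp: T_def first_smult last_smult mult_mat_vec[of _ n' n]
        mult_mat_vec[of _ n' m']
        smult_add_distrib_vec[of _ n'])
  \<comment> \<open>The kernels of T on U, of the first projection on U, and of the first projection
    on Kt. K0 is a copy of k^m', and K1 a copy of the kernel of \<open>d'\<close>.\<close>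
  define Kt where "Kt = {v \<in> U. T v = 0\<^sub>v n'}"
  define K0 where "K0 = {v \<in> U. vec_first v n = 0\<^sub>v n}"
  define K1 where "K1 = {v \<in> Kt. vec_first v n = 0\<^sub>v n}"
  have Kt: "lin_subspace (n + m') Kt" unfolding Kt_def by (rule sub[OF U _ Tc Tadd Tsmult]) auto
  have K0: "lin_subspace (n + m') K0" unfolding K0_def
    by (rule sub[OF U]) (auto simp: Uc first_add first_smult)
  have K1: "lin_subspace (n + m') K1" unfolding K1_def
    by (rule sub[OF Kt]) (auto simp: Uc first_add first_smult Kt_def)
  have KtU: "Kt \<subseteq> U" and K0U: "K0 \<subseteq> U" and K1U: "K1 \<subseteq> U" by (auto simp: Kt_def K0_def K1_def)
  have e1: "subspace_dim n Z + subspace_dim (n + m') K0 = subspace_dim (n + m') U"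
  proof -
    have "z \<in> (\<lambda>v. vec_first v n) ` U" if "z \<in> Z" for z
      using that Zc fl(1)[of z "0\<^sub>v m'"] by (intro image_eqI[of _ _ "z @\<^sub>v 0\<^sub>v m'"])
          (auto simp: U_def)
    then have "(\<lambda>v. vec_first v n) ` U = Z" by (auto simp: U_def)
    then show ?thesis
      using rank_nullity_subspace[OF U, of "\<lambda>v. vec_first v n" n] by
          (auto simp: K0_def first_add first_smult Uc)
  qed
  have inj_last: "u = 0\<^sub>v (n + m')" if "u \<in> U" "vec_first u n = 0\<^sub>v n" "vec_last u m' = 0\<^sub>v m'"
      for u
    using split[of u] that Uc by auto
  have e2: "subspace_dim (n + m') K0 = m'"
  proof -
    have "w \<in> (\<lambda>v. vec_last v m') ` K0" if "w \<in> carrier_vec m'" for w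
      using that Zz fl[of "0\<^sub>v n" w] by (intro image_eqI[of _ _ "0\<^sub>v n @\<^sub>v w"])
          (auto simp: U_def K0_def)
    then have im: "(\<lambda>v. vec_last v m') ` K0 = carrier_vec m'" by auto
    show ?thesis
      using subspace_dim_inj_image[OF K0, of "\<lambda>v. vec_last v m'" m'] im K0U inj_last
      by (auto simp: last_add last_smult Uc subset_iff K0_def)
  qed
  have e3: "subspace_dim n' (T ` U) + subspace_dim (n + m') Kt = subspace_dim (n + m') U"
    unfolding Kt_def by (rule rank_nullity_subspace[OF U Tc Tadd Tsmult])
  have Timg: "lin_subspace n' (T ` U)"
  proof -
    have z: "0\<^sub>v (n + m') \<in> U" using U by (simp add: lin_subspace_def)
    have "T (0\<^sub>v (n + m')) = 0\<^sub>v n'" using Kt by (auto simp: lin_subspace_def Kt_def)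
    moreover have "u + v \<in> U" "c \<cdot>\<^sub>v u \<in> U" if "u \<in> U" "v \<in> U" for u v c
      using U that by (auto simp: lin_subspace_def)
    ultimately show ?thesis using z Tc
      by (auto simp: lin_subspace_def Tadd[symmetric] Tsmult[symmetric] intro: image_eqI[OF _ z])
  qed
  have "T ` U \<subseteq> Z'"
  proof (clarify)
    fix u assume u: "u \<in> U"
    have "ph *\<^sub>v vec_first u n \<in> Z'" using u phZ by (simp add: U_def)
    moreover have "d' *\<^sub>v vec_last u m' \<in> Z'" using dZ' by auto
    ultimately show "T u \<in> Z'" using Z' by (simp add: T_def lin_subspace_def)
  qed
  then have e3': "subspace_dim n' (T ` U) \<le> subspace_dim n' Z'" by
      (rule subspace_dim_mono[OF Timg Z'])
  have e4: "subspace_dim n ((\<lambda>v. vec_first v n) ` Kt) + subspace_dim (n + m') K1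
      = subspace_dim (n + m') Kt"
    unfolding K1_def by (rule rank_nullity_subspace[OF Kt])
        (use KtU in \<open>auto simp: first_add first_smult Uc subset_iff\<close>)
  \<comment> \<open>T u = 0 rewritten as ph z = d' (-w), so that the injectivity hypothesis puts the
    first component z into the image of \<open>d\<close>.\<close>
  have neg: "ph *\<^sub>v vec_first u n = d' *\<^sub>v (- vec_last u m')" if "u \<in> Kt" for u
  proof -
    define a where "a = ph *\<^sub>v vec_first u n"
    define b where "b = d' *\<^sub>v vec_last u m'"
    have c: "a \<in> carrier_vec n'" "b \<in> carrier_vec n'" using ph d' by (auto simp: a_def b_def)
    have "a + b = 0\<^sub>v n'" using that by (auto simp: Kt_def T_def a_def b_def)
    then have "a $ i + b $ i = 0" if "i < n'" for i
      using c that by (metis index_add_vec(1) carrier_vecD index_zero_vec(1))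
    then have "a = (-1) \<cdot>\<^sub>v b" using c by (intro eq_vecI) (simp_all add: eq_neg_iff_add_eq_0)
    moreover have "- vec_last u m' = (-1) \<cdot>\<^sub>v vec_last u m'" by (intro eq_vecI) simp_all
    then have "d' *\<^sub>v (- vec_last u m') = (-1) \<cdot>\<^sub>v b"
      using mult_mat_vec[OF d', of "vec_last u m'" "-1"] by (simp add: b_def)
    ultimately show ?thesis by (simp add: a_def)
  qed
  have e4': "subspace_dim n ((\<lambda>v. vec_first v n) ` Kt) \<le> vec_space.rank n d"
    unfolding rank_subspace_dim[OF d]
  proof (rule subspace_dim_mono)
    have "u + v \<in> Kt" "c \<cdot>\<^sub>v u \<in> Kt" if "u \<in> Kt" "v \<in> Kt" for u v c
      using Kt that by (auto simp: lin_subspace_def)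
    moreover have "0\<^sub>v n \<in> (\<lambda>v. vec_first v n) ` Kt"
    proof -
      have "0\<^sub>v n = vec_first (0\<^sub>v (n + m')) n" by (auto simp: vec_first_def)
      then show ?thesis using Kt by (auto simp: lin_subspace_def)
    qed
    ultimately show "lin_subspace n ((\<lambda>v. vec_first v n) ` Kt)" using KtU Uc
      by (auto simp: lin_subspace_def first_add[symmetric] first_smult[symmetric] subset_iff)
    show "lin_subspace n ((\<lambda>v. d *\<^sub>v v) ` carrier_vec m)" by (rule lin_subspace_image[OF d])
    show "(\<lambda>v. vec_first v n) ` Kt \<subseteq> (\<lambda>v. d *\<^sub>v v) ` carrier_vec m"
    proof (clarify)
      fix u assume u: "u \<in> Kt"
      have "- vec_last u m' \<in> carrier_vec m'" by auto
      then have "ph *\<^sub>v vec_first u n \<in> (\<lambda>v. d' *\<^sub>v v) ` carrier_vec m'" using neg[OF u] by auto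
      then show "vec_first u n \<in> (\<lambda>v. d *\<^sub>v v) ` carrier_vec m"
        using inj u by (auto simp: Kt_def U_def)
    qed
  qed
  have e5: "subspace_dim (n + m') K1 = kernel_dim d'"
  proof -
    have "w \<in> (\<lambda>v. vec_last v m') ` K1" if "w \<in> mat_kernel d'" for w
      using that Zz fl[of "0\<^sub>v n" w] ph d'
      by (intro image_eqI[of _ _ "0\<^sub>v n @\<^sub>v w"])
          (auto simp: U_def K1_def Kt_def T_def mat_kernel ph0)
    moreover have "vec_last v m' \<in> mat_kernel d'" if "v \<in> K1" for v
      using that d' by (auto simp: K1_def Kt_def T_def mat_kernel ph0)
    ultimately have im: "(\<lambda>v. vec_last v m') ` K1 = mat_kernel d'" by auto
    show ?thesis
      using subspace_dim_inj_image[OF K1, of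
          "\<lambda>v. vec_last v m'" m'] im K1U inj_last kernel_dim_subspace_dim[OF d']
      by (auto simp: last_add last_smult Uc subset_iff K1_def)
  qed
  show ?thesis using e1 e2 e3 e3' e4 e4' e5 rank_plus_kernel_dim[OF d'] by linarith
qed

section \<open>Comparison of resolutions modulo a ring element\<close>

text \<open>Congruence modulo x replaces the passage to the quotient ring by x, which is not a type:
  vectors and matrices keep their entries in the original ring.\<close>

definition vcong :: "'r::comm_ring_1 \<Rightarrow> 'r vec \<Rightarrow> 'r vec \<Rightarrow> bool" where
  "vcong x u v \<longleftrightarrow> dim_vec u = dim_vec v \<and> (\<forall>i<dim_vec v. x dvd u $ i - v $ i)"

definition mcong :: "'r::comm_ring_1 \<Rightarrow> 'r mat \<Rightarrow> 'r mat \<Rightarrow> bool" where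
  "mcong x A B \<longleftrightarrow> dim_row A = dim_row B \<and> dim_col A = dim_col B \<and>
     (\<forall>i<dim_row B. \<forall>j<dim_col B. x dvd A $$ (i, j) - B $$ (i, j))"

lemma mcong_refl [simp]: "mcong x A A"
  by (simp add: mcong_def)

lemma mcong_sym: "mcong x A B \<Longrightarrow> mcong x B A"
  by (auto simp: mcong_def) (metis dvd_minus_iff minus_diff_eq)

lemma mcong_trans [trans]:
  assumes "mcong x A B" "mcong x B C"
  shows "mcong x A C"
proof -
  have "x dvd A $$ (i, j) - C $$ (i, j)" if "i < dim_row C" "j < dim_col C" for i j
    using assms that dvd_add[of x "A $$ (i, j) - B $$ (i, j)" "B $$ (i, j) - C $$ (i, j)"]
    by (simp add: mcong_def)
  then show ?thesis using assms by (simp add: mcong_def)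
qed

lemma mcong_minus:
  assumes "mcong x A B" "mcong x C D" "dim_row A = dim_row C" "dim_col A = dim_col C"
  shows "mcong x (A - C) (B - D)"
proof -
  have "x dvd (A - C) $$ (i, j) - (B - D) $$ (i, j)" if "i < dim_row D" "j < dim_col D" for i j
    using assms that dvd_diff[of x "A $$ (i, j) - B $$ (i, j)" "C $$ (i, j) - D $$ (i, j)"]
    by (simp add: mcong_def algebra_simps)
  then show ?thesis using assms by (simp add: mcong_def)
qed

lemma mcong_mult_left:
  assumes "mcong x A B" "dim_col C = dim_row A"
  shows "mcong x (C * A) (C * B)"
proof -
  have "x dvd (C * A) $$ (i, j) - (C * B) $$ (i, j)" if "i < dim_row C" "j < dim_col B" for i j
  proof -
    have "(C * A) $$ (i, j) - (C * B) $$ (i, j) = (\<Sum>l<dim_row A. C $$ (i, l) * (A $$ (l, j) - B $$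
        (l, j)))"
      using assms that
      by (simp add: scalar_prod_def mcong_def sum_subtractf right_diff_distrib lessThan_atLeast0)
    also have "x dvd \<dots>" using assms that by (intro dvd_sum dvd_mult) (auto simp: mcong_def)
    finally show ?thesis .
  qed
  then show ?thesis using assms by (auto simp: mcong_def)
qed

lemma mcong_mult_right:
  assumes "mcong x A B" "dim_row C = dim_col A"
  shows "mcong x (A * C) (B * C)"
proof -
  have "x dvd (A * C) $$ (i, j) - (B * C) $$ (i, j)" if "i < dim_row B" "j < dim_col C" for i j
  proof -
    have "(A * C) $$ (i, j) - (B * C) $$ (i, j) = (\<Sum>l<dim_col A. (A $$ (i, l) - B $$ (i, l)) * C $$
        (l, j))"
      using assms that
      by (simp add: scalar_prod_def mcong_def sum_subtractf left_diff_distrib lessThan_atLeast0)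
    also have "x dvd \<dots>" using assms that by (intro dvd_sum dvd_mult2) (auto simp: mcong_def)
    finally show ?thesis .
  qed
  then show ?thesis using assms by (auto simp: mcong_def)
qed

lemma mcong_cols:
  assumes "A \<in> carrier_mat n k" "B \<in> carrier_mat n k" "\<And>j. j < k \<Longrightarrow> vcong x (col A j) (col B j)"
  shows "mcong x A B"
proof -
  have "x dvd A $$ (i, j) - B $$ (i, j)" if "i < n" "j < k" for i j
    using assms(1,2) assms(3)[OF that(2)] that by (auto simp: vcong_def)
  then show ?thesis using assms(1,2) by (auto simp: mcong_def)
qed

lemma vcong_col: "mcong x A B \<Longrightarrow> j < dim_col A \<Longrightarrow> vcong x (col A j) (col B j)"
  by (auto simp: mcong_def vcong_def)

text \<open>\<open>F / x F\<close> is a resolution of \<open>\<epsilon> ` P\<^bsup>b 0\<^esup>\<close>, with the ring action on it given by \<open>act\<close>.\<close>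

definition resolution_mod ::
    "'r::comm_ring_1 \<Rightarrow> ('r \<Rightarrow> 'm \<Rightarrow> 'm) \<Rightarrow> (nat \<Rightarrow> nat) \<Rightarrow> (nat \<Rightarrow> 'r mat) \<Rightarrow> ('r vec \<Rightarrow> 'm::ab_group_add) \<Rightarrow>
        bool" where
  "resolution_mod x act b D \<epsilon> \<longleftrightarrow>
     (\<forall>u\<in>carrier_vec (b 0). \<forall>v\<in>carrier_vec (b 0). \<epsilon> (u + v) = \<epsilon> u + \<epsilon> v) \<and>
     (\<forall>p. \<forall>v\<in>carrier_vec (b 0). \<epsilon> (p \<cdot>\<^sub>v v) = act p (\<epsilon> v)) \<and>
     (\<forall>i. D i \<in> carrier_mat (b i) (b (Suc i))) \<and>
     (\<forall>v\<in>carrier_vec (b 0). \<epsilon> v = 0 \<longleftrightarrow> (\<exists>u\<in>carrier_vec (b 1). vcong x v (D 0 *\<^sub>v u))) \<and>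
     (\<forall>i. \<forall>v\<in>carrier_vec (b (Suc i)). vcong x (D i *\<^sub>v v) (0\<^sub>v (b i)) \<longleftrightarrow>
        (\<exists>u\<in>carrier_vec (b (Suc (Suc i))). vcong x v (D (Suc i) *\<^sub>v u)))"

lemma vcong_refl [simp]: "vcong x v v"
  by (simp add: vcong_def)

lemma mult_mat_smult_vec:
  fixes A :: "'r::comm_ring_1 mat"
  assumes "A \<in> carrier_mat n m" "v \<in> carrier_vec m"
  shows "A *\<^sub>v (p \<cdot>\<^sub>v v) = p \<cdot>\<^sub>v (A *\<^sub>v v)"
  using assms by (intro eq_vecI) auto

lemma mat_unit_vec_col:
  fixes A :: "'r::comm_ring_1 mat"
  assumes "A \<in> carrier_mat n m" "j < m"
  shows "A *\<^sub>v unit_vec m j = col A j"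
  using assms by (intro eq_vecI) auto

text \<open>Induction on the number of leading coordinates in which a vector may be nonzero. Nothing
  is assumed about \<open>act\<close>, so that f and g vanish at 0 has to come from additivity;
  agreement on unit vectors spreads to multiples because both maps use the same
  \<open>act\<close>.\<close>

lemma linear_eqI:
  fixes f g :: "'r::comm_ring_1 vec \<Rightarrow> 'm::ab_group_add"
  assumes fa: "\<And>u v. u \<in> carrier_vec n \<Longrightarrow> v \<in> carrier_vec n \<Longrightarrow> f (u + v) = f u + f v"
    and fs: "\<And>p v. v \<in> carrier_vec n \<Longrightarrow> f (p \<cdot>\<^sub>v v) = act p (f v)"
    and ga: "\<And>u v. u \<in> carrier_vec n \<Longrightarrow> v \<in> carrier_vec n \<Longrightarrow> g (u + v) = g u + g v"
    and gs: "\<And>p v. v \<in> carrier_vec n \<Longrightarrow> g (p \<cdot>\<^sub>v v) = act p (g v)"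
    and units: "\<And>j. j < n \<Longrightarrow> f (unit_vec n j) = g (unit_vec n j)"
    and v: "v \<in> carrier_vec n"
  shows "f v = g v"
proof -
  have z: "(0\<^sub>v n :: 'r vec) = 0\<^sub>v n + 0\<^sub>v n" by auto
  have f0: "f (0\<^sub>v n) = 0" using fa[of "0\<^sub>v n" "0\<^sub>v n"] z by simp
  have g0: "g (0\<^sub>v n) = 0" using ga[of "0\<^sub>v n" "0\<^sub>v n"] z by simp
  have "\<forall>v\<in>carrier_vec n. (\<forall>j<n. k \<le> j \<longrightarrow> v $ j = 0) \<longrightarrow> f v = g v" for k
  proof (induction k)
    case 0
    have "v = 0\<^sub>v n" if "v \<in> carrier_vec n" "\<forall>j<n. v $ j = 0" for v :: "'r vec"
      using that by (intro eq_vecI) auto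
    then show ?case using f0 g0 by force
  next
    case (Suc k)
    show ?case
    proof (intro ballI impI)
      fix v :: "'r vec" assume v: "v \<in> carrier_vec n" and s: "\<forall>j<n. Suc k \<le> j \<longrightarrow> v $ j = 0"
      show "f v = g v"
      proof (cases "k < n")
        case False
        then show ?thesis using Suc v by auto
      next
        case True
        define w where "w = vec n (\<lambda>j. if j = k then 0 else v $ j)"
        have vw: "v = w + v $ k \<cdot>\<^sub>v unit_vec n k"
          using v True by (intro eq_vecI) (auto simp: w_def unit_vec_def)
        have w: "w \<in> carrier_vec n" by (simp add: w_def)
        have "f w = g w" using Suc w s by (auto simp: w_def)
        moreover have "f v = f w + act (v $ k) (f (unit_vec n k))"
            "g v = g w + act (v $ k) (g (unit_vec n k))"
          using fa[OF w, of "v $ k \<cdot>\<^sub>v unit_vec n k"] ga[OF w, of "v $ k \<cdot>\<^sub>v unit_vec n k"] vw fs gs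
              by auto
        ultimately show ?thesis using units[OF True] by simp
      qed
    qed
  qed
  from this[of n] show ?thesis using v by auto
qed

lemma mat_from_cols:
  assumes "\<And>j. j < k \<Longrightarrow> f j \<in> carrier_vec n"
  shows "\<exists>Y\<in>carrier_mat n k. \<forall>j<k. col Y j = f j"
proof (intro bexI[of _ "mat n k (\<lambda>(i, j). f j $ i)"] allI impI)
  show "mat n k (\<lambda>(i, j). f j $ i) \<in> carrier_mat n k" by simp
  show "col (mat n k (\<lambda>(i, j). f j $ i)) j = f j" if "j < k" for j
    using that assms[OF that] by (intro eq_vecI) auto
qed

context
  fixes x :: "'r::comm_ring_1" and act b D and \<epsilon> :: "'r vec \<Rightarrow> 'm::ab_group_add"
  assumes res: "resolution_mod x act b D \<epsilon>"
begin

lemma resolution_mod_carrier [simp]: "D i \<in> carrier_mat (b i) (b (Suc i))"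
  using res by (simp add: resolution_mod_def)

lemma resolution_mod_dims [simp]: "dim_row (D i) = b i" "dim_col (D i) = b (Suc i)"
  using resolution_mod_carrier[of i] by (auto simp only: carrier_matD)

lemma resolution_mod_add:
  "u \<in> carrier_vec (b 0) \<Longrightarrow> v \<in> carrier_vec (b 0) \<Longrightarrow> \<epsilon> (u + v) = \<epsilon> u + \<epsilon> v"
  using res by (simp add: resolution_mod_def)

lemma resolution_mod_smult: "v \<in> carrier_vec (b 0) \<Longrightarrow> \<epsilon> (p \<cdot>\<^sub>v v) = act p (\<epsilon> v)"
  using res by (simp add: resolution_mod_def)

text \<open>Exactness modulo x applied to each column. With its counterpart in higher degrees this
  is the lifting property of free modules, in matrix form.\<close>

lemma resolution_mod_lift0:
  assumes C: "C \<in> carrier_mat (b 0) k" and e: "\<And>j. j < k \<Longrightarrow> \<epsilon> (col C j) = 0"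
  shows "\<exists>Y\<in>carrier_mat (b 1) k. mcong x C (D 0 * Y)"
proof -
  have "\<exists>u\<in>carrier_vec (b 1). vcong x (col C j) (D 0 *\<^sub>v u)" if "j < k" for j
    using res e[OF that] C col_carrier_vec[OF that C] by (simp add: resolution_mod_def)
  then obtain f where f: "\<And>j. j < k \<Longrightarrow> f j \<in> carrier_vec (b 1) \<and> vcong x (col C j) (D 0 *\<^sub>v f j)"
    by metis
  obtain Y where Y: "Y \<in> carrier_mat (b 1) k" "\<And>j. j < k \<Longrightarrow> col Y j = f j"
    using mat_from_cols[of k f "b 1"] f by blast
  have "mcong x C (D 0 * Y)"
    by (rule mcong_cols[OF C]) (use Y f col_mult2[OF resolution_mod_carrier[of 0]] in auto)
  with Y show ?thesis by blast
qed

lemma resolution_mod_lift: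
  assumes C: "C \<in> carrier_mat (b (Suc i)) k" and e: "mcong x (D i * C) (0\<^sub>m (b i) k)"
  shows "\<exists>Y\<in>carrier_mat (b (Suc (Suc i))) k. mcong x C (D (Suc i) * Y)"
proof -
  have "\<exists>u\<in>carrier_vec (b (Suc (Suc i))). vcong x (col C j) (D (Suc i) *\<^sub>v u)" if "j < k" for j
  proof -
    have "vcong x (col (D i * C) j) (col (0\<^sub>m (b i) k) j)" using vcong_col[OF e] C that by simp
    then have "vcong x (D i *\<^sub>v col C j) (0\<^sub>v (b i))"
      using col_mult2[OF resolution_mod_carrier C that] that by simp
    then show ?thesis using res C col_carrier_vec[OF that C] by (simp add: resolution_mod_def)
  qed
  then obtain f where f: "\<And>j. j < k \<Longrightarrow> f j \<in> carrier_vec (b (Suc (Suc i)))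
      \<and> vcong x (col C j) (D (Suc i) *\<^sub>v f j)"
    by metis
  obtain Y where Y: "Y \<in> carrier_mat (b (Suc (Suc i))) k" "\<And>j. j < k \<Longrightarrow> col Y j = f j"
    using mat_from_cols[of k f "b (Suc (Suc i))"] f by blast
  have "mcong x C (D (Suc i) * Y)"
    by (rule mcong_cols[OF C]) (use Y f col_mult2[OF resolution_mod_carrier[of "Suc i"]] in auto)
  with Y show ?thesis by blast
qed

lemma resolution_mod_aug_D0: "v \<in> carrier_vec (b 1) \<Longrightarrow> \<epsilon> (D 0 *\<^sub>v v) = 0"
  using res mult_mat_vec_carrier[OF resolution_mod_carrier[of 0], of v] unfolding resolution_mod_def
  by (metis One_nat_def vcong_refl)

lemma resolution_mod_DD: "mcong x (D i * D (Suc i)) (0\<^sub>m (b i) (b (Suc (Suc i))))"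
proof (rule mcong_cols)
  fix j assume j: "j < b (Suc (Suc i))"
  have "vcong x (D i *\<^sub>v (D (Suc i) *\<^sub>v unit_vec (b (Suc (Suc i))) j)) (0\<^sub>v (b i))"
    using res unit_vec_carrier[of "b (Suc (Suc i))" j] unfolding resolution_mod_def
    by (metis mult_mat_vec_carrier vcong_refl)
  moreover have "D (Suc i) *\<^sub>v unit_vec (b (Suc (Suc i))) j = col (D (Suc i)) j"
    using mat_unit_vec_col[of "D (Suc i)"] j by auto
  ultimately show "vcong x (col (D i * D (Suc i)) j) (col (0\<^sub>m (b i) (b (Suc (Suc i)))) j)"
    using j col_mult2[OF resolution_mod_carrier[of i] resolution_mod_carrier[of "Suc i"] j] by simp
qed (auto intro!: mult_carrier_mat)

end

text \<open>Free modules lift along surjections: \<phi> 0 is chosen on unit vectors. Each later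
  matrix exists by exactness of the target modulo x, because D' i \<phi> (i+1) D (i+1) is congruent
  to \<phi> i D i D (i+1) and hence to 0.\<close>

lemma comparison_map:
  assumes F: "resolution_mod x act b D \<epsilon>" and G: "resolution_mod x act b' D' \<epsilon>'"
    and im: "\<epsilon> ` carrier_vec (b 0) \<subseteq> \<epsilon>' ` carrier_vec (b' 0)"
  shows "\<exists>\<phi>. (\<forall>i. \<phi> i \<in> carrier_mat (b' i) (b i)) \<and> (\<forall>v\<in>carrier_vec (b 0). \<epsilon>' (\<phi> 0 *\<^sub>v v) = \<epsilon> v) \<and>
    (\<forall>i. mcong x (\<phi> i * D i) (D' i * \<phi> (Suc i)))"
proof -
  note F_simps [simp] = resolution_mod_carrier[OF F] resolution_mod_dims[OF F]
    and G_simps [simp] = resolution_mod_carrier[OF G] resolution_mod_dims[OF G]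
  have "\<exists>w\<in>carrier_vec (b' 0). \<epsilon>' w = \<epsilon> (unit_vec (b 0) j)" for j
    using im unit_vec_carrier by (metis (no_types, lifting) image_iff image_subset_iff)
  then obtain f where f: "\<And>j. f j \<in> carrier_vec (b' 0)" "\<And>j. \<epsilon>' (f j) = \<epsilon> (unit_vec (b 0) j)"
      by metis
  obtain ph0 where p0: "ph0 \<in> carrier_mat (b' 0) (b 0)" "\<And>j. j < b 0 \<Longrightarrow> col ph0 j = f j"
    using mat_from_cols[of "b 0" f "b' 0"] f by blast
  have e0: "\<epsilon>' (ph0 *\<^sub>v v) = \<epsilon> v" if v: "v \<in> carrier_vec (b 0)" for v
  proof (rule linear_eqI[where f = "\<lambda>v. \<epsilon>' (ph0 *\<^sub>v v)" and g = \<epsilon> and n = "b 0" and act = act])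
    show "\<epsilon>' (ph0 *\<^sub>v (u + v)) = \<epsilon>' (ph0 *\<^sub>v u) + \<epsilon>' (ph0 *\<^sub>v v)" if "u \<in> carrier_vec (b 0)"
        "v \<in> carrier_vec (b 0)" for u v
      using p0(1) that by (simp add: mult_add_distrib_mat_vec[OF p0(1)] resolution_mod_add[OF G])
    show "\<epsilon>' (ph0 *\<^sub>v (p \<cdot>\<^sub>v v)) = act p (\<epsilon>' (ph0 *\<^sub>v v))" if "v \<in> carrier_vec (b 0)" for p v
      using p0(1) that by (simp add: mult_mat_smult_vec[OF p0(1)] resolution_mod_smult[OF G])
    show "\<epsilon>' (ph0 *\<^sub>v unit_vec (b 0) j) = \<epsilon> (unit_vec (b 0) j)" if "j < b 0" for j
      using mat_unit_vec_col[OF p0(1) that] p0(2)[OF that] f(2) by simp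
  qed (use v resolution_mod_add[OF F] resolution_mod_smult[OF F] in auto)
  have "\<exists>Y\<in>carrier_mat (b' 1) (b 1). mcong x (ph0 * D 0) (D' 0 * Y)"
  proof (rule resolution_mod_lift0[OF G])
    show "ph0 * D 0 \<in> carrier_mat (b' 0) (b 1)" using p0(1) by auto
    show "\<epsilon>' (col (ph0 * D 0) j) = 0" if "j < b 1" for j
    proof -
      have "col (D 0) j = D 0 *\<^sub>v unit_vec (b 1) j"
        using mat_unit_vec_col[of "D 0" "b 0" "b 1" j] that by auto
      then show ?thesis
        using that col_mult2[OF p0(1), of "D 0" "b 1" j] e0[of
            "col (D 0) j"] resolution_mod_aug_D0[OF F]
          mult_mat_vec_carrier[OF F_simps(1)[of 0] unit_vec_carrier[of "b (Suc 0)" j]]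
        by simp
    qed
  qed
  then obtain ph1 where p1: "ph1 \<in> carrier_mat (b' 1) (b 1)" "mcong x (ph0 * D 0) (D' 0 * ph1)"
      by blast
  \<comment> \<open>The choice runs over pairs of consecutive matrices, since the next matrix is
    built from the square relating the last two. Adjacent pairs are glued by requiring that the
    second entry of one is the first entry of the next.\<close>
  define Q where "Q = (\<lambda>i (p, q). p \<in> carrier_mat (b' i) (b i)
      \<and> q \<in> carrier_mat (b' (Suc i)) (b (Suc i)) \<and>
      mcong x (p * D i) (D' i * q))"
  have step: "\<exists>r\<in>carrier_mat (b' (Suc (Suc i))) (b (Suc (Suc i))). mcong x (q * D (Suc i)) (D' (Suc
      i) * r)"
    if p: "p \<in> carrier_mat (b' i) (b i)" and q: "q \<in> carrier_mat (b' (Suc i)) (b (Suc i))"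
      and pq: "mcong x (p * D i) (D' i * q)" for i p q
  proof (rule resolution_mod_lift[OF G])
    show "q * D (Suc i) \<in> carrier_mat (b' (Suc i)) (b (Suc (Suc i)))" using q by auto
    have "D' i * (q * D (Suc i)) = (D' i * q) * D (Suc i)"
      by (rule assoc_mult_mat[symmetric, OF _ q]) auto
    also have "mcong x \<dots> ((p * D i) * D (Suc i))"
      by (rule mcong_mult_right[OF mcong_sym[OF pq]]) (use q in auto)
    also have "(p * D i) * D (Suc i) = p * (D i * D (Suc i))" by (rule assoc_mult_mat[OF p]) auto
    also have "mcong x \<dots> (p * 0\<^sub>m (b i) (b (Suc (Suc i))))"
      by (rule mcong_mult_left[OF resolution_mod_DD[OF F]]) (use p in auto)
    also have "p * 0\<^sub>m (b i) (b (Suc (Suc i))) = 0\<^sub>m (b' i) (b (Suc (Suc i)))" using p by auto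
    finally show "mcong x (D' i * (q * D (Suc i))) (0\<^sub>m (b' i) (b (Suc (Suc i))))" .
  qed
  have "\<exists>F. \<forall>i. (Q i (F i) \<and> (i = 0 \<longrightarrow> F i = (ph0, ph1))) \<and> snd (F i) = fst (F (Suc i))"
  proof (rule dependent_nat_choice)
    show "\<exists>y. Q 0 y \<and> (0 = 0 \<longrightarrow> y = (ph0, ph1))" using p0 p1 by (auto simp: Q_def)
    show "\<exists>z. (Q (Suc i) z \<and> (Suc i = 0 \<longrightarrow> z = (ph0, ph1))) \<and> snd y = fst z"
      if "Q i y \<and> (i = 0 \<longrightarrow> y = (ph0, ph1))" for y i
      using that step[of "fst y" i "snd y"] by (auto simp: Q_def split: prod.splits)
  qed
  then obtain F where F: "\<And>i. Q i (F i)" "F 0 = (ph0, ph1)" "\<And>i. snd (F i) = fst (F (Suc i))"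
      by blast
  show ?thesis
    by (rule exI[of _ "\<lambda>i. fst (F i)"])
        (use F(1,2) e0 in \<open>auto simp: Q_def F(3)[symmetric] case_prod_unfold\<close>)
qed

text \<open>The usual degree-by-degree construction of a homotopy, with exactness available only
  modulo x. Applied to \<psi> \<phi> - 1 it shows that comparison maps are inverse up to
  homotopy.\<close>

lemma null_homotopy:
  assumes F: "resolution_mod x act b D \<epsilon>"
    and \<theta>: "\<And>i. \<theta> i \<in> carrier_mat (b i) (b i)" and \<epsilon>\<theta>:
        "\<And>v. v \<in> carrier_vec (b 0) \<Longrightarrow> \<epsilon> (\<theta> 0 *\<^sub>v v) = 0"
    and chain: "\<And>i. mcong x (\<theta> i * D i) (D i * \<theta> (Suc i))"
  shows "\<exists>h. (\<forall>i. h i \<in> carrier_mat (b (Suc i)) (b i)) \<and> mcong x (\<theta> 0) (D 0 * h 0) \<and>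
    (\<forall>i. mcong x (\<theta> (Suc i) - h i * D i) (D (Suc i) * h (Suc i)))"
proof -
  note F_simps [simp] = resolution_mod_carrier[OF F] resolution_mod_dims[OF F]
  note [simp] = \<theta>
  have [simp]: "dim_row (\<theta> i) = b i" "dim_col (\<theta> i) = b i" for i using \<theta>[of i] by
      (auto simp only: carrier_matD)
  have "\<exists>Y\<in>carrier_mat (b 1) (b 0). mcong x (\<theta> 0) (D 0 * Y)"
  proof (rule resolution_mod_lift0[OF F])
    show "\<epsilon> (col (\<theta> 0) j) = 0" if "j < b 0" for j
      using mat_unit_vec_col[OF \<theta>[of 0] that] \<epsilon>\<theta>[of "unit_vec (b 0) j"] by simp
  qed simp
  then obtain h0 where h0: "h0 \<in> carrier_mat (b 1) (b 0)" "mcong x (\<theta> 0) (D 0 * h0)" by blast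
  \<comment> \<open>The congruence is what makes \<theta> (i+1) - h D i a cycle, so the next choice
    depends on the current h alone. It reproduces itself: \<theta> (i+1) - D (i+1) h' is congruent
    to h D i, and D i D (i+1) to 0.\<close>
  define Q where "Q = (\<lambda>i h. h \<in> carrier_mat (b (Suc i)) (b i) \<and>
     mcong x ((\<theta> i - D i * h) * D i) (0\<^sub>m (b i) (b (Suc i))) \<and> (i = 0 \<longrightarrow> h = h0))"
  have "\<exists>h. \<forall>i. Q i (h i) \<and> mcong x (\<theta> (Suc i) - h i * D i) (D (Suc i) * h (Suc i))"
  proof (rule dependent_nat_choice)
    have "mcong x (\<theta> 0 - D 0 * h0) (D 0 * h0 - D 0 * h0)"
      by (rule mcong_minus[OF h0(2)]) (use h0(1) in auto)
    also have "D 0 * h0 - D 0 * h0 = 0\<^sub>m (b 0) (b 0)" using h0(1) by (intro minus_r_inv_mat) auto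
    finally have "mcong x ((\<theta> 0 - D 0 * h0) * D 0) (0\<^sub>m (b 0) (b 0) * D 0)"
      by (rule mcong_mult_right) (use h0(1) in auto)
    then show "\<exists>h. Q 0 h" using h0(1) by (auto simp: Q_def intro!: exI[of _ h0])
  next
    fix h i assume "Q i h"
    then have h: "h \<in> carrier_mat (b (Suc i)) (b i)" and hz:
        "mcong x ((\<theta> i - D i * h) * D i) (0\<^sub>m (b i) (b (Suc i)))"
      by (auto simp: Q_def)
    let ?C = "\<theta> (Suc i) - h * D i"
    have C: "?C \<in> carrier_mat (b (Suc i)) (b (Suc i))" using h by auto
    have "D i * ?C = D i * \<theta> (Suc i) - D i * (h * D i)"
      by (rule mult_minus_distrib_mat) (use h in auto)
    also have "mcong x \<dots> (\<theta> i * D i - D i * (h * D i))"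
      by (intro mcong_minus mcong_sym[OF chain]) (use h in auto)
    also have "\<theta> i * D i - D i * (h * D i) = \<theta> i * D i - (D i * h) * D i"
      using assoc_mult_mat[OF _ h, of "D i" "b i" "D i" "b (Suc i)"] by simp
    also have "\<dots> = (\<theta> i - D i * h) * D i"
      by (rule minus_mult_distrib_mat[symmetric]) (use h in auto)
    also note hz
    finally obtain h' where h': "h' \<in> carrier_mat (b (Suc (Suc i))) (b (Suc i))" and hh:
        "mcong x ?C (D (Suc i) * h')"
      using resolution_mod_lift[OF F C] by blast
    let ?j = "Suc i"
    have "mcong x (\<theta> ?j - D ?j * h') (\<theta> ?j - ?C)"
      by (rule mcong_minus[OF mcong_refl mcong_sym[OF hh]]) (use h' in auto)
    also have "\<theta> ?j - ?C = h * D i" using h by (intro eq_matI) auto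
    finally have "mcong x ((\<theta> ?j - D ?j * h') * D ?j) ((h * D i) * D ?j)"
      by (rule mcong_mult_right) (use h' in auto)
    also have "(h * D i) * D ?j = h * (D i * D ?j)" by (rule assoc_mult_mat[OF h]) auto
    also have "mcong x \<dots> (h * 0\<^sub>m (b i) (b (Suc ?j)))"
      by (rule mcong_mult_left[OF resolution_mod_DD[OF F]]) (use h in auto)
    also have "\<dots> = 0\<^sub>m (b ?j) (b (Suc ?j))" using h by auto
    finally show "\<exists>y. Q (Suc i) y \<and> mcong x (\<theta> (Suc i) - h * D i) (D (Suc i) * y)"
      using h' hh by (auto simp: Q_def)
  qed
  then show ?thesis using h0(2) by (auto simp: Q_def)
qed

section \<open>Reduction of matrices over P to the residue field\<close>

lemma mult_mat_zero_vec:
  fixes A :: "'r::comm_ring_1 mat"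
  assumes "A \<in> carrier_mat n m"
  shows "A *\<^sub>v 0\<^sub>v m = 0\<^sub>v n"
  using assms by (intro eq_vecI) auto

text \<open>Exponent vectors of naturals add up to 0 only if both are 0, so no other terms
  contribute.\<close>

lemma lookup_mult_0:
  fixes p q :: "('n::finite, 'k::field) pring"
  shows "Poly_Mapping.lookup (p * q) 0 = Poly_Mapping.lookup p 0 * Poly_Mapping.lookup q 0"
proof -
  have z: "0 = l + m \<longleftrightarrow> l = 0 \<and> m = 0" for l m :: "'n \<Rightarrow>\<^sub>0 nat"
    by (auto simp: poly_mapping_eq_iff lookup_add fun_eq_iff)
  have "(\<Sum>m. Poly_Mapping.lookup q m when 0 = l + m) = (Poly_Mapping.lookup q 0 when l = 0)"
      for l :: "'n \<Rightarrow>\<^sub>0 nat"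
    by (simp add: z when_def[abs_def] Sum_any.expand_set)
  then show ?thesis by (simp add: lookup_mult mult_when)
qed

lemma lookup_0_hom: "comm_ring_hom (\<lambda>p :: ('n::finite, 'k::field) pring. Poly_Mapping.lookup p 0)"
  by unfold_locales (simp_all add: lookup_add lookup_mult_0)

lemma mod_variables_mult:
  fixes A B :: "('n::finite, 'k::field) pring mat"
  assumes "A \<in> carrier_mat n m" "B \<in> carrier_mat m l"
  shows "mod_variables (A * B) = mod_variables A * mod_variables B"
proof -
  interpret comm_ring_hom "\<lambda>p :: ('n::finite, 'k::field) pring. Poly_Mapping.lookup p 0" by
      (rule lookup_0_hom)
  show ?thesis unfolding mod_variables_def by (rule mat_hom_mult[OF assms])
qed

lemma mod_variables_dims [simp]:
  "dim_row (mod_variables A) = dim_row A" "dim_col (mod_variables A) = dim_col A"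
  by (simp_all add: mod_variables_def)

lemma mod_variables_carrier [simp]: "mod_variables A \<in> carrier_mat n m \<longleftrightarrow> A \<in> carrier_mat n m"
  by (simp add: mod_variables_def)

text \<open>Here the ambiguity modulo x disappears: an element without constant term, and all its
  multiples, are killed on passing to k.\<close>

lemma mod_variables_mcong:
  assumes "mcong x A B" "Poly_Mapping.lookup x 0 = 0"
  shows "mod_variables A = mod_variables B"
proof (rule eq_matI)
  fix i j assume "i < dim_row (mod_variables B)" "j < dim_col (mod_variables B)"
  moreover from this have "x dvd A $$ (i, j) - B $$ (i, j)"
    using assms(1) by (simp add: mcong_def)
  then obtain c where "A $$ (i, j) - B $$ (i, j) = x * c" by (elim dvdE)
  then have "Poly_Mapping.lookup (A $$ (i, j) - B $$ (i, j)) 0 = 0"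
    using assms(2) by (simp add: lookup_mult_0)
  ultimately show "mod_variables A $$ (i, j) = mod_variables B $$ (i, j)"
    using assms(1) by (auto simp: mod_variables_def mcong_def lookup_minus)
qed (use assms(1) in \<open>auto simp: mcong_def\<close>)

lemma mod_variables_minus:
  assumes "A \<in> carrier_mat n m" "B \<in> carrier_mat n m"
  shows "mod_variables (A - B) = mod_variables A - mod_variables B"
  using assms by (intro eq_matI) (auto simp: mod_variables_def lookup_minus)

lemma mod_variables_one [simp]: "mod_variables (1\<^sub>m n) = 1\<^sub>m n"
  by (intro eq_matI) (auto simp: mod_variables_def)

text \<open>\<psi> \<phi> - 1 is null homotopic modulo x, hence honestly null homotopic over k, and
  this makes \<phi> injective on homology. One inequality is enough, as the hypotheses are symmetric
  in the two resolutions.\<close>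

lemma homology_dim_le_comparison:
  fixes x :: "('n::finite, 'k::field) pring"
  assumes F: "resolution_mod x act b D \<epsilon>" and G: "resolution_mod x act b' D' \<epsilon>'"
    and im: "\<epsilon> ` carrier_vec (b 0) = \<epsilon>' ` carrier_vec (b' 0)"
    and x: "Poly_Mapping.lookup x 0 = 0"
  shows "homology_dim b D i \<le> homology_dim b' D' i"
proof -
  note cF [simp] = resolution_mod_carrier[OF F] and dF [simp] = resolution_mod_dims[OF F]
  note cG [simp] = resolution_mod_carrier[OF G] and dG [simp] = resolution_mod_dims[OF G]
  obtain \<phi> where cphi [simp]: "\<And>i. \<phi> i \<in> carrier_mat (b' i) (b i)" and phi0:
      "\<And>v. v \<in> carrier_vec (b 0) \<Longrightarrow> \<epsilon>' (\<phi> 0 *\<^sub>v v) = \<epsilon> v"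
    and phi: "\<And>i. mcong x (\<phi> i * D i) (D' i * \<phi> (Suc i))"
    using comparison_map[OF F G] im by auto
  obtain \<psi> where cpsi [simp]: "\<And>i. \<psi> i \<in> carrier_mat (b i) (b' i)" and psi0:
      "\<And>v. v \<in> carrier_vec (b' 0) \<Longrightarrow> \<epsilon> (\<psi> 0 *\<^sub>v v) = \<epsilon>' v"
    and psi: "\<And>i. mcong x (\<psi> i * D' i) (D i * \<psi> (Suc i))"
    using comparison_map[OF G F] im by auto
  have dphi [simp]: "dim_row (\<phi> i) = b' i" "dim_col (\<phi> i) = b i" for i using cphi[of i] by
      (auto simp only: carrier_matD)
  have dpsi [simp]: "dim_row (\<psi> i) = b i" "dim_col (\<psi> i) = b' i" for i using cpsi[of i] by
      (auto simp only: carrier_matD)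
  define \<theta> where "\<theta> = (\<lambda>i. \<psi> i * \<phi> i - 1\<^sub>m (b i))"
  have ct [simp]: "\<theta> i \<in> carrier_mat (b i) (b i)" for i by (simp add: \<theta>_def carrier_matI)
  have "\<epsilon> (\<theta> 0 *\<^sub>v v) = 0" if v: "v \<in> carrier_vec (b 0)" for v
  proof -
    have c: "\<psi> 0 *\<^sub>v (\<phi> 0 *\<^sub>v v) \<in> carrier_vec (b 0)" by
        (rule mult_mat_vec_carrier[OF cpsi mult_mat_vec_carrier[OF cphi v]])
    have "\<theta> 0 *\<^sub>v v = \<psi> 0 *\<^sub>v (\<phi> 0 *\<^sub>v v) - v"
      using v by (simp add: \<theta>_def minus_mult_distrib_mat_vec[of _ "b 0"
          "b 0"] assoc_mult_mat_vec[OF cpsi cphi v] carrier_matI)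
    then have "\<theta> 0 *\<^sub>v v + v = \<psi> 0 *\<^sub>v (\<phi> 0 *\<^sub>v v)" using v c by auto
    moreover have "\<epsilon> (\<theta> 0 *\<^sub>v v + v) = \<epsilon> (\<theta> 0 *\<^sub>v v) + \<epsilon> v"
      by (rule resolution_mod_add[OF F _ v]) (rule mult_mat_vec_carrier[OF ct v])
    ultimately show ?thesis using psi0[OF mult_mat_vec_carrier[OF cphi v]] phi0[OF v] by simp
  qed
  moreover have "mcong x (\<theta> i * D i) (D i * \<theta> (Suc i))" for i
  proof -
    have "\<theta> i * D i = (\<psi> i * \<phi> i) * D i - 1\<^sub>m (b i) * D i"
      unfolding \<theta>_def by (rule minus_mult_distrib_mat) (auto simp: carrier_matI)
    also have "(\<psi> i * \<phi> i) * D i = \<psi> i * (\<phi> i * D i)" by (rule assoc_mult_mat[OF cpsi cphi cF])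
    also have "mcong x (\<psi> i * (\<phi> i * D i) - 1\<^sub>m (b i) * D i) (D i * (\<psi> (Suc i) * \<phi> (Suc i)) - D i *
        1\<^sub>m (b (Suc i)))"
    proof (rule mcong_minus)
      have "mcong x (\<psi> i * (\<phi> i * D i)) (\<psi> i * (D' i * \<phi> (Suc i)))"
        by (rule mcong_mult_left[OF phi]) simp
      also have "\<psi> i * (D' i * \<phi> (Suc i)) = (\<psi> i * D' i) * \<phi> (Suc i)" by
          (rule assoc_mult_mat[OF cpsi cG cphi, symmetric])
      also have "mcong x \<dots> ((D i * \<psi> (Suc i)) * \<phi> (Suc i))" by (rule mcong_mult_right[OF psi]) simp
      also have "\<dots> = D i * (\<psi> (Suc i) * \<phi> (Suc i))" by (rule assoc_mult_mat[OF cF cpsi cphi])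
      finally show "mcong x (\<psi> i * (\<phi> i * D i)) (D i * (\<psi> (Suc i) * \<phi> (Suc i)))" .
      show "mcong x (1\<^sub>m (b i) * D i) (D i * 1\<^sub>m (b (Suc i)))"
        using left_mult_one_mat[OF cF] right_mult_one_mat[OF cF] by simp
    qed auto
    also have "D i * (\<psi> (Suc i) * \<phi> (Suc i)) - D i * 1\<^sub>m (b (Suc i)) = D i * \<theta> (Suc i)"
      unfolding \<theta>_def by (rule mult_minus_distrib_mat[symmetric, OF cF]) (auto simp: carrier_matI)
    finally show ?thesis .
  qed
  ultimately obtain h where ch [simp]: "\<And>i. h i \<in> carrier_mat (b (Suc i)) (b i)" and h0:
      "mcong x (\<theta> 0) (D 0 * h 0)"
    and hS: "\<And>i. mcong x (\<theta> (Suc i) - h i * D i) (D (Suc i) * h (Suc i))"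
    using null_homotopy[OF F, of \<theta>] ct by blast
  let ?d = "\<lambda>i. mod_variables (D i)" and ?d' = "\<lambda>i. mod_variables (D' i)"
  let ?p = "\<lambda>i. mod_variables (\<phi> i)" and ?q = "\<lambda>i. mod_variables (\<psi> i)" and ?h =
      "\<lambda>i. mod_variables (h i)"
  have c: "?d i \<in> carrier_mat (b i) (b (Suc i))" "?d' i \<in> carrier_mat (b' i) (b' (Suc i))"
      "?p i \<in> carrier_mat (b' i) (b i)"
    "?q i \<in> carrier_mat (b i) (b' i)" "?h i \<in> carrier_mat (b (Suc i)) (b i)" for i by simp_all
  have pd: "?p i * ?d i = ?d' i * ?p (Suc i)" for i
    using mod_variables_mcong[OF phi x, of i] by
        (simp add: mod_variables_mult[OF cphi cF] mod_variables_mult[OF cG cphi])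
  have qd: "?q i * ?d' i = ?d i * ?q (Suc i)" for i
    using mod_variables_mcong[OF psi x, of i] by
        (simp add: mod_variables_mult[OF cpsi cG] mod_variables_mult[OF cF cpsi])
  have dd': "?d' i * ?d' (Suc i) = 0\<^sub>m (b' i) (b' (Suc (Suc i)))" for i
  proof -
    have "mod_variables (D' i * D' (Suc i)) =
      mod_variables (0\<^sub>m (b' i) (b' (Suc (Suc i))) :: ('n, 'k) pring mat)"
      by (rule mod_variables_mcong[OF resolution_mod_DD[OF G] x])
    also have "\<dots> = 0\<^sub>m (b' i) (b' (Suc (Suc i)))" by (intro eq_matI) (auto simp: mod_variables_def)
    finally show ?thesis by (simp add: mod_variables_mult[OF cG cG])
  qed
  have t: "mod_variables (\<theta> i) = ?q i * ?p i - 1\<^sub>m (b i)" for i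
    by (simp add: \<theta>_def mod_variables_minus[of _ "b i"
        "b i"] mod_variables_mult[OF cpsi cphi] carrier_matI)
  \<comment> \<open>Write z = \<psi> \<phi> z - \<theta> z. If \<phi> z = d' w and \<theta> z = d h
    z, then \<psi> d' w = d \<psi> w gives z = d (\<psi> w - h z).\<close>
  have boundary: "z \<in> (\<lambda>v. ?d i *\<^sub>v v) ` carrier_vec (b (Suc i))"
    if z: "z \<in> carrier_vec (b i)" and w: "w \<in> carrier_vec (b' (Suc i))" and pz:
        "?p i *\<^sub>v z = ?d' i *\<^sub>v w"
      and hz: "mod_variables (\<theta> i) *\<^sub>v z = ?d i *\<^sub>v (?h i *\<^sub>v z)" for i z w
  proof -
    have "mod_variables (\<theta> i) *\<^sub>v z = ?q i *\<^sub>v (?p i *\<^sub>v z) - z"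
      using z c by (simp add: t minus_mult_distrib_mat_vec[of _ "b i"
          "b i"] assoc_mult_mat_vec[OF c(4) c(3) z] carrier_matI)
    also have "?q i *\<^sub>v (?p i *\<^sub>v z) = (?q i * ?d' i) *\<^sub>v w"
        using pz assoc_mult_mat_vec[OF c(4) c(2) w] by simp
    also have "\<dots> = ?d i *\<^sub>v (?q (Suc i) *\<^sub>v w)" using qd assoc_mult_mat_vec[OF c(1) c(4) w] by simp
    finally have e: "?d i *\<^sub>v (?q (Suc i) *\<^sub>v w) - z = ?d i *\<^sub>v (?h i *\<^sub>v z)" using hz by simp
    have cc: "?q (Suc i) *\<^sub>v w \<in> carrier_vec (b (Suc i))" "?h i *\<^sub>v z \<in> carrier_vec (b (Suc i))"
      using mult_mat_vec_carrier[OF c(4) w] mult_mat_vec_carrier[OF c(5) z] by simp_all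
    have "z = ?d i *\<^sub>v (?q (Suc i) *\<^sub>v w) - (?d i *\<^sub>v (?q (Suc i) *\<^sub>v w) - z)"
      using z mult_mat_vec_carrier[OF c(1) cc(1)] by (intro eq_vecI) auto
    also have "\<dots> = ?d i *\<^sub>v (?q (Suc i) *\<^sub>v w - ?h i *\<^sub>v z)"
      unfolding e by (rule mult_minus_distrib_mat_vec[symmetric, OF c(1) cc])
    finally show ?thesis using cc by auto
  qed
  show ?thesis
  proof (cases i)
    case 0
    have "subspace_dim (b 0) (carrier_vec (b 0) :: 'k vec set) + vec_space.rank (b' 0) (?d' 0)
      \<le> subspace_dim (b' 0) (carrier_vec (b' 0) :: 'k vec set) + vec_space.rank (b 0) (?d 0)"
    proof (rule homology_dim_le[OF lin_subspace_carrier lin_subspace_carrier c(1) c(2) _ c(3)])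
      show "(\<lambda>v. ?d' 0 *\<^sub>v v) ` carrier_vec (b' (Suc 0)) \<subseteq> carrier_vec (b' 0)"
        using mult_mat_vec_carrier[OF c(2)[of 0]] by auto
      show "?p 0 *\<^sub>v z \<in> carrier_vec (b' 0)" if "z \<in> carrier_vec (b 0)" for z
        by (rule mult_mat_vec_carrier[OF c(3) that])
      show "z \<in> (\<lambda>v. ?d 0 *\<^sub>v v) ` carrier_vec (b (Suc 0))"
        if z: "z \<in> carrier_vec (b 0)" and pz:
            "?p 0 *\<^sub>v z \<in> (\<lambda>v. ?d' 0 *\<^sub>v v) ` carrier_vec (b' (Suc 0))" for z
      proof -
        have "mod_variables (\<theta> 0) = ?d 0 * ?h 0"
          using mod_variables_mcong[OF h0 x] by (simp add: mod_variables_mult[OF cF ch])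
        then have "mod_variables (\<theta> 0) *\<^sub>v z = ?d 0 *\<^sub>v (?h 0 *\<^sub>v z)"
          using assoc_mult_mat_vec[OF c(1) c(5) z] by simp
        then show ?thesis using boundary[OF z] pz by blast
      qed
    qed
    \<comment> \<open>\<open>homology_dim\<close> subtracts natural numbers; this bound is what
      turns the additive inequality into one between truncated differences.\<close>
    moreover have "vec_space.rank (b' 0) (?d' 0) \<le> b' 0"
      using subspace_dim_mono[OF lin_subspace_image[OF c(2)] lin_subspace_carrier, of 0]
          mult_mat_vec_carrier[OF c(2)[of 0]]
      by (auto simp: rank_subspace_dim[OF c(2)])
    ultimately show ?thesis using 0 by simp
  next
    case (Suc j)
    have sub: "(\<lambda>v. ?d' (Suc j) *\<^sub>v v) ` carrier_vec (b' (Suc (Suc j))) \<subseteq> mat_kernel (?d' j)"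
    proof (clarify)
      fix v :: "'k vec" assume v: "v \<in> carrier_vec (b' (Suc (Suc j)))"
      have "?d' j *\<^sub>v (?d' (Suc j) *\<^sub>v v) = (?d' j * ?d' (Suc j)) *\<^sub>v v"
        using assoc_mult_mat_vec[OF c(2) c(2) v] by simp
      also have "\<dots> = 0\<^sub>v (b' j)" unfolding dd' using v by (intro eq_vecI) auto
      finally show "?d' (Suc j) *\<^sub>v v \<in> mat_kernel (?d' j)"
        by (rule mat_kernelI[OF c(2) mult_mat_vec_carrier[OF c(2) v]])
    qed
    have "subspace_dim (b (Suc j)) (mat_kernel (?d j)) + vec_space.rank (b' (Suc j)) (?d' (Suc j))
      \<le> subspace_dim (b' (Suc j)) (mat_kernel (?d' j)) + vec_space.rank (b (Suc j)) (?d (Suc j))"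
    proof (rule homology_dim_le[OF lin_subspace_kernel[OF c(1)] lin_subspace_kernel[OF c(2)] c(1)
        c(2) _ c(3)])
      show "(\<lambda>v. ?d' (Suc j) *\<^sub>v v) ` carrier_vec (b' (Suc (Suc j))) \<subseteq> mat_kernel (?d' j)" by
          (rule sub)
      show "?p (Suc j) *\<^sub>v z \<in> mat_kernel (?d' j)" if "z \<in> mat_kernel (?d j)" for z
      proof -
        note z = mat_kernelD[OF c(1) that]
        have "?d' j *\<^sub>v (?p (Suc j) *\<^sub>v z) = (?p j * ?d j) *\<^sub>v z"
          using assoc_mult_mat_vec[OF c(2) c(3) z(1)] by (simp add: pd)
        also have "\<dots> = 0\<^sub>v (b' j)" using assoc_mult_mat_vec[OF c(3) c(1) z(1)] z(2)
            mult_mat_zero_vec[OF c(3)] by simp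
        finally show ?thesis by (rule mat_kernelI[OF c(2) mult_mat_vec_carrier[OF c(3) z(1)]])
      qed
      show "z \<in> (\<lambda>v. ?d (Suc j) *\<^sub>v v) ` carrier_vec (b (Suc (Suc j)))"
        if zk: "z \<in> mat_kernel (?d j)" and pz:
            "?p (Suc j) *\<^sub>v z \<in> (\<lambda>v. ?d' (Suc j) *\<^sub>v v) ` carrier_vec (b' (Suc (Suc j)))" for z
      proof -
        note z = mat_kernelD[OF c(1) zk]
        have hd: "h j * D j \<in> carrier_mat (b (Suc j)) (b (Suc j))" by
            (rule mult_carrier_mat[OF ch cF])
        have mt: "mod_variables (\<theta> (Suc j)) \<in> carrier_mat (b (Suc j)) (b (Suc j))" by simp
        have "mod_variables (\<theta> (Suc j)) - ?h j * ?d j = ?d (Suc j) * ?h (Suc j)"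
          using mod_variables_mcong[OF hS x, of j]
          by (simp add: mod_variables_minus[OF ct hd] mod_variables_mult[OF ch cF]
              mod_variables_mult[OF cF ch])
        then have "(mod_variables (\<theta> (Suc j)) - ?h j * ?d j) *\<^sub>v z
            = ?d (Suc j) *\<^sub>v (?h (Suc j) *\<^sub>v z)"
          using assoc_mult_mat_vec[OF c(1) c(5) z(1)] by simp
        moreover have "(mod_variables (\<theta> (Suc j)) - ?h j * ?d j) *\<^sub>v z
            = mod_variables (\<theta> (Suc j)) *\<^sub>v z - (?h j * ?d j) *\<^sub>v z"
          by (rule minus_mult_distrib_mat_vec[OF mt mult_carrier_mat[OF c(5) c(1)] z(1)])
        \<comment> \<open>The other half of the homotopy, h d z, vanishes because z is a
          cycle.\<close>
        moreover have "(?h j * ?d j) *\<^sub>v z = 0\<^sub>v (b (Suc j))"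
          using assoc_mult_mat_vec[OF c(5) c(1) z(1)] z(2) mult_mat_zero_vec[OF c(5)] by simp
        moreover have "mod_variables (\<theta> (Suc j)) *\<^sub>v z - 0\<^sub>v (b (Suc j))
            = mod_variables (\<theta> (Suc j)) *\<^sub>v z"
          using mult_mat_vec_carrier[OF mt z(1)] by auto
        ultimately have "mod_variables (\<theta> (Suc j)) *\<^sub>v z = ?d (Suc j) *\<^sub>v (?h (Suc j) *\<^sub>v z)"
            by simp
        then show ?thesis using boundary[OF z(1)] pz by blast
      qed
    qed
    moreover have "vec_space.rank (b' (Suc j)) (?d' (Suc j)) \<le> subspace_dim (b' (Suc j)) (mat_kernel
        (?d' j))"
      unfolding rank_subspace_dim[OF c(2)]
      by (rule subspace_dim_mono[OF lin_subspace_image[OF c(2)] lin_subspace_kernel[OF c(2)] sub])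
    ultimately show ?thesis using Suc by
        (simp add: kernel_dim_subspace_dim[OF c(1)] kernel_dim_subspace_dim[OF c(2)])
  qed
qed

section \<open>Finite generation of submodules of free modules over the polynomial ring\<close>

lemma nat_seq_incseq_subseq:
  fixes f :: "nat \<Rightarrow> nat"
  shows "\<exists>r :: nat \<Rightarrow> nat. strict_mono r \<and> incseq (\<lambda>k. f (r k))"
proof -
  obtain r :: "nat \<Rightarrow> nat" where r: "strict_mono r" "monoseq (\<lambda>k. f (r k))"
    using seq_monosub[of f] by (auto simp: o_def)
  show ?thesis
  proof (cases "incseq (\<lambda>k. f (r k))")
    case False
    \<comment> \<open>A decreasing sequence of naturals is constant from the index of its least
      value on, and the constant tail is also nondecreasing.\<close>
    then have dec: "decseq (\<lambda>k. f (r k))" using r(2) by (simp add: monoseq_iff)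
    obtain k0 where k0: "\<And>k. f (r k0) \<le> f (r k)"
      using ex_has_least_nat[of "\<lambda>_. True" _ "\<lambda>k. f (r k)"] by auto
    have "f (r (k0 + k)) = f (r k0)" for k
      using k0[of "k0 + k"] decseqD[OF dec, of k0 "k0 + k"] by simp
    moreover have "strict_mono (\<lambda>k. r (k0 + k))" using r(1) by (simp add: strict_mono_def)
    ultimately show ?thesis by (intro exI[of _ "\<lambda>k. r (k0 + k)"]) (auto simp: incseq_def)
  qed (use r in blast)
qed

lemma finite_family_incseq_subseq:
  fixes f :: "nat \<Rightarrow> 'a \<Rightarrow> nat"
  assumes "finite A"
  shows "\<exists>r :: nat \<Rightarrow> nat. strict_mono r \<and> (\<forall>i\<in>A. incseq (\<lambda>k. f (r k) i))"
  using assms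
proof induction
  case empty
  show ?case by (rule exI[of _ id]) (simp add: strict_mono_def)
next
  case (insert a A)
  then obtain r :: "nat \<Rightarrow> nat" where r: "strict_mono r" "\<forall>i\<in>A. incseq (\<lambda>k. f (r k) i)" by blast
  obtain q :: "nat \<Rightarrow> nat" where q: "strict_mono q" "incseq (\<lambda>k. f (r (q k)) a)"
    using nat_seq_incseq_subseq[of "\<lambda>k. f (r k) a"] by blast
  have "incseq (\<lambda>k. f (r (q k)) i)" if "i \<in> A" for i
    using r(2) that q(1) by (auto simp: incseq_def strict_mono_less_eq)
  then show ?case using q r(1)
    by (intro exI[of _ "\<lambda>k. r (q k)"]) (auto simp: strict_mono_def)
qed

text \<open>B consists of the componentwise minimal members of L. An infinite B would contain two
  distinct comparable members, by extracting a subsequence that is nondecreasing in every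
  coordinate. Below a given m, a member of L of least total degree is minimal.\<close>

lemma dickson:
  fixes L :: "('n::finite \<Rightarrow>\<^sub>0 nat) set"
  shows "\<exists>B\<subseteq>L. finite B \<and> (\<forall>m\<in>L. \<exists>b\<in>B. \<forall>i. Poly_Mapping.lookup b i \<le> Poly_Mapping.lookup m i)"
proof -
  define le where "le = (\<lambda>b m :: 'n \<Rightarrow>\<^sub>0 nat. \<forall>i. Poly_Mapping.lookup b i \<le> Poly_Mapping.lookup m i)"
  define B where "B = {b \<in> L. \<forall>l\<in>L. le l b \<longrightarrow> l = b}"
  have "finite B"
  proof (rule ccontr)
    assume "infinite B"
    then obtain f :: "nat \<Rightarrow> 'n \<Rightarrow>\<^sub>0 nat" where f: "inj f" "range f \<subseteq> B"
      using infinite_countable_subset by blast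
    obtain r :: "nat \<Rightarrow> nat" where r: "strict_mono r"
        "\<forall>i\<in>UNIV. incseq (\<lambda>k. Poly_Mapping.lookup (f (r k)) i)"
      using finite_family_incseq_subseq[of UNIV "\<lambda>k. Poly_Mapping.lookup (f k)"] by auto
    have "le (f (r 0)) (f (r 1))" using r(2) by (auto simp: le_def incseq_def)
    moreover have "f (r 0) \<in> B" "f (r 1) \<in> B" using f(2) by auto
    ultimately have "f (r 0) = f (r 1)" by (auto simp: B_def)
    then show False using f(1) r(1) by (auto dest!: injD simp: strict_mono_eq)
  qed
  moreover have "\<exists>b\<in>B. le b m" if m: "m \<in> L" for m
  proof -
    let ?s = "\<lambda>l. \<Sum>i\<in>UNIV. Poly_Mapping.lookup l i"
    obtain b where b: "b \<in> L" "le b m" "\<And>l. l \<in> L \<Longrightarrow> le l m \<Longrightarrow> ?s b \<le> ?s l"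
      using ex_has_least_nat[of "\<lambda>l. l \<in> L \<and> le l m" m ?s] m by (auto simp: le_def)
    have "l = b" if l: "l \<in> L" "le l b" for l
    proof (rule ccontr)
      assume "l \<noteq> b"
      then obtain i where "Poly_Mapping.lookup l i \<noteq> Poly_Mapping.lookup b i"
        using poly_mapping_eqI[of l b] by blast
      then have "Poly_Mapping.lookup l i < Poly_Mapping.lookup b i"
        using l(2) by (simp add: le_def order.strict_iff_order)
      then have "?s l < ?s b" using l(2) by (intro sum_strict_mono_ex1) (auto simp: le_def)
      moreover have "le l m" using l(2) b(2) by (auto simp: le_def intro: order_trans)
      ultimately show False using b(3)[OF l(1)] by simp
    qed
    then show ?thesis using b by (auto simp: B_def)
  qed
  ultimately show ?thesis by (intro exI[of _ B]) (auto simp: B_def le_def)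
qed

section \<open>Lexicographic order on exponents and on terms of vectors\<close>

definition lex_less :: "('n \<Rightarrow> nat) \<Rightarrow> ('n \<Rightarrow>\<^sub>0 nat) \<Rightarrow> ('n \<Rightarrow>\<^sub>0 nat) \<Rightarrow> bool" where
  "lex_less e m m' \<longleftrightarrow> (\<exists>i. Poly_Mapping.lookup m i < Poly_Mapping.lookup m' i \<and>
     (\<forall>j. e j < e i \<longrightarrow> Poly_Mapping.lookup m j = Poly_Mapping.lookup m' j))"

lemma lex_less_trans:
  assumes "inj e" "lex_less e a b" "lex_less e b c"
  shows "lex_less e a c"
proof -
  obtain i where i: "Poly_Mapping.lookup a i < Poly_Mapping.lookup b i"
    "\<And>j. e j < e i \<Longrightarrow> Poly_Mapping.lookup a j = Poly_Mapping.lookup b j"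
    using assms(2) by (auto simp: lex_less_def)
  obtain l where l: "Poly_Mapping.lookup b l < Poly_Mapping.lookup c l"
    "\<And>j. e j < e l \<Longrightarrow> Poly_Mapping.lookup b j = Poly_Mapping.lookup c j"
    using assms(3) by (auto simp: lex_less_def)
  consider "e i < e l" | "e l < e i" | "i = l" using assms(1) by (metis injD linorder_neqE_nat)
  then show ?thesis
  proof cases
    case 1
    then show ?thesis unfolding lex_less_def using i l by (intro exI[of _ i]) auto
  next
    case 2
    then show ?thesis unfolding lex_less_def using i l by (intro exI[of _ l]) auto
  next
    case 3
    then show ?thesis unfolding lex_less_def using i l by (intro exI[of _ i]) auto
  qed
qed

text \<open>The index type carries no order of its own, so the injection \<open>e\<close> ranks the
  variables; the variable of smallest rank at which the exponents differ decides.\<close>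

lemma lex_less_total:
  fixes e :: "'n::finite \<Rightarrow> nat"
  assumes "inj e" "a \<noteq> b"
  shows "lex_less e a b \<or> lex_less e b a"
proof -
  let ?P = "\<lambda>i. Poly_Mapping.lookup a i \<noteq> Poly_Mapping.lookup b i"
  obtain i0 where "?P i0" using assms(2) poly_mapping_eqI[of a b] by blast
  then obtain i where i: "?P i" "\<And>j. ?P j \<Longrightarrow> e i \<le> e j" using ex_has_least_nat[of ?P i0 e] by auto
  then have "\<And>j. e j < e i \<Longrightarrow> Poly_Mapping.lookup a j = Poly_Mapping.lookup b j" by (meson not_le)
  with i(1) show ?thesis unfolding lex_less_def by (metis linorder_neqE_nat)
qed

lemma lex_less_plus: "lex_less e a b \<Longrightarrow> lex_less e (t + a) (t + b)"
  by (auto simp: lex_less_def lookup_add)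

lemma not_lex_less_pointwise:
  assumes "\<And>i. Poly_Mapping.lookup a i \<le> Poly_Mapping.lookup b i"
  shows "\<not> lex_less e b a"
  using assms by (auto simp: lex_less_def not_less)

text \<open>A descending chain has a subsequence along which every single exponent is nondecreasing;
  its first two members contradict the descent.\<close>

lemma wf_lex_less:
  fixes e :: "'n::finite \<Rightarrow> nat"
  assumes e: "inj e"
  shows "wf {(a, b). lex_less e a b}"
  unfolding wf_iff_no_infinite_down_chain
proof
  assume "\<exists>f. \<forall>i. (f (Suc i), f i) \<in> {(a, b). lex_less e a b}"
  then obtain f where f: "\<And>i. lex_less e (f (Suc i)) (f i)" by auto
  have desc: "lex_less e (f (i + Suc k)) (f i)" for i k
  proof (induction k)
    case (Suc k)
    then show ?case using lex_less_trans[OF e f[of "i + Suc k"]] by simp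
  qed (use f in simp)
  obtain r :: "nat \<Rightarrow> nat" where r: "strict_mono r"
      "\<forall>i\<in>UNIV. incseq (\<lambda>k. Poly_Mapping.lookup (f (r k)) i)"
    using finite_family_incseq_subseq[of UNIV "\<lambda>k. Poly_Mapping.lookup (f k)"] by auto
  have "r 0 < r 1" using r(1) by (simp add: strict_mono_def)
  then obtain k where "r 1 = r 0 + Suc k" using less_iff_Suc_add by auto
  then have "lex_less e (f (r 1)) (f (r 0))" using desc by metis
  moreover have "Poly_Mapping.lookup (f (r 0)) i \<le> Poly_Mapping.lookup (f (r 1)) i" for i
    using r(2) by (auto simp: incseq_def)
  ultimately show False using not_lex_less_pointwise by blast
qed

text \<open>Term over position: monomials are compared first, and the position in the vector breaks
  ties. Multiplication by a monomial preserves this order.\<close>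

definition term_less :: "('n \<Rightarrow> nat) \<Rightarrow> (('n \<Rightarrow>\<^sub>0 nat) \<times> nat) rel" where
  "term_less e = {(a, b). lex_less e a b} <*lex*> less_than"

lemma term_less_total:
  fixes e :: "'n::finite \<Rightarrow> nat"
  shows "inj e \<Longrightarrow> s \<noteq> t \<Longrightarrow> (s, t) \<in> term_less e \<or> (t, s) \<in> term_less e"
  using lex_less_total[of e "fst s" "fst t"] by (cases s; cases t) (auto simp: term_less_def)

lemma term_less_trans: "inj e \<Longrightarrow> (s, t) \<in> term_less e \<Longrightarrow> (t, u) \<in> term_less e \<Longrightarrow> (s, u) \<in> term_less e"
  using lex_less_trans[of e "fst s" "fst t" "fst u"]
  by (cases s; cases t; cases u) (auto simp: term_less_def)

lemma wf_term_less: "inj (e :: 'n::finite \<Rightarrow> nat) \<Longrightarrow> wf (term_less e)"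
  unfolding term_less_def by (rule wf_lex_prod[OF wf_lex_less wf_less_than])

lemma ex_term_less_max:
  fixes e :: "'n::finite \<Rightarrow> nat"
  assumes "finite T" "T \<noteq> {}" "inj e"
  shows "\<exists>t\<in>T. \<forall>s\<in>T. s = t \<or> (s, t) \<in> term_less e"
  using assms(1,2)
proof (induction rule: finite_ne_induct)
  case (insert x T)
  then obtain t where t: "t \<in> T" "\<forall>s\<in>T. s = t \<or> (s, t) \<in> term_less e" by blast
  show ?case
  proof (cases "(x, t) \<in> term_less e")
    case False
    then have "(t, x) \<in> term_less e" using term_less_total[OF assms(3), of x t] insert.hyps t
        by auto
    then have "s = x \<or> (s, x) \<in> term_less e" if "s \<in> insert x T" for s
      using t that term_less_trans[OF assms(3), of s t x] by auto
    then show ?thesis by blast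
  qed (use t in blast)
qed simp

section \<open>Leading terms and finite generation of submodules of P^n\<close>

definition vec_terms :: "(('n \<Rightarrow>\<^sub>0 nat) \<Rightarrow>\<^sub>0 'k::zero) vec \<Rightarrow> (('n \<Rightarrow>\<^sub>0 nat) \<times> nat) set" where
  "vec_terms v = {(m, i). i < dim_vec v \<and> Poly_Mapping.lookup (v $ i) m \<noteq> 0}"

lemma finite_vec_terms: "finite (vec_terms v)"
proof (rule finite_subset)
  show "vec_terms v \<subseteq> (\<Union>i<dim_vec v. Poly_Mapping.keys (v $ i)) \<times> {..<dim_vec v}"
    by (auto simp: vec_terms_def in_keys_iff)
qed auto

lemma vec_terms_empty:
  assumes "vec_terms v = {}"
  shows "v = 0\<^sub>v (dim_vec v)"
proof (rule eq_vecI)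
  fix i assume "i < dim_vec (0\<^sub>v (dim_vec v) :: (('a \<Rightarrow>\<^sub>0 nat) \<Rightarrow>\<^sub>0 'b) vec)"
  then have i: "i < dim_vec v" by simp
  have "Poly_Mapping.lookup (v $ i) m = 0" for m using assms i by (auto simp: vec_terms_def)
  then have "v $ i = 0" by (intro poly_mapping_eqI) simp
  then show "v $ i = 0\<^sub>v (dim_vec v) $ i" using i by simp
qed simp

lemma lookup_single_times_plus:
  fixes p :: "('n, 'k::field) pring"
  shows "Poly_Mapping.lookup (Poly_Mapping.single t a * p) (t + m) = a * Poly_Mapping.lookup p m"
proof -
  have "Poly_Mapping.lookup (Poly_Mapping.single t a * p) (t + m) =
     (\<Sum>l. (a when t = l) * (\<Sum>q. Poly_Mapping.lookup p q when t + m = l + q))"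
    by (simp add: lookup_mult lookup_single)
  also have "\<dots> = (\<Sum>l. (a * (\<Sum>q. Poly_Mapping.lookup p q when t + m = l + q)) when t = l)"
    by (simp add: when_mult)
  also have "\<dots> = a * Poly_Mapping.lookup p m" by simp
  finally show ?thesis .
qed

lemma lookup_single_times_nonzero:
  fixes p :: "('n, 'k::field) pring"
  assumes "Poly_Mapping.lookup (Poly_Mapping.single t a * p) m \<noteq> 0"
  shows "\<exists>m'. m = t + m'"
proof -
  have "m \<in> Poly_Mapping.keys (Poly_Mapping.single t a * p)" using assms by (simp add: in_keys_iff)
  then show ?thesis using keys_mult[of "Poly_Mapping.single t a" p] by (auto split: if_splits)
qed

definition pring_submodule :: "nat \<Rightarrow> ('n::finite, 'k::field) pring vec set \<Rightarrow> bool" where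
  "pring_submodule n N \<longleftrightarrow> N \<subseteq> carrier_vec n \<and> 0\<^sub>v n \<in> N \<and>
     (\<forall>u\<in>N. \<forall>v\<in>N. u + v \<in> N) \<and> (\<forall>p. \<forall>u\<in>N. p \<cdot>\<^sub>v u \<in> N)"

lemma mult_mat_vec_in_submodule:
  assumes N: "pring_submodule n N" and D: "D \<in> carrier_mat n m" and cols: "\<And>j. j < m \<Longrightarrow> col D j \<in> N"
    and u: "u \<in> carrier_vec m"
  shows "D *\<^sub>v u \<in> N"
proof -
  have "\<forall>u\<in>carrier_vec m. (\<forall>j<m. k \<le> j \<longrightarrow> u $ j = 0) \<longrightarrow> D *\<^sub>v u \<in> N" for k
  proof (induction k)
    case 0
    have "D *\<^sub>v u = 0\<^sub>v n" if "u \<in> carrier_vec m" "\<forall>j<m. u $ j = 0" for u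
    proof -
      have "u = 0\<^sub>v m" using that by (intro eq_vecI) auto
      then show ?thesis using D by (intro eq_vecI) auto
    qed
    then show ?case using N by (auto simp: pring_submodule_def)
  next
    case (Suc k)
    show ?case
    proof (intro ballI impI)
      fix u :: "('a, 'b) pring vec" assume u: "u \<in> carrier_vec m" and s:
          "\<forall>j<m. Suc k \<le> j \<longrightarrow> u $ j = 0"
      show "D *\<^sub>v u \<in> N"
      proof (cases "k < m")
        case False
        then show ?thesis using Suc u by auto
      next
        case True
        define w where "w = vec m (\<lambda>j. if j = k then 0 else u $ j)"
        have uw: "u = w + u $ k \<cdot>\<^sub>v unit_vec m k"
          using u True by (intro eq_vecI) (auto simp: w_def unit_vec_def)
        have w: "w \<in> carrier_vec m" by (simp add: w_def)
        have "D *\<^sub>v w \<in> N" using Suc w s by (auto simp: w_def)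
        moreover have "D *\<^sub>v u = D *\<^sub>v w + u $ k \<cdot>\<^sub>v col D k"
          using arg_cong[OF uw, of "\<lambda>u. D *\<^sub>v u"] mult_add_distrib_mat_vec[OF D w, of
              "u $ k \<cdot>\<^sub>v unit_vec m k"]
            mult_mat_smult_vec[OF D, of "unit_vec m k"] mat_unit_vec_col[OF D True] by simp
        ultimately show ?thesis using N cols[OF True] by (simp add: pring_submodule_def)
      qed
    qed
  qed
  from this[of m] show ?thesis using u by auto
qed

lemma pring_submodule_image:
  fixes D :: "('n::finite, 'k::field) pring mat"
  assumes D: "D \<in> carrier_mat n m"
  shows "pring_submodule n ((\<lambda>u. D *\<^sub>v u) ` carrier_vec m)"
proof -
  have "0\<^sub>v n = D *\<^sub>v 0\<^sub>v m" using D by (intro eq_vecI) auto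
  then show ?thesis using D
    by (auto simp: pring_submodule_def mult_add_distrib_mat_vec[OF D, symmetric]
        mult_mat_smult_vec[OF D, symmetric])
qed

text \<open>Division as for Groebner bases: the generators are elements whose leading terms divide
  all leading terms of N, and subtracting a monomial multiple of one of them lowers the leading
  term, which can go on only finitely long.\<close>

theorem pring_submodule_finitely_generated:
  fixes N :: "('n::finite, 'k::field) pring vec set"
  assumes N: "pring_submodule n N"
  shows "\<exists>m. \<exists>D\<in>carrier_mat n m. (\<lambda>u. D *\<^sub>v u) ` carrier_vec m = N"
proof -
  obtain e :: "'n \<Rightarrow> nat" where e: "inj e" using finite_imp_inj_to_nat_seg[of "UNIV :: 'n set"]
      by auto
  have Nc: "v \<in> N \<Longrightarrow> v \<in> carrier_vec n" for v using N by (auto simp: pring_submodule_def)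
  define lead where "lead = (\<lambda>(v :: ('n, 'k) pring vec) t. t \<in> vec_terms v \<and> (\<forall>s\<in>vec_terms v. s
      = t \<or> (s, t) \<in> term_less e))"
  have lead_ex: "\<exists>t. lead v t" if "v \<in> carrier_vec n" "v \<noteq> 0\<^sub>v n" for v
  proof -
    have "vec_terms v \<noteq> {}" using vec_terms_empty[of v] that by auto
    from ex_term_less_max[OF finite_vec_terms this e] show ?thesis unfolding lead_def by blast
  qed
  \<comment> \<open>Terms of P^n can divide each other only within one position, so the leading
    exponents are collected, and Dickson's lemma applied, for each position separately.\<close>
  define L where "L = (\<lambda>i. {m. \<exists>v\<in>N. lead v (m, i)})"
  have "\<forall>i. \<exists>B. B \<subseteq> L i \<and> finite B \<and>
    (\<forall>m\<in>L i. \<exists>b\<in>B. \<forall>l. Poly_Mapping.lookup b l \<le> Poly_Mapping.lookup m l)"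
    using dickson by blast
  from choice[OF this] obtain B where B: "\<And>i. B i \<subseteq> L i" "\<And>i. finite (B i)"
    "\<And>i m. m \<in> L i \<Longrightarrow> \<exists>b\<in>B i. \<forall>l. Poly_Mapping.lookup b l \<le> Poly_Mapping.lookup m l" by blast
  define T where "T = (\<Union>i<n. (\<lambda>m. (m, i)) ` B i)"
  have finT: "finite T" using B(2) by (auto simp: T_def)
  have "\<forall>t\<in>T. \<exists>v\<in>N. lead v t" using B(1) by (auto simp: T_def L_def)
  then have "\<forall>t\<in>T. \<exists>v. v \<in> N \<and> lead v t" by blast
  from bchoice[OF this] obtain gen where gen: "\<And>t. t \<in> T \<Longrightarrow> gen t \<in> N \<and> lead (gen t) t" by blast
  obtain ts where ts: "set ts = T" using finite_list[OF finT] by blast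
  have "gen (ts ! j) \<in> carrier_vec n" if "j < length ts" for j
    using gen[of "ts ! j"] ts Nc nth_mem[OF that] by simp
  from mat_from_cols[of "length ts" "\<lambda>j. gen (ts ! j)", OF this]
  obtain D where D: "D \<in> carrier_mat n (length ts)" and Dcol:
      "\<And>j. j < length ts \<Longrightarrow> col D j = gen (ts ! j)"
    by blast
  let ?I = "(\<lambda>u. D *\<^sub>v u) ` carrier_vec (length ts)"
  have I: "pring_submodule n ?I" by (rule pring_submodule_image[OF D])
  have genI: "gen t \<in> ?I" if t: "t \<in> T" for t
  proof -
    obtain j where j: "j < length ts" "ts ! j = t" using t ts in_set_conv_nth[of t ts] by blast
    show ?thesis
      by (rule image_eqI[of _ _ "unit_vec (length ts) j"])
          (use j mat_unit_vec_col[OF D j(1)] Dcol[OF j(1)] in simp_all)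
  qed
  have main: "\<forall>v\<in>N. lead v t \<longrightarrow> v \<in> ?I" for t
    using wf_term_less[OF e]
  proof (induction t rule: wf_induct_rule)
    case (less t)
    show ?case
    proof (intro ballI impI)
      fix v assume v: "v \<in> N" and lv: "lead v t"
      obtain m i where t: "t = (m, i)" by force
      have i: "i < n" and cv: "Poly_Mapping.lookup (v $ i) m \<noteq> 0"
        using lv Nc[OF v] by (auto simp: lead_def vec_terms_def t)
      have "m \<in> L i" using v lv by (auto simp: L_def t)
      then obtain b where b: "b \<in> B i" "\<And>i. Poly_Mapping.lookup b i \<le> Poly_Mapping.lookup m i"
          using B(3) by blast
      have bT: "(b, i) \<in> T" using b(1) i by (auto simp: T_def)
      define q where "q = gen (b, i)"
      have q: "q \<in> N" "lead q (b, i)" using gen[OF bT] by (auto simp: q_def)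
      have cq: "Poly_Mapping.lookup (q $ i) b \<noteq> 0" using q(2) by (auto simp: lead_def vec_terms_def)
      define d where "d = m - b"
      have mb: "m = d + b" using b(2) by (intro poly_mapping_eqI)
          (simp add: d_def lookup_add lookup_minus)
      \<comment> \<open>Chosen so that the leading term of v cancels against that of c x^d
        q.\<close>
      define c where "c = Poly_Mapping.lookup (v $ i) m / Poly_Mapping.lookup (q $ i) b"
      define p where "p = Poly_Mapping.single d c"
      define w where "w = v + (- p) \<cdot>\<^sub>v q"
      have wN: "w \<in> N" using N v q(1) by (auto simp: w_def pring_submodule_def)
      \<comment> \<open>A term of w stems from v or from x^d q. Both have t as their largest term,
        and t itself has cancelled.\<close>
      have wterm: "(s, t) \<in> term_less e" if s: "s \<in> vec_terms w" for s
      proof -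
        obtain m' i' where sm: "s = (m', i')" by force
        have i': "i' < n" and nz: "Poly_Mapping.lookup (w $ i') m' \<noteq> 0"
          using s Nc[OF wN] by (auto simp: vec_terms_def sm)
        have wl: "Poly_Mapping.lookup (w $ i') m' = Poly_Mapping.lookup (v $ i') m' -
            Poly_Mapping.lookup (p * q $ i') m'"
          using i' Nc[OF v] Nc[OF q(1)] by (simp add: w_def lookup_minus)
        have "s \<noteq> t"
        proof
          assume "s = t"
          then have "m' = d + b" "i' = i" using sm t mb by auto
          then have "Poly_Mapping.lookup (p * q $ i') m' = Poly_Mapping.lookup (v $ i) m"
            using lookup_single_times_plus[of d c "q $ i" b] cq by (simp add: p_def c_def)
          then show False using nz wl \<open>s = t\<close> sm t by simp
        qed
        show ?thesis
        proof (cases "Poly_Mapping.lookup (v $ i') m' = 0")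
          case False
          then have "s \<in> vec_terms v" using i' Nc[OF v] by (auto simp: vec_terms_def sm)
          then show ?thesis using lv \<open>s \<noteq> t\<close> by (auto simp: lead_def)
        next
          case True
          then have nz': "Poly_Mapping.lookup (p * q $ i') m' \<noteq> 0" using nz wl by simp
          then obtain m'' where m'': "m' = d + m''" using lookup_single_times_nonzero by
              (metis p_def)
          then have "Poly_Mapping.lookup (q $ i') m'' \<noteq> 0"
            using nz' lookup_single_times_plus[of d c "q $ i'" m''] by (auto simp: p_def)
          then have "(m'', i') \<in> vec_terms q" using i' Nc[OF q(1)] by (auto simp: vec_terms_def)
          then have "(m'', i') = (b, i) \<or> ((m'', i'), (b, i)) \<in> term_less e" using q(2) by
              (auto simp: lead_def)
          then show ?thesis
            using \<open>s \<noteq> t\<close> by (auto simp: sm t m'' mb term_less_def lex_less_plus)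
        qed
      qed
      have "w \<in> ?I"
      proof (cases "w = 0\<^sub>v n")
        case True
        then show ?thesis using I by (simp add: pring_submodule_def)
      next
        case False
        then obtain s where s: "lead w s" using lead_ex Nc[OF wN] by blast
        then have "(s, t) \<in> term_less e" using wterm by (auto simp: lead_def)
        then show ?thesis using less s wN by blast
      qed
      moreover have "p \<cdot>\<^sub>v q \<in> ?I" using I genI[OF bT] unfolding pring_submodule_def q_def by blast
      ultimately have "w + p \<cdot>\<^sub>v q \<in> ?I" using I unfolding pring_submodule_def by blast
      moreover have "w + p \<cdot>\<^sub>v q = v"
        using Nc[OF v] Nc[OF q(1)] by (intro eq_vecI) (auto simp: w_def)
      ultimately show "v \<in> ?I" by simp
    qed
  qed
  have "N \<subseteq> ?I"
  proof
    fix v assume v: "v \<in> N"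
    show "v \<in> ?I"
    proof (cases "v = 0\<^sub>v n")
      case True
      then show ?thesis using I by (simp add: pring_submodule_def)
    next
      case False
      then show ?thesis using lead_ex[OF Nc[OF v]] main v by blast
    qed
  qed
  moreover have "?I \<subseteq> N"
  proof (clarify)
    fix u :: "('n, 'k) pring vec" assume u: "u \<in> carrier_vec (length ts)"
    show "D *\<^sub>v u \<in> N"
      by (rule mult_mat_vec_in_submodule[OF N D _ u]) (use Dcol gen ts nth_mem in metis)
  qed
  ultimately show ?thesis using D by blast
qed

lemma pring_submodule_kernel:
  "D \<in> carrier_mat n m \<Longrightarrow> pring_submodule m (mat_kernel (D :: ('n::finite, 'k::field) pring mat))"
  by (auto simp: pring_submodule_def mat_kernel mult_add_distrib_mat_vec mult_mat_smult_vec)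

text \<open>The kernel of each matrix is again a submodule of a free module of finite rank, so a
  matrix onto it can always be chosen next.\<close>

theorem free_resolution_exists:
  fixes M :: "(('n::finite, 'k::field) pring, 'm) module"
  assumes hom: "mod_hom class_ring (module_vec TYPE(('n, 'k) pring) n) M e"
    and surj: "e ` carrier_vec n = carrier M"
  shows "\<exists>b D e. free_resolution M b D e"
proof -
  interpret mod_hom class_ring "module_vec TYPE(('n, 'k) pring) n" M e by (rule hom)
  have "pring_submodule n {v \<in> carrier_vec n. e v = \<zero>\<^bsub>M\<^esub>}"
    using f0_is_0 f_add f_smult unfolding pring_submodule_def
    by (auto simp: module_vec_simps)
  then obtain m D0 where D0: "D0 \<in> carrier_mat n m"
      "(\<lambda>u. D0 *\<^sub>v u) ` carrier_vec m = {v \<in> carrier_vec n. e v = \<zero>\<^bsub>M\<^esub>}"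
    using pring_submodule_finitely_generated by blast
  \<comment> \<open>The triples carry both dimensions along with the matrix. The clause for index 0
    fixes the first matrix to be the one onto the kernel of e.\<close>
  define P where "P = (\<lambda>i :: nat. \<lambda>(a :: nat, c :: nat, A :: ('n, 'k) pring mat).
    A \<in> carrier_mat a c \<and> (i = 0 \<longrightarrow> a = n \<and> c = m \<and> A = D0))"
  define Q where "Q = (\<lambda>i :: nat. \<lambda>(a :: nat, c :: nat, A :: ('n, 'k) pring mat) (a' :: nat, c' ::
      nat, A' :: ('n, 'k) pring mat).
    a' = c \<and> mat_kernel A = (\<lambda>u. A' *\<^sub>v u) ` carrier_vec c')"
  have "\<exists>f. \<forall>i. P i (f i) \<and> Q i (f i) (f (Suc i))"
  proof (rule dependent_nat_choice)
    show "\<exists>x. P 0 x" using D0 by (auto simp: P_def)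
    show "\<exists>y. P (Suc i) y \<and> Q i x y" if "P i x" for x i
    proof -
      obtain a c A where x: "x = (a, c, A)" by (metis prod.exhaust)
      have "A \<in> carrier_mat a c" using that by (auto simp: P_def x)
      then obtain c' A' where "A' \<in> carrier_mat c c'"
          "(\<lambda>u. A' *\<^sub>v u) ` carrier_vec c' = mat_kernel A"
        using pring_submodule_finitely_generated[OF pring_submodule_kernel] by blast
      then show ?thesis by (intro exI[of _ "(c, c', A')"]) (auto simp: P_def Q_def x)
    qed
  qed
  then obtain f where f: "\<And>i. P i (f i)" "\<And>i. Q i (f i) (f (Suc i))" by blast
  define b where "b = (\<lambda>i. fst (f i))"
  define D where "D = (\<lambda>i. snd (snd (f i)))"
  have bS: "fst (snd (f i)) = b (Suc i)" for i using f(2)[of i] by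
      (auto simp: Q_def b_def case_prod_unfold)
  have DS: "D i \<in> carrier_mat (b i) (b (Suc i))" for i
    using f(1)[of i] bS[of i] by (auto simp: P_def b_def D_def case_prod_unfold)
  have ker: "mat_kernel (D i) = (\<lambda>u. D (Suc i) *\<^sub>v u) ` carrier_vec (b (Suc (Suc i)))" for i
    using f(2)[of i] bS[of "Suc i"] by (auto simp: Q_def b_def D_def case_prod_unfold)
  have "b 0 = n" "D 0 = D0" "b 1 = m"
    using f(1)[of 0] bS[of 0] by (auto simp: P_def b_def D_def case_prod_unfold)
  then have "free_resolution M b D e"
    unfolding free_resolution_def using hom surj DS ker D0 by auto
  then show ?thesis by blast
qed

section \<open>Specialization modulo a regular element\<close>

lemma (in abelian_group) add_eq_self:
  assumes "x \<in> carrier G" "y \<in> carrier G" "y = x \<oplus> y"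
  shows "x = \<zero>"
  using assms by (metis add.r_cancel_one' zero_closed)

lemma vcong_iff:
  assumes "u \<in> carrier_vec n" "v \<in> carrier_vec n"
  shows "vcong x u v \<longleftrightarrow> (\<exists>w\<in>carrier_vec n. u = v + x \<cdot>\<^sub>v w)"
proof
  assume "vcong x u v"
  then have "\<forall>i\<in>{..<n}. \<exists>c. u $ i - v $ i = x * c" using assms by (auto simp: vcong_def dvd_def)
  from bchoice[OF this] obtain f where f: "\<And>i. i < n \<Longrightarrow> u $ i - v $ i = x * f i" by auto
  have "u = v + x \<cdot>\<^sub>v vec n f" using assms f by (intro eq_vecI) (auto simp: algebra_simps)
  then show "\<exists>w\<in>carrier_vec n. u = v + x \<cdot>\<^sub>v w" by (intro bexI[of _ "vec n f"]) auto
qed (use assms in \<open>auto simp: vcong_def\<close>)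

text \<open>\<open>q\<close> identifies \<open>M / x M\<close> with a subgroup of \<open>'a\<close>, and \<open>x\<close> is regular on \<open>M\<close>.\<close>

definition specialization ::
    "'r::comm_ring_1 \<Rightarrow> ('r \<Rightarrow> 'a::ab_group_add \<Rightarrow> 'a) \<Rightarrow> ('r, 'm) module \<Rightarrow> ('m \<Rightarrow> 'a) \<Rightarrow> bool" where
  "specialization x act M q \<longleftrightarrow>
     (\<forall>r\<in>carrier M. \<forall>s\<in>carrier M. q (r \<oplus>\<^bsub>M\<^esub> s) = q r + q s) \<and>
     (\<forall>p. \<forall>r\<in>carrier M. q (p \<odot>\<^bsub>M\<^esub> r) = act p (q r)) \<and>
     (\<forall>r\<in>carrier M. q r = 0 \<longleftrightarrow> (\<exists>s\<in>carrier M. r = x \<odot>\<^bsub>M\<^esub> s)) \<and>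
     (\<forall>r\<in>carrier M. x \<odot>\<^bsub>M\<^esub> r = \<zero>\<^bsub>M\<^esub> \<longrightarrow> r = \<zero>\<^bsub>M\<^esub>)"

text \<open>In effect the vanishing of the higher Tor of M with P/x, done by hand: if D v = x w,
  then regularity of x yields z with w = D z, so v can be corrected by x z to a true cycle, to which
  exactness over P applies.\<close>

lemma resolution_mod_of_free_resolution:
  fixes M :: "(('n::finite, 'k::field) pring, 'm) module" and x :: "('n, 'k) pring"
  assumes res: "free_resolution M b D e" and sp: "specialization x act M q"
    and reg: "\<And>p. x * p = 0 \<Longrightarrow> p = 0"
  shows "resolution_mod x act b D (\<lambda>v. q (e v))"
proof -
  have hom: "mod_hom class_ring (module_vec TYPE(('n, 'k) pring) (b 0)) M e"
    and surj: "e ` carrier_vec (b 0) = carrier M" and D: "\<And>i. D i \<in> carrier_mat (b i) (b (Suc i))"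
    and ex0: "{v \<in> carrier_vec (b 0). e v = \<zero>\<^bsub>M\<^esub>} = (\<lambda>v. D 0 *\<^sub>v v) ` carrier_vec (b 1)"
    and ex: "\<And>i. mat_kernel (D i) = (\<lambda>v. D (Suc i) *\<^sub>v v) ` carrier_vec (b (Suc (Suc i)))"
    using res by (auto simp: free_resolution_def)
  interpret mod_hom class_ring "module_vec TYPE(('n, 'k) pring) (b 0)" M e by (rule hom)
  have ab: "abelian_group M" using hom by (simp add: mod_hom_def module_def)
  have ec: "e v \<in> carrier M" if "v \<in> carrier_vec (b 0)" for v using surj that by blast
  have ea: "e (u + v) = e u \<oplus>\<^bsub>M\<^esub> e v" if "u \<in> carrier_vec (b 0)" "v \<in> carrier_vec (b 0)" for u v
    using f_add[of u v] that by (simp add: module_vec_simps)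
  have es: "e (p \<cdot>\<^sub>v v) = p \<odot>\<^bsub>M\<^esub> e v" if "v \<in> carrier_vec (b 0)" for p v
    using f_smult[of p v] that by (simp add: module_vec_simps)
  have Dc: "D i *\<^sub>v v \<in> carrier_vec (b i)" if "v \<in> carrier_vec (b (Suc i))" for i v
    by (rule mult_mat_vec_carrier[OF D that])
  have shift: "u = w + x \<cdot>\<^sub>v z \<longleftrightarrow> u + (- x) \<cdot>\<^sub>v z = w"
    if "u \<in> carrier_vec n" "w \<in> carrier_vec n" "z \<in> carrier_vec n" for u w z :: "('n, 'k) pring vec"
        and n
    using that by (auto simp: vec_eq_iff diff_eq_eq)
  have xzero: "z = 0\<^sub>v n" if "x \<cdot>\<^sub>v z = 0\<^sub>v n" "z \<in> carrier_vec n" for z :: "('n, 'k) pring vec"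
      and n
  proof (rule eq_vecI)
    fix i assume "i < dim_vec (0\<^sub>v n :: ('n, 'k) pring vec)"
    then show "z $ i = 0\<^sub>v n $ i" using arg_cong[OF that(1), of "\<lambda>v. v $ i"] that(2) reg by auto
  qed (use that(2) in auto)
  have e_kernel: "\<exists>u\<in>carrier_vec (b 1). v = D 0 *\<^sub>v u" if "v \<in> carrier_vec (b 0)" "e v = \<zero>\<^bsub>M\<^esub>" for v
    using ex0 that by blast
  have e_D: "e (D 0 *\<^sub>v u) = \<zero>\<^bsub>M\<^esub>" if "u \<in> carrier_vec (b 1)" for u using ex0 that by blast
  have D_kernel: "\<exists>u\<in>carrier_vec (b (Suc (Suc i))). v = D (Suc i) *\<^sub>v u"
    if "v \<in> carrier_vec (b (Suc i))" "D i *\<^sub>v v = 0\<^sub>v (b i)" for v i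
    using ex[of i] mat_kernelI[OF D that] by blast
  have DD: "D i *\<^sub>v (D (Suc i) *\<^sub>v u) = 0\<^sub>v (b i)" if "u \<in> carrier_vec (b (Suc (Suc i)))" for u i
    using ex[of i] mat_kernelD(2)[OF D] that by blast
  \<comment> \<open>The image of D i is saturated: if x w lies in it, so does w. For i = 0 this
    rests on the regularity of x on M, in higher degrees on its regularity on P.\<close>
  have sat: "\<exists>u\<in>carrier_vec (b (Suc i)). w = D i *\<^sub>v u"
    if w: "w \<in> carrier_vec (b i)" and v: "v \<in> carrier_vec (b (Suc i))" and eq: "D i *\<^sub>v v = x \<cdot>\<^sub>v w"
        for i v w
  proof (cases i)
    case 0
    have "x \<odot>\<^bsub>M\<^esub> e w = \<zero>\<^bsub>M\<^esub>" using e_D[of v] v w eq es[of w x] 0 by simp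
    then show ?thesis using sp ec[of w] w e_kernel[of w] 0 by (simp add: specialization_def)
  next
    case (Suc j)
    have "x \<cdot>\<^sub>v (D j *\<^sub>v w) = 0\<^sub>v (b j)"
      using DD[of v j] v w eq mult_mat_smult_vec[OF D, of w j x] Suc by simp
    then have "D j *\<^sub>v w = 0\<^sub>v (b j)" using xzero Dc[of w j] w Suc by simp
    then show ?thesis using D_kernel[of w j] w Suc by simp
  qed
  show ?thesis
    unfolding resolution_mod_def
  proof (intro conjI ballI allI)
    show "q (e (u + v)) = q (e u) + q (e v)" if "u \<in> carrier_vec (b 0)" "v \<in> carrier_vec (b 0)"
        for u v
      using sp that ec by (simp add: ea specialization_def)
    show "q (e (p \<cdot>\<^sub>v v)) = act p (q (e v))" if "v \<in> carrier_vec (b 0)" for p v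
      using sp that ec by (simp add: es specialization_def)
    show "D i \<in> carrier_mat (b i) (b (Suc i))" for i by (rule D)
    show "q (e v) = 0 \<longleftrightarrow> (\<exists>u\<in>carrier_vec (b 1). vcong x v (D 0 *\<^sub>v u))" if v: "v \<in> carrier_vec (b 0)"
        for v
    proof
      assume "q (e v) = 0"
      then obtain s where "s \<in> carrier M" "e v = x \<odot>\<^bsub>M\<^esub> s"
        using sp ec[OF v] by (auto simp: specialization_def)
      moreover from this have "s \<in> e ` carrier_vec (b 0)" using surj by simp
      ultimately obtain w where w: "w \<in> carrier_vec (b 0)" and eq: "e v = x \<odot>\<^bsub>M\<^esub> e w" by blast
      \<comment> \<open>As e v = x e w, the vector v - x w lies in the kernel of e and is therefore
        a boundary.\<close>
      define w' where "w' = v + (- x) \<cdot>\<^sub>v w"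
      have cw: "w' \<in> carrier_vec (b 0)" using v w by (simp add: w'_def)
      have vw: "v = w' + x \<cdot>\<^sub>v w" using shift[OF v cw w] by (simp add: w'_def)
      have "e v = e w' \<oplus>\<^bsub>M\<^esub> e (x \<cdot>\<^sub>v w)" unfolding vw by (rule ea[OF cw]) (use w in simp)
      also have "e (x \<cdot>\<^sub>v w) = e v" using eq es[OF w] by simp
      finally have "e w' = \<zero>\<^bsub>M\<^esub>" by (rule abelian_group.add_eq_self[OF ab ec[OF cw] ec[OF v]])
      then obtain u where "u \<in> carrier_vec (b 1)" "w' = D 0 *\<^sub>v u" using e_kernel cw by blast
      then show "\<exists>u\<in>carrier_vec (b 1). vcong x v (D 0 *\<^sub>v u)"
        using vw w vcong_iff[OF v Dc[of u 0]] by auto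
    next
      assume "\<exists>u\<in>carrier_vec (b 1). vcong x v (D 0 *\<^sub>v u)"
      then obtain u where u: "u \<in> carrier_vec (b 1)" "vcong x v (D 0 *\<^sub>v u)" by blast
      then obtain w where w: "w \<in> carrier_vec (b 0)" "v = D 0 *\<^sub>v u + x \<cdot>\<^sub>v w"
        using vcong_iff[OF v Dc[of u 0]] by auto
      then have "e v = x \<odot>\<^bsub>M\<^esub> e w"
        using ea[OF Dc[of u 0], of "x \<cdot>\<^sub>v w"] e_D[OF u(1)] es[OF w(1)] u(1) ec[of "x \<cdot>\<^sub>v w"] by simp
      then have "\<exists>s\<in>carrier M. e v = x \<odot>\<^bsub>M\<^esub> s" using ec[OF w(1)] by blast
      then show "q (e v) = 0" using sp ec[OF v] unfolding specialization_def by blast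
    qed
    show "vcong x (D i *\<^sub>v v) (0\<^sub>v (b i)) \<longleftrightarrow> (\<exists>u\<in>carrier_vec (b (Suc (Suc i))). vcong x v (D (Suc i)
        *\<^sub>v u))"
      if v: "v \<in> carrier_vec (b (Suc i))" for i v
    proof
      assume "vcong x (D i *\<^sub>v v) (0\<^sub>v (b i))"
      then obtain w where w: "w \<in> carrier_vec (b i)" "D i *\<^sub>v v = x \<cdot>\<^sub>v w"
        using vcong_iff[OF Dc[OF v] zero_carrier_vec] by auto
      then obtain z where z: "z \<in> carrier_vec (b (Suc i))" "w = D i *\<^sub>v z" using sat[OF w(1) v]
          by blast
      let ?z = "v + (- x) \<cdot>\<^sub>v z"
      have cz: "?z \<in> carrier_vec (b (Suc i))" using v z by simp
      have "D i *\<^sub>v ?z = x \<cdot>\<^sub>v w + (- x) \<cdot>\<^sub>v w"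
        using mult_add_distrib_mat_vec[OF D v, of "(- x) \<cdot>\<^sub>v z"] mult_mat_smult_vec[OF D z(1), of
            "- x"] w z by simp
      then have "D i *\<^sub>v ?z = 0\<^sub>v (b i)" using w(1) by (auto simp: vec_eq_iff)
      then obtain u where "u \<in> carrier_vec (b (Suc (Suc i)))" "?z = D (Suc i) *\<^sub>v u"
          using D_kernel cz by blast
      then show "\<exists>u\<in>carrier_vec (b (Suc (Suc i))). vcong x v (D (Suc i) *\<^sub>v u)"
        using shift[OF v Dc[of u "Suc i"] z(1)] vcong_iff[OF v Dc[of u "Suc i"]] z(1) by blast
    next
      assume "\<exists>u\<in>carrier_vec (b (Suc (Suc i))). vcong x v (D (Suc i) *\<^sub>v u)"
      then obtain u w where u: "u \<in> carrier_vec (b (Suc (Suc i)))" and w: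
          "w \<in> carrier_vec (b (Suc i))"
        "v = D (Suc i) *\<^sub>v u + x \<cdot>\<^sub>v w"
        using vcong_iff[OF v Dc[of _ "Suc i"]] by blast
      then have "D i *\<^sub>v v = 0\<^sub>v (b i) + x \<cdot>\<^sub>v (D i *\<^sub>v w)"
        using mult_add_distrib_mat_vec[OF D Dc[OF u], of
            "x \<cdot>\<^sub>v w"] mult_mat_smult_vec[OF D w(1)] DD[OF u] by simp
      then show "vcong x (D i *\<^sub>v v) (0\<^sub>v (b i))"
        using vcong_iff[OF Dc[OF v] zero_carrier_vec] Dc[OF w(1)] by blast
    qed
  qed
qed

text \<open>The definite description in \<open>betti\<close> has a value only once all resolutions
  of a module agree. Two resolutions of M agree because each of them agrees with one fixed
  resolution of N, and likewise with the roles exchanged; so independence of the resolution costs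
  nothing extra.\<close>

theorem betti_eq_of_specializations:
  fixes M :: "(('n::finite, 'k::field) pring, 'm) module" and N :: "(('n, 'k) pring, 'l) module"
    and x :: "('n, 'k) pring"
  assumes M: "specialization x act M q" and N: "specialization x act N q'"
    and im: "q ` carrier M = q' ` carrier N"
    and reg: "\<And>p. x * p = 0 \<Longrightarrow> p = 0" and x0: "Poly_Mapping.lookup x 0 = 0"
    and exM: "\<exists>b D e. free_resolution M b D e" and exN: "\<exists>b D e. free_resolution N b D e"
  shows "betti M i = betti N i"
proof -
  have eq: "homology_dim b D i = homology_dim b' D' i"
    if F: "free_resolution M b D e" and G: "free_resolution N b' D' e'" for b D e b' D' e'
  proof -
    note RF = resolution_mod_of_free_resolution[OF F M reg]
        and RG = resolution_mod_of_free_resolution[OF G N reg]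
    have "e ` carrier_vec (b 0) = carrier M" "e' ` carrier_vec (b' 0) = carrier N"
      using F G by (auto simp: free_resolution_def)
    then have im': "(\<lambda>v. q (e v)) ` carrier_vec (b 0) = (\<lambda>v. q' (e' v)) ` carrier_vec (b' 0)"
      using im by (metis image_image)
    show ?thesis
      using homology_dim_le_comparison[OF RF RG im' x0] homology_dim_le_comparison[OF RG RF
          im'[symmetric] x0]
      by (rule order_antisym)
  qed
  obtain b D e b' D' e' where F: "free_resolution M b D e" and G: "free_resolution N b' D' e'"
    using exM exN by blast
  have "betti M i = homology_dim b D i"
    unfolding betti_def using eq F G by (intro the_equality) (metis, metis)
  moreover have "betti N i = homology_dim b D i"
    unfolding betti_def using eq F G by (intro the_equality) (metis, metis)
  ultimately show ?thesis by simp
qed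

section \<open>Semigroup orders\<close>

locale generated_semigroup =
  fixes g :: "'n::finite \<Rightarrow> nat" and S :: "nat set"
  assumes numerical: "numerical_semigroup S" and minimal: "minimally_generates g S"
begin

definition weight :: "('n \<Rightarrow> nat) \<Rightarrow> nat" where
  "weight a = (\<Sum>i\<in>UNIV. a i * g i)"

text \<open>For s in S this is the order of t^s with respect to the powers of the maximal ideal.
  Outside S it is the maximum of the empty set and has no specified value.\<close>

definition order :: "nat \<Rightarrow> nat" where
  "order s = Max {sum a UNIV | a. weight a = s}"

abbreviation n1 :: nat where
  "n1 \<equiv> least_generator g"

lemma zero_in [simp]: "0 \<in> S" and add_in [simp]: "s \<in> S \<Longrightarrow> t \<in> S \<Longrightarrow> s + t \<in> S"
  using numerical by (auto simp: numerical_semigroup_def)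

lemma S_iff: "s \<in> S \<longleftrightarrow> (\<exists>a. weight a = s)"
  using minimal by (auto simp: minimally_generates_def semigroup_span_def weight_def)

lemma weight_in [simp]: "weight a \<in> S"
  by (auto simp: S_iff)

lemma weight_add: "weight (\<lambda>i. a i + b i) = weight a + weight b"
  by (simp add: weight_def algebra_simps sum.distrib)

lemma weight_single: "weight (\<lambda>i. if i = j then k else 0) = k * g j"
  by (simp add: weight_def if_distrib[of "\<lambda>x. x * _"] cong: if_cong)

lemma generator_in [simp]: "g i \<in> S"
  using weight_in[of "\<lambda>l. if l = i then 1 else 0"] by (simp add: weight_single del: weight_in)

lemma span_drop:
  assumes "\<And>a. \<exists>b. weight a = (\<Sum>i\<in>UNIV - {j}. b i * g i)"
  shows False
proof -
  have "semigroup_span g (UNIV - {j}) \<noteq> S"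
    using minimal unfolding minimally_generates_def by blast
  moreover have "semigroup_span g (UNIV - {j}) = S"
  proof
    show "S \<subseteq> semigroup_span g (UNIV - {j})"
      using assms by (fastforce simp: S_iff semigroup_span_def)
    show "semigroup_span g (UNIV - {j}) \<subseteq> S"
    proof
      fix s assume "s \<in> semigroup_span g (UNIV - {j})"
      then obtain a where a: "s = (\<Sum>i\<in>UNIV - {j}. a i * g i)" by (auto simp: semigroup_span_def)
      have "weight (a(j := 0)) = (a(j := 0)) j * g j + (\<Sum>i\<in>UNIV - {j}. (a(j := 0)) i * g i)"
        unfolding weight_def by (subst sum.remove[of UNIV j]) auto
      also have "\<dots> = s" by (simp add: a)
      finally show "s \<in> S" by (auto simp: S_iff)
    qed
  qed
  ultimately show False by simp
qed

lemma weight_remove: "weight a = a j * g j + (\<Sum>i\<in>UNIV - {j}. a i * g i)"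
  unfolding weight_def by (rule sum.remove) auto

lemma generator_pos [simp]: "g i > 0"
proof (rule ccontr)
  assume "\<not> g i > 0"
  then have "weight a = (\<Sum>l\<in>UNIV - {i}. a l * g l)" for a by (simp add: weight_remove[of a i])
  then show False using span_drop by blast
qed

lemma generator_inj: "inj g"
proof (rule injI, rule ccontr)
  fix i j assume eq: "g i = g j" and ne: "i \<noteq> j"
  \<comment> \<open>Copies of n_j are recounted as copies of the equal generator n_i, which makes
    n_j redundant.\<close>
  have "weight a = (\<Sum>l\<in>UNIV - {j}. (a(i := a i + a j)) l * g l)" for a
  proof -
    have "(\<Sum>l\<in>UNIV - {j}. (a(i := a i + a j)) l * g l) = (a i + a j) * g i + (\<Sum>l\<in>UNIV - {j} - {i}. a
        l * g l)"
      using ne by (subst sum.remove[of "UNIV - {j}" i]) (auto intro!: sum.cong)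
    moreover have "(\<Sum>l\<in>UNIV - {j}. a l * g l) = a i * g i + (\<Sum>l\<in>UNIV - {j} - {i}. a l * g l)"
      using ne by (intro sum.remove) auto
    ultimately show ?thesis using eq by (simp add: weight_remove[of a j] algebra_simps)
  qed
  then show False using span_drop by blast
qed

lemma n1_le: "n1 \<le> g i"
  by (auto simp: least_generator_def)

lemma n1_generator: "\<exists>i. g i = n1"
proof -
  have "n1 \<in> range g" unfolding least_generator_def by (rule Min_in) auto
  then show ?thesis by auto
qed

lemma n1_pos [simp]: "n1 > 0" and n1_in [simp]: "n1 \<in> S"
  using n1_generator generator_pos generator_in by metis+

lemma length_le_weight: "sum a UNIV \<le> weight a"
  unfolding weight_def by (intro sum_mono) (simp add: Suc_leI)

lemma finite_lengths: "finite {sum a UNIV | a. weight a = s}"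
  by (rule finite_subset[of _ "{..s}"]) (use length_le_weight in auto)

lemma order_ge: "sum a UNIV \<le> order (weight a)"
  unfolding order_def by (rule Max_ge[OF finite_lengths]) auto

lemma order_attained: "s \<in> S \<Longrightarrow> \<exists>a. weight a = s \<and> sum a UNIV = order s"
proof -
  assume "s \<in> S"
  then have "{sum a UNIV | a. weight a = s} \<noteq> {}" by (auto simp: S_iff)
  from Max_in[OF finite_lengths this] show ?thesis by (auto simp: order_def)
qed

lemma order_add:
  assumes "s \<in> S" "t \<in> S"
  shows "order s + order t \<le> order (s + t)"
proof -
  obtain a b where "weight a = s" "sum a UNIV = order s" "weight b = t" "sum b UNIV = order t"
    using order_attained assms by blast
  then show ?thesis using order_ge[of "\<lambda>i. a i + b i"] by (simp add: weight_add sum.distrib)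
qed

lemma order_generator: "1 \<le> order (g i)"
  using order_ge[of "\<lambda>l. if l = i then 1 else 0"] by (simp add: weight_single)

lemma order_0 [simp]: "order 0 = 0"
proof -
  obtain a where "weight a = 0" "sum a UNIV = order 0" using order_attained[of 0] by auto
  then show ?thesis using length_le_weight[of a] by simp
qed

lemma n1_order_le: "s \<in> S \<Longrightarrow> n1 * order s \<le> s"
proof -
  assume "s \<in> S"
  then obtain a where a: "weight a = s" "sum a UNIV = order s" using order_attained by blast
  have "n1 * sum a UNIV \<le> weight a"
    unfolding weight_def sum_distrib_left by (intro sum_mono) (simp add: n1_le mult.commute)
  with a show ?thesis by simp
qed

lemma n1_multiple_in [simp]: "n1 * k \<in> S"
  by (induction k) auto

lemma order_n1_multiple: "order (n1 * k) = k"
proof (rule order_antisym)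
  show "order (n1 * k) \<le> k" using n1_order_le[of "n1 * k"] by simp
  obtain i where "g i = n1" using n1_generator by blast
  then show "k \<le> order (n1 * k)"
    using order_ge[of "\<lambda>l. if l = i then k else 0"] by (simp add: weight_single mult.commute)
qed

text \<open>One generator is removed from a longest expression. The bound on the loss of order is
  what allows t^s to be factored within the powers of the maximal ideal.\<close>

lemma order_split:
  assumes "s \<in> S" "s \<noteq> 0"
  shows "\<exists>i. \<exists>t\<in>S. s = t + g i \<and> order s \<le> Suc (order t)"
proof -
  obtain a where a: "weight a = s" "sum a UNIV = order s" using order_attained assms by blast
  have "\<exists>i. a i \<noteq> 0"
  proof (rule ccontr)
    assume "\<nexists>i. a i \<noteq> 0"
    then have "weight a = 0" by (simp add: weight_def)
    then show False using assms(2) a(1) by simp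
  qed
  then obtain i where i: "a i \<noteq> 0" by blast
  define b where "b = a(i := a i - 1)"
  have ab: "a = (\<lambda>l. b l + (if l = i then 1 else 0))" using i by (intro ext) (auto simp: b_def)
  have "s = weight b + g i" unfolding a(1)[symmetric] by (subst ab, subst weight_add)
      (simp add: weight_single)
  moreover have "order s = Suc (sum b UNIV)"
    unfolding a(2)[symmetric] by (subst ab) (simp add: sum.distrib)
  ultimately show ?thesis using order_ge[of b] weight_in by fastforce
qed

text \<open>An expression of maximal length uses each generator other than the least one fewer than
  \<open>n\<^sub>1\<close> times: \<open>n\<^sub>1\<close> copies of \<open>n\<^sub>i\<close> could be traded for \<open>n\<^sub>i\<close> copies of \<open>n\<^sub>1\<close>.\<close>

lemma order_split_n1:
  assumes s: "s \<in> S" and large: "card (UNIV :: 'n set) * n1 \<le> order s"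
  shows "\<exists>t\<in>S. s = t + n1 \<and> order s \<le> Suc (order t)"
proof -
  obtain j where j: "g j = n1" using n1_generator by blast
  obtain a where a: "weight a = s" "sum a UNIV = order s" using order_attained s by blast
  have small: "a i < n1" if "i \<noteq> j" for i
  proof (rule ccontr)
    assume "\<not> a i < n1"
    then have ai: "n1 \<le> a i" by simp
    define b where "b = a(i := a i - n1)"
    have ab: "a = (\<lambda>l. b l + (if l = i then n1 else 0))" using ai by (intro ext) (auto simp: b_def)
    define c where "c = (\<lambda>l. b l + (if l = j then g i else 0))"
    have "s = weight b + n1 * g i" unfolding a(1)[symmetric] by (subst ab, subst weight_add)
        (simp add: weight_single)
    moreover have "weight c = weight b + g i * n1" unfolding c_def by (subst weight_add)
        (simp add: weight_single j)
    ultimately have "weight c = s" by (simp add: mult.commute)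
    then have "sum c UNIV \<le> order s" using order_ge[of c] by simp
    moreover have "sum c UNIV = sum b UNIV + g i" by (simp add: c_def sum.distrib)
    moreover have "order s = sum b UNIV + n1" unfolding a(2)[symmetric] by (subst ab)
        (simp add: sum.distrib)
    \<comment> \<open>So n_i exceeds n_1, and the trade would strictly lengthen a longest
      expression.\<close>
    moreover have "g i \<noteq> n1" using generator_inj j that by (metis injD)
    ultimately show False using n1_le[of i] by linarith
  qed
  \<comment> \<open>If n_1 did not occur, all d coefficients would be below n_1 and the length below
    d n_1; this is the origin of the bound in \<open>large\<close>.\<close>
  have "a j > 0"
  proof (rule ccontr)
    assume "\<not> a j > 0"
    then have "a i < n1" for i using small[of i] by (cases "i = j") auto
    then have "sum a UNIV < (\<Sum>i\<in>(UNIV :: 'n set). n1)" by (intro sum_strict_mono) auto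
    then show False using large a(2) by simp
  qed
  define b where "b = a(j := a j - 1)"
  have ab: "a = (\<lambda>l. b l + (if l = j then 1 else 0))" using \<open>a j > 0\<close> by (intro ext)
      (auto simp: b_def)
  have "s = weight b + n1" unfolding a(1)[symmetric] by (subst ab, subst weight_add)
      (simp add: weight_single j)
  moreover have "order s = Suc (sum b UNIV)"
    unfolding a(2)[symmetric] by (subst ab) (simp add: sum.distrib)
  ultimately show ?thesis using order_ge[of b] weight_in by fastforce
qed

abbreviation AP :: "nat set" where
  "AP \<equiv> apery_set S n1"

lemma AP_D: "s \<in> AP \<Longrightarrow> s \<in> S" "s \<in> AP \<Longrightarrow> t \<in> S \<Longrightarrow> s \<noteq> t + n1"
  by (auto simp: apery_set_def)

lemma AP_cases:
  assumes "s \<in> S" "s \<notin> AP"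
  obtains t where "t \<in> S" "s = t + n1"
  using assms by (auto simp: apery_set_def)

text \<open>Multiplication never leads from outside the Apery set back into it, so discarding the
  exponents outside is compatible with the action of P.\<close>

lemma AP_summand:
  assumes "s + t \<in> AP" "s \<in> S" "t \<in> S"
  shows "s \<in> AP"
proof (rule ccontr)
  assume "s \<notin> AP"
  then obtain y where "y \<in> S" "s = y + n1" using AP_cases[OF assms(2)] by blast
  then have "s + t = (y + t) + n1" by simp
  then show False using AP_D(2)[OF assms(1), of "y + t"] \<open>y \<in> S\<close> assms(3) by simp
qed

text \<open>A longest expression of s, joined with m, is an expression of s + weight m, and by
  homogeneity all expressions of that element are equally long. Homogeneity is used only in this
  form.\<close>

lemma homogeneous_order:
  assumes hom: "homogeneous_semigroup g S" and AP: "s + weight m \<in> AP" and s: "s \<in> S"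
  shows "order (s + weight m) = order s + sum m UNIV"
proof (cases "s + weight m = 0")
  \<comment> \<open>The definition of homogeneity says nothing about 0, but here m itself has length
    0.\<close>
  case True
  then show ?thesis using length_le_weight[of m] by simp
next
  case False
  obtain a where a: "weight a = s" "sum a UNIV = order s" using order_attained s by blast
  obtain b where b: "weight b = s + weight m" "sum b UNIV = order (s + weight m)"
    using order_attained s by (meson add_in weight_in)
  have "weight (\<lambda>i. a i + m i) = s + weight m" by (simp add: weight_add a)
  with b(1) have "sum b UNIV = sum (\<lambda>i. a i + m i) UNIV"
    by (rule hom[unfolded homogeneous_semigroup_def, rule_format, OF AP False, folded weight_def, OF
        conjI])
  then show ?thesis using a b by (simp add: sum.distrib)
qed

end

section \<open>Rings, quotients and modules along a homomorphism\<close>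

lemma ring_on_simps [simp]:
  "carrier (ring_on B) = B" "x \<otimes>\<^bsub>ring_on B\<^esub> y = x * y" "x \<oplus>\<^bsub>ring_on B\<^esub> y = x + y"
  "\<one>\<^bsub>ring_on B\<^esub> = 1" "\<zero>\<^bsub>ring_on B\<^esub> = 0"
  by (simp_all add: ring_on_def class_ring_simps)

lemma ring_on_cring:
  fixes B :: "'a::comm_ring_1 set"
  assumes "0 \<in> B" "1 \<in> B" "\<And>x y. x \<in> B \<Longrightarrow> y \<in> B \<Longrightarrow> x + y \<in> B"
    "\<And>x y. x \<in> B \<Longrightarrow> y \<in> B \<Longrightarrow> x * y \<in> B" "\<And>x. x \<in> B \<Longrightarrow> - x \<in> B"
  shows "cring (ring_on B)"
proof (rule cringI)
  show "abelian_group (ring_on B)"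
  proof (rule abelian_groupI)
    fix x assume "x \<in> carrier (ring_on B)"
    then show "\<exists>y\<in>carrier (ring_on B). y \<oplus>\<^bsub>ring_on B\<^esub> x = \<zero>\<^bsub>ring_on B\<^esub>"
      using assms(5) by (intro bexI[of _ "- x"]) auto
  qed (use assms in \<open>auto simp: algebra_simps\<close>)
  show "comm_monoid (ring_on B)"
    by (rule comm_monoidI) (use assms in \<open>auto simp: algebra_simps\<close>)
qed (auto simp: algebra_simps)

lemma ring_on_a_inv:
  fixes B :: "'a::comm_ring_1 set"
  assumes "cring (ring_on B)" "x \<in> B" "- x \<in> B"
  shows "\<ominus>\<^bsub>ring_on B\<^esub> x = - x"
proof -
  interpret cring "ring_on B" by (rule assms(1))
  show ?thesis using assms(2,3) by (intro minus_equality) auto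
qed

lemma ring_on_ideal:
  fixes B :: "'a::comm_ring_1 set"
  assumes B: "cring (ring_on B)" and "I \<subseteq> B" "0 \<in> I" "\<And>x y. x \<in> I \<Longrightarrow> y \<in> I \<Longrightarrow> x + y \<in> I"
    "\<And>x. x \<in> I \<Longrightarrow> - x \<in> I" "\<And>x r. x \<in> I \<Longrightarrow> r \<in> B \<Longrightarrow> r * x \<in> I"
  shows "ideal I (ring_on B)"
proof (rule idealI)
  interpret cring "ring_on B" by (rule B)
  show "ring (ring_on B)" by (rule ring_axioms)
  show "subgroup I (add_monoid (ring_on B))"
  proof (rule add.subgroupI)
    fix x assume x: "x \<in> I"
    have "\<ominus>\<^bsub>ring_on B\<^esub> x = - x"
      by (rule ring_on_a_inv[OF B]) (use assms(2) x assms(5)[OF x] in blast)+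
    then show "\<ominus>\<^bsub>ring_on B\<^esub> x \<in> I" using assms(5)[OF x] by simp
  qed (use assms in auto)
qed (use assms(6) in \<open>auto simp: mult.commute\<close>)

lemma (in ideal) quot_carrier: "C \<in> carrier (R Quot I) \<longleftrightarrow> (\<exists>r\<in>carrier R. C = I +> r)"
  by (auto simp: FactRing_def A_RCOSETS_def')

lemma (in ideal) coset_eq_iff:
  "r \<in> carrier R \<Longrightarrow> s \<in> carrier R \<Longrightarrow> I +> r = I +> s \<longleftrightarrow> r \<ominus> s \<in> I"
  using quotient_eq_iff_same_a_r_cos[OF is_ideal] by auto

lemma (in ideal) coset_eq_zero_iff:
  "r \<in> carrier R \<Longrightarrow> I +> r = \<zero>\<^bsub>R Quot I\<^esub> \<longleftrightarrow> r \<in> I"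
  using coset_eq_iff[of r \<zero>] a_coset_add_zero a_subset by (simp add: FactRing_def a_minus_def)

lemma (in ideal) induced_hom:
  assumes A: "ring A" and hom: "\<phi> \<in> Ring.ring_hom R A" and I0: "\<And>i. i \<in> I \<Longrightarrow> \<phi> i = \<zero>\<^bsub>A\<^esub>"
  shows "\<exists>h\<in>Ring.ring_hom (R Quot I) A. \<forall>r\<in>carrier R. h (I +> r) = \<phi> r"
proof -
  interpret h: ring_hom_ring R A \<phi> using hom A ring_axioms by (simp add: ring_hom_ringI2)
  interpret q: ring_hom_ring R "R Quot I" "(+>) I" by (rule rcos_ring_hom_ring)
  define h where "h = (\<lambda>C. \<phi> (SOME r. r \<in> carrier R \<and> I +> r = C))"
  have h: "h (I +> r) = \<phi> r" if r: "r \<in> carrier R" for r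
  proof -
    define s where "s = (SOME s. s \<in> carrier R \<and> I +> s = I +> r)"
    have s: "s \<in> carrier R" "I +> s = I +> r"
      using someI[of "\<lambda>s. s \<in> carrier R \<and> I +> s = I +> r" r] r by (auto simp: s_def)
    then have "s \<ominus> r \<in> I" using coset_eq_iff r by blast
    then have "\<phi> s \<ominus>\<^bsub>A\<^esub> \<phi> r = \<zero>\<^bsub>A\<^esub>" using I0[of "s \<ominus> r"] s r by (simp add: a_minus_def)
    then have "\<phi> s = \<phi> r" using ring.r_right_minus_eq[OF A] s r by simp
    then show ?thesis by (simp add: h_def s_def)
  qed
  have "h \<in> Ring.ring_hom (R Quot I) A"
  proof (rule ring_hom_memI)
    fix C assume "C \<in> carrier (R Quot I)"
    then show "h C \<in> carrier A" using h by (auto simp: quot_carrier)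
  next
    fix C D assume "C \<in> carrier (R Quot I)" "D \<in> carrier (R Quot I)"
    then obtain r s where rs: "r \<in> carrier R" "C = I +> r" "s \<in> carrier R" "D = I +> s"
      by (auto simp: quot_carrier)
    have "C \<otimes>\<^bsub>R Quot I\<^esub> D = I +> (r \<otimes> s)" "C \<oplus>\<^bsub>R Quot I\<^esub> D = I +> (r \<oplus> s)"
      using q.hom_mult[OF rs(1,3)] q.hom_add[OF rs(1,3)] rs(2,4) by simp_all
    then show "h (C \<otimes>\<^bsub>R Quot I\<^esub> D) = h C \<otimes>\<^bsub>A\<^esub> h D" "h (C \<oplus>\<^bsub>R Quot I\<^esub> D) = h C \<oplus>\<^bsub>A\<^esub> h D"
      using rs h[of r] h[of s] h[of "r \<otimes> s"] h[of "r \<oplus> s"] by simp_all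
  next
    have "h (I +> \<one>) = \<phi> \<one>" by (rule h[OF one_closed])
    then show "h \<one>\<^bsub>R Quot I\<^esub> = \<one>\<^bsub>A\<^esub>" using q.hom_one h.hom_one by simp
  qed
  with h show ?thesis by blast
qed

lemma hom_kernel_ideal:
  assumes G: "cring G" and h: "h \<in> Ring.ring_hom G (class_ring :: 'b::comm_ring_1 ring)"
  shows "ideal {c \<in> carrier G. h c = 0} G"
proof -
  interpret cring G by (rule G)
  have "ring (class_ring :: 'b ring)" by (rule class_ring.ring_axioms)
  then interpret h: ring_hom_ring G "class_ring :: 'b ring" h
    by (intro ring_hom_ringI2 ring_axioms h)
  have "a_kernel G class_ring h = {c \<in> carrier G. h c = 0}"
    unfolding a_kernel_def' class_ring_simps ..
  with h.kernel_is_ideal show ?thesis by (rule subst[rotated])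
qed

lemma hom_kernel_prime:
  assumes G: "cring G" and h: "h \<in> Ring.ring_hom G (class_ring :: 'b::idom ring)"
  shows "primeideal {c \<in> carrier G. h c = 0} G"
proof (rule primeidealI)
  interpret cring G by (rule G)
  show "ideal {c \<in> carrier G. h c = 0} G" by (rule hom_kernel_ideal[OF G h])
  show "cring G" by (rule G)
  have "h \<one>\<^bsub>G\<^esub> = 1" using ring_hom_one[OF h] by (simp add: class_ring_simps)
  then show "carrier G \<noteq> {c \<in> carrier G. h c = 0}" using one_closed by force
  fix a b assume "a \<in> carrier G" "b \<in> carrier G" "a \<otimes>\<^bsub>G\<^esub> b \<in> {c \<in> carrier G. h c = 0}"
  then show "a \<in> {c \<in> carrier G. h c = 0} \<or> b \<in> {c \<in> carrier G. h c = 0}"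
    using ring_hom_mult[OF h, of a b] by (simp add: class_ring_simps)
qed

lemma hom_kernel_maximal:
  assumes G: "cring G" and h: "h \<in> Ring.ring_hom G (class_ring :: 'k::field ring)" and surj:
      "h ` carrier G = UNIV"
  shows "maximalideal {c \<in> carrier G. h c = 0} G"
proof (rule maximalidealI)
  interpret cring G by (rule G)
  have "ring (class_ring :: 'k ring)" by (rule class_ring.ring_axioms)
  then interpret h: ring_hom_ring G "class_ring :: 'k ring" h
    by (intro ring_hom_ringI2 ring_axioms h)
  have h1: "h \<one>\<^bsub>G\<^esub> = 1" using h.hom_one by (simp add: class_ring_simps)
  show "ideal {c \<in> carrier G. h c = 0} G" by (rule hom_kernel_ideal[OF G h])
  show "carrier G \<noteq> {c \<in> carrier G. h c = 0}" using h1 one_closed by force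
  fix J assume J: "ideal J G" and KJ: "{c \<in> carrier G. h c = 0} \<subseteq> J" and JG: "J \<subseteq> carrier G"
  interpret J: ideal J G by (rule J)
  show "J = {c \<in> carrier G. h c = 0} \<or> J = carrier G"
  proof (cases "J \<subseteq> {c \<in> carrier G. h c = 0}")
    case False
    then obtain c where c: "c \<in> J" "h c \<noteq> 0" using JG by blast
    then have cG: "c \<in> carrier G" using JG by blast
    \<comment> \<open>With d a lift of the inverse of h c, the element 1 - d c lies in the kernel
      and so in J, which then contains 1.\<close>
    have "inverse (h c) \<in> h ` carrier G" using surj by simp
    then obtain d where d: "d \<in> carrier G" "h d = inverse (h c)" by (metis imageE)
    have dc: "d \<otimes>\<^bsub>G\<^esub> c \<in> J" using J.I_l_closed[OF c(1) d(1)] .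
    have "h (\<one>\<^bsub>G\<^esub> \<ominus>\<^bsub>G\<^esub> d \<otimes>\<^bsub>G\<^esub> c) = 1 - h d * h c"
      using cG d h1 by (simp add: a_minus_def class_ring_simps)
    then have "h (\<one>\<^bsub>G\<^esub> \<ominus>\<^bsub>G\<^esub> d \<otimes>\<^bsub>G\<^esub> c) = 0" using c d by simp
    then have "\<one>\<^bsub>G\<^esub> \<ominus>\<^bsub>G\<^esub> d \<otimes>\<^bsub>G\<^esub> c \<in> J" using KJ cG d by auto
    then have "(\<one>\<^bsub>G\<^esub> \<ominus>\<^bsub>G\<^esub> d \<otimes>\<^bsub>G\<^esub> c) \<oplus>\<^bsub>G\<^esub> d \<otimes>\<^bsub>G\<^esub> c \<in> J" using dc by (rule J.a_closed)
    moreover have "(\<one>\<^bsub>G\<^esub> \<ominus>\<^bsub>G\<^esub> d \<otimes>\<^bsub>G\<^esub> c) \<oplus>\<^bsub>G\<^esub> d \<otimes>\<^bsub>G\<^esub> c = \<one>\<^bsub>G\<^esub>"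
      using cG d by (simp add: a_minus_def a_assoc l_neg)
    ultimately show ?thesis using J.one_imp_carrier by simp
  qed (use KJ in blast)
qed

lemma module_along_simps [simp]:
  "carrier (module_along h A) = carrier A" "x \<oplus>\<^bsub>module_along h A\<^esub> y = x \<oplus>\<^bsub>A\<^esub> y"
  "\<zero>\<^bsub>module_along h A\<^esub> = \<zero>\<^bsub>A\<^esub>" "r \<odot>\<^bsub>module_along h A\<^esub> x = h r \<otimes>\<^bsub>A\<^esub> x"
  by (simp_all add: module_along_def ring.defs module.defs)

lemma module_along_module:
  fixes h :: "'r::comm_ring_1 \<Rightarrow> 'a"
  assumes A: "cring A" and h: "h \<in> Ring.ring_hom class_ring A"
  shows "module class_ring (module_along h A)"
proof -
  interpret A: cring A by (rule A)
  have hc: "h r \<in> carrier A" for r using ring_hom_closed[OF h] by (simp add: class_ring_simps)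
  have hm: "h (r * s) = h r \<otimes>\<^bsub>A\<^esub> h s" and ha: "h (r + s) = h r \<oplus>\<^bsub>A\<^esub> h s" for r s
    using ring_hom_mult[OF h, of r s] ring_hom_add[OF h, of r s] by (simp_all add: class_ring_simps)
  have h1: "h 1 = \<one>\<^bsub>A\<^esub>" using ring_hom_one[OF h] by (simp add: class_ring_simps)
  have "abelian_group (module_along h A)"
  proof (rule abelian_groupI)
    show "\<exists>y\<in>carrier (module_along h A). y \<oplus>\<^bsub>module_along h A\<^esub> x = \<zero>\<^bsub>module_along h A\<^esub>"
      if "x \<in> carrier (module_along h A)" for x
      using that A.l_neg by (intro bexI[of _ "\<ominus>\<^bsub>A\<^esub> x"]) auto
  qed (auto simp: A.a_ac)
  moreover have "cring (class_ring :: 'r ring)" by (rule class_cring.cring_axioms)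
  ultimately show ?thesis
    by (intro moduleI)
      (auto simp: hc hm ha h1 A.l_distr A.r_distr A.m_assoc class_ring_simps)
qed

text \<open>The module is cyclic, so P itself, as vectors of length 1, can start the
  resolution.\<close>

lemma module_along_resolution_exists:
  fixes h :: "('n::finite, 'k::field) pring \<Rightarrow> 'a"
  assumes A: "cring A" and h: "h \<in> Ring.ring_hom class_ring A" and surj: "range h = carrier A"
  shows "\<exists>b D e. free_resolution (module_along h A) b D e"
proof (rule free_resolution_exists)
  interpret A: cring A by (rule A)
  interpret V: vec_module "TYPE(('n, 'k) pring)" 1 .
  have hc: "h r \<in> carrier A" for r using ring_hom_closed[OF h] by (simp add: class_ring_simps)
  have hm: "h (r * s) = h r \<otimes>\<^bsub>A\<^esub> h s" and ha: "h (r + s) = h r \<oplus>\<^bsub>A\<^esub> h s" for r s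
    using ring_hom_mult[OF h, of r s] ring_hom_add[OF h, of r s] by (simp_all add: class_ring_simps)
  show "mod_hom class_ring (module_vec TYPE(('n, 'k) pring) 1) (module_along h A) (\<lambda>v. h (v $ 0))"
  proof (intro mod_hom.intro mod_hom_axioms.intro)
    show "module class_ring (module_vec TYPE(('n, 'k) pring) 1)" by (rule V.module_axioms)
    show "module class_ring (module_along h A)" by (rule module_along_module[OF A h])
    show "(\<lambda>v. h (v $ 0)) \<in> module_hom class_ring (module_vec TYPE(('n, 'k) pring) 1) (module_along
        h A)"
      by (auto simp: module_hom_def module_vec_simps hc ha hm)
  qed
  show "(\<lambda>v. h (v $ 0)) ` carrier_vec 1 = carrier (module_along h A)"
  proof
    show "carrier (module_along h A) \<subseteq> (\<lambda>v. h (v $ 0)) ` carrier_vec 1"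
    proof
      fix a assume "a \<in> carrier (module_along h A)"
      then obtain p where "a = h p" using surj by auto
      then show "a \<in> (\<lambda>v. h (v $ 0)) ` carrier_vec 1"
        by (intro image_eqI[of _ _ "vec 1 (\<lambda>_. p)"]) auto
    qed
  qed (use hc in auto)
qed

section \<open>Induction on polynomials and substitution homomorphisms\<close>

lemma pring_induct [case_names single add]:
  fixes p :: "('n, 'k::comm_monoid_add) pring"
  assumes single: "\<And>m a. Q (Poly_Mapping.single m a)" and add: "\<And>p q. Q p \<Longrightarrow> Q q \<Longrightarrow> Q (p + q)"
  shows "Q p"
proof -
  have "Q (\<Sum>m\<in>K. Poly_Mapping.single m (Poly_Mapping.lookup p m))" if "finite K" for K
    using that
  proof induction
    case empty
    show ?case using single[of 0 0] by simp
  qed (simp add: single add)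
  from this[of "Poly_Mapping.keys p"]
  have "Q (\<Sum>m\<in>Poly_Mapping.keys p. Poly_Mapping.single m (Poly_Mapping.lookup p m))" by simp
  also have "(\<Sum>m\<in>Poly_Mapping.keys p. Poly_Mapping.single m (Poly_Mapping.lookup p m)) = p"
    by (rule poly_mapping_eqI) (auto simp: lookup_sum lookup_single when_def in_keys_iff)
  finally show ?thesis .
qed

context
  fixes c :: "'k::field \<Rightarrow> 'a::comm_ring_1" and x :: "'n::finite \<Rightarrow> 'a"
  assumes c0: "c 0 = 0" and c1: "c 1 = 1" and ca: "\<And>a b. c (a + b) = c a + c b"
    and cm: "\<And>a b. c (a * b) = c a * c b"
begin

lemma psubst_single: "psubst c x (Poly_Mapping.single m a)
    = c a * (\<Prod>i\<in>UNIV. x i ^ Poly_Mapping.lookup m i)"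
  by (cases "a = 0") (simp_all add: psubst_def c0)

lemma psubst_add: "psubst c x (p + q) = psubst c x p + psubst c x q"
proof -
  let ?f = "\<lambda>p m. c (Poly_Mapping.lookup p m) * (\<Prod>i\<in>UNIV. x i ^ Poly_Mapping.lookup m i)"
  \<comment> \<open>The supports of p, q and p + q differ, so all three sums are extended to the
    union of the first two.\<close>
  have ext: "psubst c x r = sum (?f r) (Poly_Mapping.keys p \<union> Poly_Mapping.keys q)"
    if "Poly_Mapping.keys r \<subseteq> Poly_Mapping.keys p \<union> Poly_Mapping.keys q" for r
    unfolding psubst_def by (rule sum.mono_neutral_left) (use that c0 in \<open>auto simp: in_keys_iff\<close>)
  show ?thesis
    using keys_add[of p q] by (simp add: ext lookup_add ca distrib_right sum.distrib)
qed

lemma psubst_mult: "psubst c x (p * q) = psubst c x p * psubst c x q"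
proof (induction p rule: pring_induct)
  case (single m a)
  show ?case
  proof (induction q rule: pring_induct)
    case (single l b)
    then show ?case
      by (simp add: mult_single psubst_single cm lookup_add power_add prod.distrib)
  qed (simp add: psubst_add distrib_left)
qed (simp add: psubst_add distrib_right)

lemma psubst_one: "psubst c x 1 = 1"
  using psubst_single[of 0 1] by (simp add: c1)

end

section \<open>The semigroup ring and its tangent cone\<close>

lemma coeff_mult_nonzeroE:
  fixes p q :: "'a::comm_ring_1 poly"
  assumes "coeff (p * q) s \<noteq> 0"
  obtains a b where "s = a + b" "coeff p a \<noteq> 0" "coeff q b \<noteq> 0"
proof -
  have "\<exists>i\<in>{..s}. coeff p i * coeff q (s - i) \<noteq> 0"
    using assms unfolding coeff_mult by (meson sum.neutral)
  then obtain i where "i \<le> s" "coeff p i * coeff q (s - i) \<noteq> 0" by auto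
  then show thesis by (intro that[of i "s - i"]) auto
qed

text \<open>Only terms that occur in f have to lie in T, so that what is known about f can be used
  for their exponents.\<close>

lemma poly_monom_induct:
  fixes f :: "'a::comm_ring_1 poly"
  assumes zero: "0 \<in> T" and add: "\<And>p q. p \<in> T \<Longrightarrow> q \<in> T \<Longrightarrow> p + q \<in> T"
    and monom: "\<And>s. coeff f s \<noteq> 0 \<Longrightarrow> monom (coeff f s) s \<in> T"
  shows "f \<in> T"
proof -
  have m: "monom (coeff f s) s \<in> T" for s using monom[of s] zero by (cases "coeff f s = 0") auto
  have "(\<Sum>s\<in>K. monom (coeff f s) s) \<in> T" if "finite K" for K
    using that by (induction rule: finite_induct) (simp_all add: zero add m)
  then have "(\<Sum>s\<le>degree f. monom (coeff f s) s) \<in> T" by simp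
  then show ?thesis by (simp add: poly_as_sum_of_monoms)
qed

context generated_semigroup
begin

text \<open>The j-th power of the maximal ideal, described by the monomials spanning it;
  \<open>ideal_power_eq\<close> identifies the two.\<close>

definition filt :: "nat \<Rightarrow> 'k::field poly set" where
  "filt j = {f. \<forall>s. coeff f s \<noteq> 0 \<longrightarrow> s \<in> S \<and> j \<le> order s}"

lemma filt_0: "filt 0 = semigroup_carrier S"
  by (simp add: filt_def semigroup_carrier_def)

lemma filt_zero [simp]: "0 \<in> filt j"
  by (simp add: filt_def)

lemma filt_add: "p \<in> filt j \<Longrightarrow> q \<in> filt j \<Longrightarrow> p + q \<in> filt j"
  unfolding filt_def coeff_add mem_Collect_eq by (metis add.right_neutral)

lemma filt_uminus: "p \<in> filt j \<Longrightarrow> - p \<in> filt j"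
  by (simp add: filt_def)

lemma filt_mult: "p \<in> filt i \<Longrightarrow> q \<in> filt j \<Longrightarrow> p * q \<in> filt (i + j)"
proof -
  assume p: "p \<in> filt i" and q: "q \<in> filt j"
  have "s \<in> S \<and> i + j \<le> order s" if nz: "coeff (p * q) s \<noteq> 0" for s
  proof -
    from nz obtain a b where ab: "s = a + b" "coeff p a \<noteq> 0" "coeff q b \<noteq> 0" by
        (rule coeff_mult_nonzeroE)
    then have "a \<in> S" "i \<le> order a" "b \<in> S" "j \<le> order b" using p q by (auto simp: filt_def)
    then show ?thesis using order_add[of a b] ab(1) by auto
  qed
  then show ?thesis by (simp add: filt_def)
qed

lemma filt_mono: "i \<le> j \<Longrightarrow> filt j \<subseteq> filt i"
  by (force simp: filt_def)

lemma filt_one [simp]: "1 \<in> filt 0"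
  by (simp add: filt_def)

lemma filt_monom: "s \<in> S \<Longrightarrow> j \<le> order s \<Longrightarrow> monom c s \<in> filt j"
  by (simp add: filt_def)

lemma filt_sum: "(\<And>i. i \<in> A \<Longrightarrow> f i \<in> filt j) \<Longrightarrow> sum f A \<in> filt j"
  by (induction A rule: infinite_finite_induct) (auto intro: filt_add)

lemma filt_monomD: "f \<in> filt j \<Longrightarrow> coeff f s \<noteq> 0 \<Longrightarrow> s \<in> S \<and> j \<le> order s"
  by (simp add: filt_def)

lemma semigroup_ring_cring: "cring (ring_on (filt 0) :: 'k::field poly ring)"
  by (rule ring_on_cring) (auto intro: filt_add filt_uminus filt_mult[of _ 0 _ 0, simplified])

lemma order_pos: "s \<in> S \<Longrightarrow> s \<noteq> 0 \<Longrightarrow> 1 \<le> order s"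
proof -
  assume "s \<in> S" "s \<noteq> 0"
  then obtain i t where "t \<in> S" "s = t + g i" using order_split by blast
  then show ?thesis using order_add[of t "g i"] order_generator[of i] by simp
qed

lemma max_ideal_eq: "(max_ideal g S :: 'k::field poly set) = filt (Suc 0)"
proof
  have R: "ring (ring_on (filt 0) :: 'k poly ring)" using semigroup_ring_cring by
      (rule cring.axioms)
  have id: "ideal (filt (Suc 0)) (ring_on (filt 0) :: 'k poly ring)"
    by (rule ring_on_ideal[OF semigroup_ring_cring])
      (use filt_mono[of 0 "Suc 0"] in \<open>auto intro: filt_add filt_uminus filt_mult[of _ 0 _
          "Suc 0", simplified]\<close>)
  have m: "(max_ideal g S :: 'k poly set) = Idl\<^bsub>ring_on (filt 0)\<^esub> (range (\<lambda>i. monom 1 (g i)))"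
    by (simp add: max_ideal_def semigroup_ring_def filt_0)
  show "max_ideal g S \<subseteq> (filt (Suc 0) :: 'k poly set)"
    unfolding m by (rule ring.genideal_minimal[OF R id])
        (auto intro!: filt_monom order_generator[simplified])
  have gens: "range (\<lambda>i. monom 1 (g i)) \<subseteq> carrier (ring_on (filt 0) :: 'k poly ring)"
    by (auto intro!: filt_monom)
  interpret I: ideal "max_ideal g S" "ring_on (filt 0) :: 'k poly ring"
    unfolding m by (rule ring.genideal_ideal[OF R gens])
  show "filt (Suc 0) \<subseteq> (max_ideal g S :: 'k poly set)"
  proof
    fix f :: "'k poly" assume f: "f \<in> filt (Suc 0)"
    show "f \<in> max_ideal g S"
    proof (rule poly_monom_induct)
      fix s assume nz: "coeff f s \<noteq> 0"
      then have "s \<in> S" "s \<noteq> 0" using filt_monomD[OF f nz] by (auto intro: gr0I)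
      then obtain i t where t: "t \<in> S" "s = t + g i" using order_split by blast
      have "(monom 1 (g i) :: 'k poly) \<in> max_ideal g S" unfolding m
          using ring.genideal_self[OF R gens] by auto
      then have "monom (coeff f s) t \<otimes>\<^bsub>ring_on (filt 0)\<^esub> monom 1 (g i) \<in> max_ideal g S"
        by (rule I.I_l_closed) (use t in \<open>auto intro: filt_monom\<close>)
      then show "monom (coeff f s) s \<in> max_ideal g S" by (simp add: mult_monom t)
    qed (use additive_subgroup.zero_closed[OF I.additive_subgroup_axioms]
        additive_subgroup.a_closed[OF I.additive_subgroup_axioms] in auto)
  qed
qed

text \<open>A monomial of order at least j + 1 loses at most one unit of order when a suitable
  generator is split off, so it lies in the product of the maximal ideal and its j-th power. The
  other inclusion is superadditivity of the order.\<close>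

lemma ideal_power_eq: "ideal_power (ring_on (filt 0)) (filt (Suc 0)) j
    = (filt j :: 'k::field poly set)"
proof (induction j)
  case (Suc j)
  let ?P = "ideal_prod (ring_on (filt 0)) (filt (Suc 0)) (filt j) :: 'k poly set"
  have "f \<in> filt (Suc j)" if "f \<in> ?P" for f
    using that by induction (auto intro: filt_add filt_mult[of _ "Suc 0", simplified])
  moreover have "f \<in> ?P" if f: "f \<in> filt (Suc j)" for f
  proof (rule poly_monom_induct)
    show "0 \<in> ?P" using ideal_prod.prod[of 0 "filt (Suc 0)" 0 "filt j" "ring_on (filt 0)"] by simp
    show "p + q \<in> ?P" if "p \<in> ?P" "q \<in> ?P" for p q using ideal_prod.sum[OF that] by simp
    fix s assume nz: "coeff f s \<noteq> 0"
    have s: "s \<in> S" "Suc j \<le> order s" using filt_monomD[OF f nz] by auto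
    then have "s \<noteq> 0" by (auto intro: gr0I)
    then obtain i t where t: "t \<in> S" "s = t + g i" "order s \<le> Suc (order t)" using order_split s
        by blast
    have "monom 1 (g i) \<otimes>\<^bsub>ring_on (filt 0)\<^esub> monom (coeff f s) t \<in> ?P"
      by (rule ideal_prod.prod) (use t s order_generator in \<open>auto intro!: filt_monom\<close>)
    then show "monom (coeff f s) s \<in> ?P" by (simp add: mult_monom t add.commute)
  qed
  ultimately have "?P = filt (Suc j)" by blast
  then show ?case using Suc by simp
qed simp

section \<open>The Rees algebra and coordinates on the tangent cone\<close>

definition rees :: "'k::field poly poly set" where
  "rees = {F. \<forall>j. coeff F j \<in> filt j}"

definition rees0 :: "'k::field poly poly set" where
  "rees0 = {F. \<forall>j. coeff F j \<in> filt (Suc j)}"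

lemma rees_algebra_eq: "rees_algebra (semigroup_carrier S) (max_ideal g S)
    = (ring_on rees :: 'k::field poly poly ring)"
  by (simp add: rees_algebra_def rees_def max_ideal_eq ideal_power_eq del: ideal_power.simps flip:
      filt_0)

lemma rees_ideal_eq: "rees_ideal (semigroup_carrier S) (max_ideal g S)
    = (rees0 :: 'k::field poly poly set)"
  by (simp add: rees_ideal_def rees0_def max_ideal_eq ideal_power_eq del: ideal_power.simps flip:
      filt_0)

lemma tangent_cone_eq: "tangent_cone g S = (ring_on rees Quot rees0 :: 'k::field poly poly set
    ring)"
  by (simp add: tangent_cone_def assoc_graded_def rees_algebra_eq rees_ideal_eq)

lemma rees_add: "F \<in> rees \<Longrightarrow> G \<in> rees \<Longrightarrow> F + G \<in> rees"
  and rees_uminus: "F \<in> rees \<Longrightarrow> - F \<in> rees"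
  and rees_zero [simp]: "0 \<in> rees" and rees0_zero [simp]: "0 \<in> rees0"
  and rees0_add: "F \<in> rees0 \<Longrightarrow> G \<in> rees0 \<Longrightarrow> F + G \<in> rees0"
  and rees0_uminus: "F \<in> rees0 \<Longrightarrow> - F \<in> rees0"
  by (auto simp: rees_def rees0_def intro: filt_add filt_uminus)

lemma rees_one [simp]: "1 \<in> rees"
  by (auto simp: rees_def coeff_1 intro: filt_one)

lemma rees_mult: "F \<in> rees \<Longrightarrow> G \<in> rees \<Longrightarrow> F * G \<in> rees"
  unfolding rees_def coeff_mult mem_Collect_eq
proof (intro allI filt_sum)
  fix j i :: nat assume "\<forall>j. coeff F j \<in> filt j" "\<forall>j. coeff G j \<in> filt j" "i \<in> {..j}"
  then show "coeff F i * coeff G (j - i) \<in> filt j" using filt_mult[of "coeff F i" i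
      "coeff G (j - i)" "j - i"] by simp
qed

lemma rees0_mult: "F \<in> rees \<Longrightarrow> G \<in> rees0 \<Longrightarrow> F * G \<in> rees0"
  unfolding rees_def rees0_def coeff_mult mem_Collect_eq
proof (intro allI filt_sum)
  fix j i :: nat assume "\<forall>j. coeff F j \<in> filt j" "\<forall>j. coeff G j \<in> filt (Suc j)" "i \<in> {..j}"
  then show "coeff F i * coeff G (j - i) \<in> filt (Suc j)"
    using filt_mult[of "coeff F i" i "coeff G (j - i)" "Suc (j - i)"] by simp
qed

lemma rees0_subset: "rees0 \<subseteq> rees"
proof
  fix F :: "'a poly poly" assume "F \<in> rees0"
  then have "coeff F j \<in> filt j" for j using filt_mono[of j "Suc j"] by (auto simp: rees0_def)
  then show "F \<in> rees" by (simp add: rees_def)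
qed

lemma rees_cring: "cring (ring_on rees :: 'k::field poly poly ring)"
  by (rule ring_on_cring) (auto intro: rees_add rees_uminus rees_mult)

lemma rees0_ideal: "ideal rees0 (ring_on rees :: 'k::field poly poly ring)"
  by (rule ring_on_ideal[OF rees_cring])
    (use rees0_subset in \<open>auto intro: rees0_add rees0_uminus rees0_mult\<close>)

lemma tangent_cone_cring: "cring (tangent_cone g S :: 'k::field poly poly set ring)"
  unfolding tangent_cone_eq by (rule ideal.quotient_is_cring[OF rees0_ideal rees_cring])

definition cls :: "'k::field poly poly \<Rightarrow> 'k poly poly set" where
  "cls F = rees0 +>\<^bsub>ring_on rees\<^esub> F"

lemma tangent_cone_carrier: "C \<in> carrier (tangent_cone g S) \<longleftrightarrow> (\<exists>F\<in>rees. C = cls F)"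
  using ideal.quot_carrier[OF rees0_ideal] by (auto simp: tangent_cone_eq cls_def)

lemma cls_carrier [simp]: "F \<in> rees \<Longrightarrow> cls F \<in> carrier (tangent_cone g S)"
  by (auto simp: tangent_cone_carrier)

lemma cls_hom: "cls \<in> Ring.ring_hom (ring_on rees) (tangent_cone g S :: 'k::field poly poly set
    ring)"
  using ideal.rcos_ring_hom[OF rees0_ideal] by (simp add: tangent_cone_eq cls_def[abs_def])

lemma cls_mult: "F \<in> rees \<Longrightarrow> G \<in> rees \<Longrightarrow> cls F \<otimes>\<^bsub>tangent_cone g S\<^esub> cls G = cls (F * G)"
  using ring_hom_mult[OF cls_hom, of F G] by simp

lemma cls_add: "F \<in> rees \<Longrightarrow> G \<in> rees \<Longrightarrow> cls F \<oplus>\<^bsub>tangent_cone g S\<^esub> cls G = cls (F + G)"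
  using ring_hom_add[OF cls_hom, of F G] by simp

lemma cls_eq_iff:
  assumes F: "F \<in> rees" and G: "G \<in> rees"
  shows "cls F = cls G \<longleftrightarrow> F - G \<in> rees0"
proof -
  have "F \<ominus>\<^bsub>ring_on rees\<^esub> G = F - G"
    using ring_on_a_inv[OF rees_cring G rees_uminus[OF G]] by (simp add: a_minus_def)
  then show ?thesis using ideal.coset_eq_iff[OF rees0_ideal, of F G] F G by (simp add: cls_def)
qed

lemma cls_eq_zero_iff: "F \<in> rees \<Longrightarrow> cls F = \<zero>\<^bsub>tangent_cone g S\<^esub> \<longleftrightarrow> F \<in> rees0"
  using ideal.coset_eq_zero_iff[OF rees0_ideal, of F] by (simp add: cls_def tangent_cone_eq)

text \<open>The coordinate of the class of F at the basis element of G(S) given by t^s in degree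
  order s.\<close>

definition ini :: "'k::field poly poly \<Rightarrow> nat \<Rightarrow> 'k" where
  "ini F s = coeff (coeff F (order s)) s"

lemma ini_add: "ini (F + G) s = ini F s + ini G s" and ini_diff: "ini (F - G) s = ini F s - ini G s"
  by (simp_all add: ini_def)

lemma rees_coeffD: "F \<in> rees \<Longrightarrow> coeff (coeff F j) s \<noteq> 0 \<Longrightarrow> s \<in> S \<and> j \<le> order s"
  by (auto simp: rees_def filt_def)

text \<open>In degree j only exponents of order at least j occur, and those of larger order belong
  to \<open>rees0\<close> anyway; what remains are exactly the coordinates.\<close>

lemma rees0_iff:
  assumes F: "F \<in> rees"
  shows "F \<in> rees0 \<longleftrightarrow> (\<forall>s\<in>S. ini F s = 0)"
proof
  assume "F \<in> rees0"
  then show "\<forall>s\<in>S. ini F s = 0" by (auto simp: rees0_def filt_def ini_def) (meson Suc_n_not_le_n)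
next
  assume z: "\<forall>s\<in>S. ini F s = 0"
  have "s \<in> S \<and> Suc j \<le> order s" if nz: "coeff (coeff F j) s \<noteq> 0" for j s
  proof -
    have s: "s \<in> S" "j \<le> order s" using rees_coeffD[OF F nz] by auto
    moreover have "j \<noteq> order s" using z s nz by (auto simp: ini_def)
    ultimately show ?thesis by simp
  qed
  then show "F \<in> rees0" by (simp add: rees0_def filt_def)
qed

text \<open>The value of \<open>order\<close> is unspecified outside S, but there the coefficients
  vanish in every degree.\<close>

lemma ini_outside: "F \<in> rees \<Longrightarrow> s \<notin> S \<Longrightarrow> ini F s = 0"
  using rees_coeffD[of F "order s" s] by (auto simp: ini_def)

lemma finite_ini: "finite {s. ini F s \<noteq> 0}"
proof (rule finite_subset)
  show "{s. ini F s \<noteq> 0} \<subseteq> (\<Union>j\<le>degree F. {..degree (coeff F j)})"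
  proof
    fix s assume "s \<in> {s. ini F s \<noteq> 0}"
    then have nz: "coeff (coeff F (order s)) s \<noteq> 0" by (simp add: ini_def)
    then have "order s \<le> degree F" using coeff_eq_0[of F "order s"] by (intro leI notI) auto
    moreover have "s \<le> degree (coeff F (order s))" using nz by (rule le_degree)
    ultimately show "s \<in> (\<Union>j\<le>degree F. {..degree (coeff F j)})" by blast
  qed
qed auto

text \<open>A section of the coordinate map: the standard representative, in the Rees algebra, of
  the class with coordinates f on A and 0 elsewhere.\<close>

definition sect :: "nat set \<Rightarrow> (nat \<Rightarrow> 'k::field) \<Rightarrow> 'k poly poly" where
  "sect A f = (\<Sum>s\<in>A. monom (monom (f s) s) (order s))"

lemma monom_rees: "s \<in> S \<Longrightarrow> j \<le> order s \<Longrightarrow> monom (monom c s) j \<in> rees"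
  by (auto simp: rees_def filt_monom)

lemma rees_sum: "(\<And>i. i \<in> A \<Longrightarrow> f i \<in> rees) \<Longrightarrow> sum f A \<in> rees"
  by (induction A rule: infinite_finite_induct) (auto intro: rees_add)

lemma sect_rees: "A \<subseteq> S \<Longrightarrow> sect A f \<in> rees"
  unfolding sect_def by (rule rees_sum) (auto intro: monom_rees)

lemma ini_sect:
  assumes "finite A"
  shows "ini (sect A f) s = (if s \<in> A then f s else 0)"
proof -
  have "ini (sect A f) s = (\<Sum>t\<in>A. if t = s then f t else 0)"
    unfolding ini_def sect_def coeff_sum by (intro sum.cong) auto
  then show ?thesis using assms by simp
qed

section \<open>The presentations of k[S] and G(S) by P\<close>

definition subst1 :: "('n, 'k::field) pring \<Rightarrow> 'k poly" where
  "subst1 = psubst (\<lambda>c. [:c:]) (\<lambda>i. monom 1 (g i))"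

definition subst2 :: "('n, 'k::field) pring \<Rightarrow> 'k poly poly" where
  "subst2 = psubst (\<lambda>c. [:[:c:]:]) (\<lambda>i. monom (monom 1 (g i)) 1)"

lemma prod_monom: "(\<Prod>i\<in>A. monom (c i) (k i)) = monom (prod c A) (sum k A)" for c ::
    "_ \<Rightarrow> 'a::comm_ring_1"
  by (induction A rule: infinite_finite_induct) (simp_all add: mult_monom monom_0 one_pCons)

lemma subst1_single:
  "subst1 (Poly_Mapping.single m a) = monom a (weight (Poly_Mapping.lookup m))"
  unfolding subst1_def
  by (subst psubst_single)
    (simp_all add: monom_power prod_monom weight_def mult.commute smult_monom)

lemma subst1_add: "subst1 (p + q) = subst1 p + subst1 q"
  and subst1_mult: "subst1 (p * q) = subst1 p * subst1 q"
  and subst1_one: "subst1 1 = 1"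
  unfolding subst1_def by (rule psubst_add psubst_mult psubst_one; simp add: one_pCons)+

lemma subst2_single:
  "subst2 (Poly_Mapping.single m a) =
     monom (monom a (weight (Poly_Mapping.lookup m))) (sum (Poly_Mapping.lookup m) UNIV)"
  unfolding subst2_def
  by (subst psubst_single)
    (simp_all add: monom_power prod_monom weight_def mult.commute smult_monom one_pCons)

lemma subst2_add: "subst2 (p + q) = subst2 p + subst2 q"
  and subst2_mult: "subst2 (p * q) = subst2 p * subst2 q"
  and subst2_one: "subst2 1 = 1"
  unfolding subst2_def by (rule psubst_add psubst_mult psubst_one; simp add: one_pCons)+

lemma subst1_filt: "subst1 p \<in> filt 0"
  by (induction p rule: pring_induct) (simp_all add: subst1_single subst1_add filt_add filt_monom)

lemma subst2_rees: "subst2 p \<in> rees"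
  by (induction p rule: pring_induct)
    (simp_all add: subst2_single subst2_add rees_add monom_rees order_ge)

lemma subst1_hom: "subst1 \<in> Ring.ring_hom class_ring (ring_on (filt 0) :: 'k::field poly ring)"
  by (rule ring_hom_memI) (simp_all add: class_ring_simps subst1_filt subst1_add subst1_mult
      subst1_one)

lemma subst2_hom: "(\<lambda>p. cls (subst2 p)) \<in> Ring.ring_hom class_ring (tangent_cone g S :: 'k::field
    poly poly set ring)"
proof (rule ring_hom_memI)
  show "cls (subst2 \<one>\<^bsub>class_ring\<^esub>) = \<one>\<^bsub>tangent_cone g S\<^esub>"
    using ring_hom_one[OF cls_hom] by (simp add: class_ring_simps subst2_one)
qed (simp_all add: class_ring_simps subst2_rees subst2_add subst2_mult cls_add cls_mult)

lemma ex_exponent: "s \<in> S \<Longrightarrow> \<exists>m. weight (Poly_Mapping.lookup m) = s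
    \<and> sum (Poly_Mapping.lookup m) UNIV = order s"
proof -
  assume "s \<in> S"
  then obtain a where a: "weight a = s" "sum a UNIV = order s" using order_attained by blast
  have "Poly_Mapping.lookup (Poly_Mapping.Abs_poly_mapping a) = a" by
      (rule lookup_Abs_poly_mapping) simp
  with a show ?thesis by metis
qed

lemma subst1_surj: "range (subst1 :: ('n, 'k::field) pring \<Rightarrow> _) = filt 0"
proof
  show "filt 0 \<subseteq> range (subst1 :: ('n, 'k) pring \<Rightarrow> _)"
  proof
    fix f :: "'k poly" assume f: "f \<in> filt 0"
    show "f \<in> range subst1"
    proof (rule poly_monom_induct)
      have "subst1 0 = (0 :: 'k poly)" using subst1_single[of 0 0] by simp
      then show "0 \<in> range (subst1 :: ('n, 'k) pring \<Rightarrow> _)" by (metis rangeI)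
      show "p + q \<in> range subst1" if "p \<in> range subst1" "q \<in> range subst1" for p q :: "'k poly"
      proof -
        obtain p' q' where "p = subst1 p'" "q = subst1 q'" using \<open>p \<in> _\<close> \<open>q \<in> _\<close> by blast
        then have "p + q = subst1 (p' + q')" by (simp add: subst1_add)
        then show ?thesis by (rule range_eqI)
      qed
      fix s assume "coeff f s \<noteq> 0"
      then have "s \<in> S" using filt_monomD[OF f] by blast
      then obtain m where "weight (Poly_Mapping.lookup m) = s" using ex_exponent by blast
      then show "monom (coeff f s) s \<in> range subst1" using subst1_single by (metis rangeI)
    qed
  qed
qed (auto simp: subst1_filt)

text \<open>A longest expression of s gives a monomial of P whose image is t^s in degree exactly
  order s.\<close>

lemma sect_subst2:
  assumes "finite A" "A \<subseteq> S"
  shows "\<exists>p. sect A f = subst2 p"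
  using assms
proof (induction A rule: finite_induct)
  case empty
  have "subst2 0 = (0 :: 'a poly poly)" using subst2_single[of 0 0] by simp
  then show ?case by (intro exI[of _ 0]) (simp add: sect_def)
next
  case (insert s A)
  then obtain p where p: "sect A f = subst2 p" by blast
  obtain m where m: "weight (Poly_Mapping.lookup m) = s"
      "sum (Poly_Mapping.lookup m) UNIV = order s"
    using ex_exponent insert.prems by blast
  have "sect (insert s A) f = subst2 (Poly_Mapping.single m (f s) + p)"
    using insert.hyps p m by (simp add: sect_def subst2_add subst2_single)
  then show ?case by blast
qed

text \<open>Modulo \<open>rees0\<close> an element of the Rees algebra equals the section of its
  coordinates, which are finitely many and hence come from a polynomial.\<close>

lemma subst2_surj: "range (\<lambda>p. cls (subst2 p) :: 'k::field poly poly set)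
    = carrier (tangent_cone g S)"
proof
  show "carrier (tangent_cone g S) \<subseteq> range (\<lambda>p. cls (subst2 p) :: 'k poly poly set)"
  proof
    fix C :: "'k poly poly set" assume "C \<in> carrier (tangent_cone g S)"
    then obtain F where F: "F \<in> rees" "C = cls F" by (auto simp: tangent_cone_carrier)
    define A where "A = {s. ini F s \<noteq> 0}"
    have A: "finite A" "A \<subseteq> S" using finite_ini[of F] ini_outside[OF F(1)] by (auto simp: A_def)
    obtain p where p: "sect A (ini F) = subst2 p" using sect_subst2[OF A] by blast
    have "F - subst2 p \<in> rees" using rees_add[OF F(1) rees_uminus[OF subst2_rees[of p]]] by simp
    moreover have "ini (F - subst2 p) s = 0" for s
      using ini_sect[OF A(1), of "ini F" s] by (simp add: ini_diff flip: p) (simp add: A_def)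
    ultimately have "F - subst2 p \<in> rees0" using rees0_iff by blast
    then have "C = cls (subst2 p)" using F cls_eq_iff[OF F(1) subst2_rees] by blast
    then show "C \<in> range (\<lambda>p. cls (subst2 p))" by blast
  qed
qed (auto simp: subst2_rees)

lemma semigroup_module_eq:
  "(semigroup_module g S :: (('n, 'k::field) pring, 'k poly) module)
      = module_along subst1 (ring_on (filt 0))"
  by (simp add: semigroup_module_def semigroup_ring_def filt_0 subst1_def)

lemma tangent_cone_module_eq:
  "(tangent_cone_module g S :: (('n, 'k::field) pring, 'k poly poly set) module) =
     module_along (\<lambda>p. cls (subst2 p)) (tangent_cone g S)"
  by (simp add: tangent_cone_module_def rees_algebra_eq rees_ideal_eq cls_def subst2_def)

section \<open>The Apery set as a common basis modulo x_1\<close>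

lemma finite_AP: "finite AP"
proof (rule finite_subset)
  show "AP \<subseteq> {..<n1} \<union> (\<lambda>s. s + n1) ` (- S)"
  proof
    fix s assume s: "s \<in> AP"
    show "s \<in> {..<n1} \<union> (\<lambda>s. s + n1) ` (- S)"
    proof (cases "s < n1")
      case False
      then have "s = (s - n1) + n1" by simp
      moreover from this have "s - n1 \<notin> S" using AP_D(2)[OF s] by metis
      ultimately show ?thesis by blast
    qed simp
  qed
  show "finite ({..<n1} \<union> (\<lambda>s. s + n1) ` (- S))"
    using numerical by (simp add: numerical_semigroup_def)
qed

text \<open>Both \<open>k[S] / t\<^bsup>n\<^sub>1\<^esup>\<close> and \<open>G(S) / x\<^sub>1 G(S)\<close> are identified with the span of the \<open>t\<^bsup>s\<^esup>\<close>, \<open>s \<in> AP\<close>.\<close>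

definition ap_part :: "(nat \<Rightarrow> 'k::field) \<Rightarrow> 'k poly" where
  "ap_part f = (\<Sum>s\<in>AP. monom (f s) s)"

lemma coeff_ap_part: "coeff (ap_part f) s = (if s \<in> AP then f s else 0)"
proof -
  have "coeff (ap_part f) s = (\<Sum>t\<in>AP. if t = s then f t else 0)"
    unfolding ap_part_def coeff_sum by (intro sum.cong) auto
  then show ?thesis using finite_AP by simp
qed

lemma ap_part_eq_iff: "ap_part f = ap_part h \<longleftrightarrow> (\<forall>s\<in>AP. f s = h s)"
  by (auto simp: poly_eq_iff coeff_ap_part)

lemma ap_part_zero_iff: "ap_part f = 0 \<longleftrightarrow> (\<forall>s\<in>AP. f s = 0)"
  by (auto simp: poly_eq_iff coeff_ap_part)

lemma ap_part_add: "ap_part (\<lambda>s. f s + h s) = ap_part f + ap_part h"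
  by (auto simp: poly_eq_iff coeff_ap_part)

text \<open>The action of P on k[S] modulo t^n_1, carried over to the span of the Apery monomials.
  It is built from k[S] only; that the tangent cone modulo x_1 carries the same action is where
  homogeneity is needed.\<close>

definition ap_act :: "('n, 'k::field) pring \<Rightarrow> 'k poly \<Rightarrow> 'k poly" where
  "ap_act p v = ap_part (coeff (subst1 p * v))"

lemma ap_act_add: "ap_act (p + q) v = ap_act p v + ap_act q v"
  by (simp add: poly_eq_iff ap_act_def subst1_add distrib_right coeff_ap_part)

lemma ap_act_single:
  "coeff (ap_act (Poly_Mapping.single m a) v) s =
     (if s \<in> AP \<and> weight (Poly_Mapping.lookup m) \<le> s then a * coeff v (s - weight
         (Poly_Mapping.lookup m)) else 0)"
  by (simp add: ap_act_def coeff_ap_part subst1_single coeff_monom_mult not_less)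

definition var1 :: "('n, 'k::field) pring" where
  "var1 = Poly_Mapping.single (Poly_Mapping.single (SOME i. g i = n1) 1) 1"

lemma weight_var1: "weight (Poly_Mapping.lookup (Poly_Mapping.single (SOME i. g i = n1) (1::nat)))
    = n1"
proof -
  have "g (SOME i. g i = n1) = n1" using n1_generator by (rule someI_ex)
  then show ?thesis by (simp add: weight_def lookup_single when_def if_distrib[of
      "\<lambda>x. x * _"] cong: if_cong)
qed

lemma subst1_var1: "subst1 var1 = monom 1 n1"
  unfolding var1_def subst1_single weight_var1 ..

lemma subst2_var1: "subst2 var1 = monom (monom 1 n1) 1"
  unfolding var1_def subst2_single weight_var1
  by (simp add: lookup_single when_def)

lemma var1_regular: "var1 * p = 0 \<Longrightarrow> p = 0"
proof (rule poly_mapping_eqI)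
  fix m assume z: "var1 * p = 0"
  show "Poly_Mapping.lookup p m = Poly_Mapping.lookup 0 m"
    using lookup_single_times_plus[of "Poly_Mapping.single (SOME i. g i = n1) 1" 1 p m] z
    by (simp add: var1_def)
qed

lemma lookup_var1_zero: "Poly_Mapping.lookup var1 0 = 0"
proof -
  have "Poly_Mapping.single (SOME i. g i = n1) (1::nat) \<noteq> 0"
    by (metis lookup_single_eq lookup_zero one_neq_zero)
  then show ?thesis by (simp add: var1_def lookup_single when_def)
qed

text \<open>Elements of S outside the Apery set are n_1 plus an element of S, so their monomials
  span the multiples of t^n_1, and the Apery coefficients describe the quotient.\<close>

lemma specialization_semigroup_module:
  "specialization var1 ap_act (semigroup_module g S :: (('n, 'k::field) pring, 'k poly) module) (\<lambda>f.
      ap_part (coeff f))"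
  unfolding specialization_def semigroup_module_eq module_along_simps ring_on_simps subst1_var1
proof (intro conjI ballI allI impI)
  show "ap_part (coeff (f + h)) = ap_part (coeff f) + ap_part (coeff h)" for f h :: "'k poly"
    by (simp add: poly_eq_iff coeff_ap_part)
  show "ap_part (coeff (subst1 p * f)) = ap_act p (ap_part (coeff f))" if f: "f \<in> filt 0" for p
      and f :: "'k poly"
  proof (induction p rule: pring_induct)
    case (single m a)
    let ?w = "weight (Poly_Mapping.lookup m)"
    \<comment> \<open>If s - w were in S, it would be a summand of the Apery element s and hence an
      Apery element; so it lies outside S, where f has no coefficients.\<close>
    have "coeff f (s - ?w) = 0" if "s \<in> AP" "?w \<le> s" "s - ?w \<notin> AP" for s
      using AP_summand[of "s - ?w" ?w] filt_monomD[OF f, of "s - ?w"] that by auto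
    then show ?case
      by (auto simp: poly_eq_iff ap_act_single coeff_ap_part subst1_single coeff_monom_mult)
  qed (simp add: subst1_add distrib_right ap_act_add ap_part_add)
  show "ap_part (coeff f) = 0 \<longleftrightarrow> (\<exists>h\<in>filt 0. f = monom 1 n1 * h)" if f: "f \<in> filt 0" for f ::
      "'k poly"
  proof
    assume z: "ap_part (coeff f) = 0"
    show "\<exists>h\<in>filt 0. f = monom 1 n1 * h"
    proof -
      have "f \<in> {monom 1 n1 * h | h. h \<in> filt 0}"
      proof (rule poly_monom_induct)
        show "0 \<in> {monom 1 n1 * h | h. h \<in> filt 0}" using filt_zero by force
        show "p + q \<in> {monom 1 n1 * h | h. h \<in> filt 0}"
          if pq: "p \<in> {monom 1 n1 * h | h. h \<in> filt 0}" "q \<in> {monom 1 n1 * h | h. h \<in> filt 0}"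
              for p q :: "'k poly"
        proof -
          obtain h k where "p = monom 1 n1 * h" "h \<in> filt 0" "q = monom 1 n1 * k" "k \<in> filt 0"
              using pq by blast
          then have "p + q = monom 1 n1 * (h + k)" "h + k \<in> filt 0" by
              (simp_all add: distrib_left filt_add)
          then show ?thesis by blast
        qed
        fix s assume nz: "coeff f s \<noteq> 0"
        have "s \<in> S" "s \<notin> AP" using filt_monomD[OF f nz] z nz by (auto simp: ap_part_zero_iff)
        then obtain t where t: "t \<in> S" "s = t + n1" by (rule AP_cases)
        then have "monom (coeff f s) s = monom 1 n1 * monom (coeff f s) t" by
            (simp add: mult_monom add.commute)
        then show "monom (coeff f s) s \<in> {monom 1 n1 * h | h. h \<in> filt 0}" using t(1) filt_monom
            by blast
      qed
      then show ?thesis by blast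
    qed
  next
    assume "\<exists>h\<in>filt 0. f = monom 1 n1 * h"
    then obtain h where h: "h \<in> filt 0" "f = monom 1 n1 * h" by blast
    have "coeff h (s - n1) = 0" if "s \<in> AP" "n1 \<le> s" for s
      using AP_D(2)[OF that(1), of "s - n1"] filt_monomD[OF h(1), of "s - n1"] that(2) by auto
    then show "ap_part (coeff f) = 0" by (auto simp: ap_part_zero_iff h(2) coeff_monom_mult)
  qed
  show "f = 0" if "monom 1 n1 * f = 0" for f :: "'k poly"
    using that by simp
qed

lemma image_semigroup_module:
  "(\<lambda>f. ap_part (coeff f)) ` carrier (semigroup_module g S :: (('n, 'k::field) pring, 'k poly)
      module) = range ap_part"
proof -
  have "ap_part f = ap_part (coeff (ap_part f))" "ap_part f \<in> filt 0" for f :: "nat \<Rightarrow> 'k"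
    by (auto simp: ap_part_eq_iff coeff_ap_part filt_def AP_D(1) split: if_splits)
  then show ?thesis by (auto simp: semigroup_module_eq)
qed

definition ap_ini :: "'k::field poly poly set \<Rightarrow> 'k poly" where
  "ap_ini C = ap_part (ini (SOME F. F \<in> rees \<and> cls F = C))"

lemma ap_ini_cls:
  assumes F: "F \<in> rees"
  shows "ap_ini (cls F) = ap_part (ini F)"
proof -
  define G where "G = (SOME G. G \<in> rees \<and> cls G = cls F)"
  have G: "G \<in> rees" "cls G = cls F"
    using someI[of "\<lambda>G. G \<in> rees \<and> cls G = cls F" F] F by (auto simp: G_def)
  then have d: "G - F \<in> rees0" using cls_eq_iff F by blast
  have "G - F \<in> rees" using d rees0_subset by blast
  then have "\<forall>s\<in>S. ini G s = ini F s" using rees0_iff[of "G - F"] d by (simp add: ini_diff)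
  then have "ap_part (ini G) = ap_part (ini F)" by (auto simp: ap_part_eq_iff AP_D(1))
  then show ?thesis by (simp add: ap_ini_def G_def)
qed

lemma ini_monom_mult:
  "ini (monom (monom a w) l * F) s =
     (if l \<le> order s \<and> w \<le> s then a * coeff (coeff F (order s - l)) (s - w) else 0)"
  by (simp add: ini_def coeff_monom_mult)

text \<open>By \<open>reg\<close>, multiplication by x_1 carries the basis element of G(S) at s to
  the one at s + n_1. Hence it is injective, and its image is spanned by the basis elements outside
  the Apery set.\<close>

lemma specialization_tangent_cone_module:
  assumes hom: "homogeneous_semigroup g S" and reg: "\<And>s. s \<in> S \<Longrightarrow> order (s + n1) = Suc (order s)"
  shows "specialization var1 ap_act
    (tangent_cone_module g S :: (('n, 'k::field) pring, 'k poly poly set) module) ap_ini"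
proof -
  let ?x = "monom (monom 1 n1) 1 :: 'k poly poly"
  have x: "?x \<in> rees" using subst2_rees[of var1] by (simp add: subst2_var1)
  have ini_x: "ini (?x * F) (s + n1) = ini F s" if "s \<in> S" for F s
    using reg[OF that] by (simp add: ini_monom_mult) (simp add: ini_def)
  have ini_x_AP: "ini (?x * F) s = 0" if "s \<in> AP" and F: "F \<in> rees" for F s
  proof (rule ccontr)
    assume "ini (?x * F) s \<noteq> 0"
    then have "n1 \<le> s" "coeff (coeff F (order s - 1)) (s - n1) \<noteq> 0"
      by (auto simp: ini_monom_mult split: if_splits)
    then show False using AP_D(2)[OF that(1), of "s - n1"] rees_coeffD[OF F, of "order s - 1"
        "s - n1"] by simp
  qed
  have add: "ap_ini (C \<oplus>\<^bsub>tangent_cone g S\<^esub> D) = ap_ini C + ap_ini D"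
    if CD: "C \<in> carrier (tangent_cone g S)" "D \<in> carrier (tangent_cone g S)" for C D ::
        "'k poly poly set"
  proof -
    obtain F G where FG: "F \<in> rees" "C = cls F" "G \<in> rees" "D = cls G"
      using CD by (auto simp: tangent_cone_carrier)
    then show ?thesis
      by (simp add: cls_add ap_ini_cls rees_add ini_add[abs_def] ap_part_add)
  qed
  have act: "ap_ini (cls (subst2 p) \<otimes>\<^bsub>tangent_cone g S\<^esub> C) = ap_act p (ap_ini C)"
    if C: "C \<in> carrier (tangent_cone g S)" for p and C :: "'k poly poly set"
  proof -
    obtain F where F: "F \<in> rees" "C = cls F" using C by (auto simp: tangent_cone_carrier)
    have "ap_part (ini (subst2 p * F)) = ap_act p (ap_part (ini F))"
    proof (induction p rule: pring_induct)
      case (single m a)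
      let ?m = "Poly_Mapping.lookup m"
      have "ini (subst2 (Poly_Mapping.single m a) * F) s =
        (if weight ?m \<le> s then a * coeff (ap_part (ini F))
            (s - weight ?m) else 0)" if s: "s \<in> AP" for s
      proof (cases "weight ?m \<le> s \<and> s - weight ?m \<in> S")
        case True
        then have eq: "s = (s - weight ?m) + weight ?m" by simp
        have AP': "s - weight ?m \<in> AP" using AP_summand[of "s - weight ?m" "weight ?m"] True s
            by simp
        \<comment> \<open>The decisive use of homogeneity: the degree of the monomial is exactly the
          gain in order, so the coordinate of the product at s is the one of F at s - weight m. With
          a larger gain the product would be 0 in the tangent cone.\<close>
        have "order s = order (s - weight ?m) + sum ?m UNIV"
          using homogeneous_order[OF hom, of "s - weight ?m" ?m] True s by simp
        then show ?thesis using True AP'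
          by (simp add: subst2_single ini_monom_mult coeff_ap_part) (simp add: ini_def)
      next
        case False
        have z: "coeff (coeff F j) (s - weight ?m) = 0" if "weight ?m \<le> s" for j
          using False that rees_coeffD[OF F(1), of j "s - weight ?m"] by blast
        have "s - weight ?m \<notin> AP" if "weight ?m \<le> s" using False that AP_D(1) by blast
        then show ?thesis using z by (simp add: subst2_single ini_monom_mult coeff_ap_part)
      qed
      then show ?case by (auto simp: poly_eq_iff coeff_ap_part ap_act_single)
    next
      case (add p q)
      then show ?case
        by (simp add: subst2_add distrib_right ini_add[abs_def] ap_part_add ap_act_add)
    qed
    then show ?thesis using F by (simp add: cls_mult subst2_rees rees_mult ap_ini_cls)
  qed
  have ker: "ap_ini C = 0 \<longleftrightarrow> (\<exists>D\<in>carrier (tangent_cone g S). C = cls ?x \<otimes>\<^bsub>tangent_cone g S\<^esub> D)"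
    if C: "C \<in> carrier (tangent_cone g S)" for C :: "'k poly poly set"
  proof
    obtain F where F: "F \<in> rees" "C = cls F" using C by (auto simp: tangent_cone_carrier)
    assume "ap_ini C = 0"
    then have z: "\<And>s. s \<in> AP \<Longrightarrow> ini F s = 0" using F by (simp add: ap_ini_cls ap_part_zero_iff)
    \<comment> \<open>F is divided by x_1 coordinatewise: the quotient G gets at s the coordinate of
      F at s + n_1.\<close>
    define A where "A = {s \<in> S. ini F (s + n1) \<noteq> 0}"
    have "finite ((\<lambda>s. s + n1) ` A)" by (rule finite_subset[OF _ finite_ini[of F]])
        (auto simp: A_def)
    then have A: "finite A" "A \<subseteq> S" by (auto simp: A_def dest: finite_imageD)
    define G where "G = sect A (\<lambda>s. ini F (s + n1))"
    have G: "G \<in> rees" using sect_rees[OF A(2)] by (simp add: G_def)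
    have "ini (F - ?x * G) s = 0" if "s \<in> S" for s
    proof (cases "s \<in> AP")
      case True
      then show ?thesis using z ini_x_AP[OF True G] by (simp add: ini_diff)
    next
      case False
      from that False obtain t where t: "t \<in> S" "s = t + n1" by (rule AP_cases)
      have "ini G t = ini F (t + n1)"
        using ini_sect[OF A(1), of "\<lambda>s. ini F (s + n1)" t] t(1) unfolding G_def A_def by auto
      then show ?thesis using ini_x[OF t(1), of G] by (simp add: ini_diff t(2))
    qed
    moreover have "F - ?x * G \<in> rees" using rees_add[OF F(1) rees_uminus[OF rees_mult[OF x G]]]
        by simp
    ultimately have "cls F = cls (?x * G)" using cls_eq_iff[OF F(1) rees_mult[OF x G]] rees0_iff
        by blast
    then show "\<exists>D\<in>carrier (tangent_cone g S). C = cls ?x \<otimes>\<^bsub>tangent_cone g S\<^esub> D"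
      using F G x by (intro bexI[of _ "cls G"]) (simp_all add: cls_mult)
  next
    assume "\<exists>D\<in>carrier (tangent_cone g S). C = cls ?x \<otimes>\<^bsub>tangent_cone g S\<^esub> D"
    then obtain G where G: "G \<in> rees" "C = cls ?x \<otimes>\<^bsub>tangent_cone g S\<^esub> cls G"
      by (auto simp: tangent_cone_carrier)
    then show "ap_ini C = 0"
      using x ini_x_AP by (simp add: cls_mult ap_ini_cls rees_mult ap_part_zero_iff)
  qed
  have inj: "C = \<zero>\<^bsub>tangent_cone g S\<^esub>"
    if C: "C \<in> carrier (tangent_cone g S)" and z:
        "cls ?x \<otimes>\<^bsub>tangent_cone g S\<^esub> C = \<zero>\<^bsub>tangent_cone g S\<^esub>"
    for C :: "'k poly poly set"
  proof -
    obtain F where F: "F \<in> rees" "C = cls F" using C by (auto simp: tangent_cone_carrier)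
    have "?x * F \<in> rees0" using z F x by (simp add: cls_mult cls_eq_zero_iff rees_mult)
    then have "ini (?x * F) s = 0" if "s \<in> S" for s using rees0_iff[OF rees_mult[OF x F(1)]] that
        by blast
    then have "ini F s = 0" if "s \<in> S" for s using ini_x[OF that, of F] that by simp
    then have "F \<in> rees0" using rees0_iff[OF F(1)] by blast
    then show ?thesis using F cls_eq_zero_iff[OF F(1)] by simp
  qed
  show ?thesis
    unfolding specialization_def tangent_cone_module_eq module_along_simps subst2_var1
    using add act ker inj by (intro conjI ballI allI impI) simp_all
qed

lemma image_tangent_cone_module:
  "ap_ini ` carrier (tangent_cone_module g S :: (('n, 'k::field) pring, 'k poly poly set) module)
      = range ap_part"
proof
  show "range ap_part \<subseteq> ap_ini ` carrier (tangent_cone_module g S :: (('n, 'k) pring, 'k poly poly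
      set) module)"
  proof
    fix v :: "'k poly" assume "v \<in> range ap_part"
    then obtain f where f: "v = ap_part f" by blast
    have AP: "AP \<subseteq> S" using AP_D(1) by blast
    have "ap_ini (cls (sect AP f)) = v"
      unfolding f ap_ini_cls[OF sect_rees[OF AP]] ap_part_eq_iff by
          (simp add: ini_sect[OF finite_AP])
    then show "v \<in> ap_ini ` carrier (tangent_cone_module g S :: (('n, 'k) pring, 'k poly poly set)
        module)"
      using sect_rees[OF AP, of f] by (intro image_eqI[of _ _ "cls (sect AP f)"])
          (auto simp: tangent_cone_module_eq)
  qed
qed (auto simp: tangent_cone_module_eq tangent_cone_carrier ap_ini_cls)

section \<open>A homomorphism from G(S) to k[T] and the height of the irrelevant ideal\<close>

definition lead_form :: "'k::field poly poly \<Rightarrow> 'k poly" where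
  "lead_form F = (\<Sum>j\<le>degree F. monom (coeff (coeff F j) (n1 * j)) j)"

lemma coeff_lead_form: "coeff (lead_form F) j = coeff (coeff F j) (n1 * j)"
proof -
  have "coeff (lead_form F) j = (\<Sum>i\<le>degree F. if i = j then coeff (coeff F i) (n1 * i) else 0)"
    unfolding lead_form_def coeff_sum by (intro sum.cong) auto
  also have "\<dots> = coeff (coeff F j) (n1 * j)"
    using coeff_eq_0[of F j] by (cases "j \<le> degree F") auto
  finally show ?thesis .
qed

lemma rees_coeff_n1:
  assumes "F \<in> rees" "coeff (coeff F j) s \<noteq> 0"
  shows "n1 * j \<le> s"
proof -
  have s: "s \<in> S" "j \<le> order s" using rees_coeffD[OF assms] by auto
  have "n1 * j \<le> n1 * order s" using s(2) by simp
  also have "\<dots> \<le> s" by (rule n1_order_le[OF s(1)])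
  finally show ?thesis .
qed

text \<open>In degree \<open>j\<close> of the Rees algebra \<open>n\<^sub>1 j\<close> is the least possible exponent, so only the extreme
  terms of the factors contribute to the extreme term of a product.\<close>

lemma lead_form_mult:
  assumes F: "F \<in> rees" and G: "G \<in> rees"
  shows "lead_form (F * G) = lead_form F * lead_form G"
proof (rule poly_eqI)
  fix j
  have "coeff (coeff F i * coeff G (j - i)) (n1 * j) =
      coeff (coeff F i) (n1 * i) * coeff (coeff G (j - i)) (n1 * (j - i))" if i: "i \<le> j" for i
  proof -
    let ?f = "\<lambda>a. coeff (coeff F i) a * coeff (coeff G (j - i)) (n1 * j - a)"
    have split: "n1 * j = n1 * i + n1 * (j - i)" using i by (simp flip: distrib_left)
    have "?f a = 0" if "a \<le> n1 * j" "a \<noteq> n1 * i" for a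
    proof (rule ccontr)
      assume "?f a \<noteq> 0"
      then have "n1 * i \<le> a" "n1 * (j - i) \<le> n1 * j - a"
        using rees_coeff_n1[OF F, of i a] rees_coeff_n1[OF G, of "j - i" "n1 * j - a"] by auto
      then show False using split that by linarith
    qed
    then have "(\<Sum>a\<le>n1 * j. ?f a) = (\<Sum>a\<in>{n1 * i}. ?f a)"
      using split by (intro sum.mono_neutral_right) auto
    then show ?thesis using split by (simp add: coeff_mult)
  qed
  then show "coeff (lead_form (F * G)) j = coeff (lead_form F * lead_form G) j"
    by (simp add: coeff_lead_form coeff_mult[of F G] coeff_mult[of "lead_form F"] coeff_sum)
qed

lemma lead_form_add: "lead_form (F + G) = lead_form F + lead_form G"
  by (simp add: poly_eq_iff coeff_lead_form)

lemma lead_form_one: "lead_form 1 = 1"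
  by (auto simp: poly_eq_iff coeff_lead_form coeff_1)

text \<open>The monomial t^(n_1 j) has order exactly j, so it cannot occur in degree j of
  \<open>rees0\<close>.\<close>

lemma lead_form_rees0: "F \<in> rees0 \<Longrightarrow> lead_form F = 0"
proof (rule poly_eqI)
  fix j assume "F \<in> rees0"
  then have "coeff (coeff F j) (n1 * j) \<noteq> 0 \<Longrightarrow> Suc j \<le> order (n1 * j)" by
      (simp add: rees0_def filt_def)
  then show "coeff (lead_form F) j = coeff 0 j" by (auto simp: coeff_lead_form order_n1_multiple)
qed

text \<open>The induced map sends the class of x_1 to T and those of the other variables to 0. As
  k[T] is a domain, its kernel is a prime ideal of G(S).\<close>

lemma lead_form_hom:
  "\<exists>h\<in>Ring.ring_hom (tangent_cone g S :: 'k::field poly poly set ring) class_ring.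
     \<forall>F\<in>rees. h (cls F) = (lead_form F :: 'k poly)"
proof -
  have "ring (class_ring :: 'k poly ring)" by (rule class_ring.ring_axioms)
  moreover have "(lead_form :: 'k poly poly \<Rightarrow> _) \<in> Ring.ring_hom (ring_on rees) class_ring"
    by (rule ring_hom_memI) (simp_all add: class_ring_simps lead_form_mult lead_form_add
        lead_form_one)
  moreover have "lead_form F = \<zero>\<^bsub>class_ring\<^esub>" if "F \<in> rees0" for F :: "'k poly poly"
    using lead_form_rees0[OF that] by (simp add: class_ring_simps)
  ultimately have "\<exists>h\<in>Ring.ring_hom (ring_on rees Quot rees0) class_ring.
      \<forall>F\<in>carrier (ring_on rees). h (rees0 +>\<^bsub>ring_on rees\<^esub> F) = (lead_form F :: 'k poly)"
    by (rule ideal.induced_hom[OF rees0_ideal])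
  then show ?thesis by (simp add: tangent_cone_eq cls_def)
qed

text \<open>M is the kernel of \<open>h0\<close>, which is \<open>h\<close> followed by evaluation
  at T = 0 and maps onto k. The kernel Q of \<open>h\<close> is a prime inside M, and a proper part
  of it: the class of x_1 goes to T, which is nonzero but vanishes at 0.\<close>

lemma tangent_cone_height:
  defines "M \<equiv> cls ` {F :: 'k::field poly poly. F \<in> rees \<and> coeff (coeff F 0) 0 = 0}"
  shows "maximalideal M (tangent_cone g S)" and "1 \<le> prime_height (tangent_cone g S) M"
proof -
  let ?G = "tangent_cone g S :: 'k poly poly set ring"
  interpret G: cring ?G by (rule tangent_cone_cring)
  obtain h where h: "h \<in> Ring.ring_hom ?G class_ring" and hcls:
      "\<And>F. F \<in> rees \<Longrightarrow> h (cls F) = lead_form F"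
    using lead_form_hom[where 'k = 'k] by blast
  define h0 where "h0 = (\<lambda>C. coeff (h C) 0)"
  have h0: "h0 \<in> Ring.ring_hom ?G class_ring"
  proof (rule ring_hom_memI)
    fix C D assume CD: "C \<in> carrier ?G" "D \<in> carrier ?G"
    show "h0 (C \<otimes>\<^bsub>?G\<^esub> D) = h0 C \<otimes>\<^bsub>class_ring\<^esub> h0 D" "h0 (C \<oplus>\<^bsub>?G\<^esub> D) = h0 C \<oplus>\<^bsub>class_ring\<^esub> h0 D"
      using ring_hom_mult[OF h CD] ring_hom_add[OF h CD] by
          (simp_all add: h0_def class_ring_simps coeff_mult)
  qed (use ring_hom_one[OF h] in \<open>simp_all add: h0_def class_ring_simps\<close>)
  have h0cls: "h0 (cls F) = coeff (coeff F 0) 0" if "F \<in> rees" for F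
    using hcls[OF that] by (simp add: h0_def coeff_lead_form)
  have surj: "h0 ` carrier ?G = UNIV"
  proof -
    have "c = h0 (cls (monom (monom c 0) 0))" for c using h0cls[OF monom_rees[of 0 0 c]] by simp
    moreover have "cls (monom (monom c 0) 0) \<in> carrier ?G" for c :: 'k by (simp add: monom_rees)
    ultimately show ?thesis by (metis UNIV_eq_I image_eqI)
  qed
  have M: "M = {C \<in> carrier ?G. h0 C = 0}"
    by (auto simp: M_def tangent_cone_carrier h0cls)
  show max: "maximalideal M ?G" unfolding M by
      (rule hom_kernel_maximal[OF tangent_cone_cring h0 surj])
  define Q where "Q = {C \<in> carrier ?G. h C = 0}"
  have Q: "primeideal Q ?G" unfolding Q_def by (rule hom_kernel_prime[OF tangent_cone_cring h])
  let ?x = "monom (monom 1 n1) 1 :: 'k poly poly"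
  have x: "?x \<in> rees" using subst2_rees[of var1] by (simp add: subst2_var1)
  have "coeff (lead_form ?x) 1 = 1" by (simp add: coeff_lead_form)
  then have "h (cls ?x) \<noteq> 0" using hcls[OF x] by auto
  then have "cls ?x \<notin> Q" by (simp add: Q_def)
  moreover have "cls ?x \<in> M" using x by (auto simp: M_def)
  moreover have "Q \<subseteq> M" by (auto simp: Q_def M h0_def)
  ultimately have "Q \<subset> M" by blast
  let ?q = "\<lambda>i :: nat. if i = 0 then Q else M"
  have q: "\<forall>i\<le>1. primeideal (?q i) ?G" "\<forall>i<1. ?q i \<subset> ?q (Suc i)" "?q 1 = M"
    using Q G.maximalideal_prime[OF max] \<open>Q \<subset> M\<close> by auto
  have "enat 1 \<le> prime_height ?G M"
    unfolding prime_height_def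
    by (intro Sup_upper CollectI exI[of _ "1::nat"] conjI refl exI[of _ ?q] q)
  then show "1 \<le> prime_height ?G M" by (simp add: one_enat_def)
qed

section \<open>Cohen-Macaulayness and the order along n_1\<close>

lemma tangent_cone_regular_element:
  assumes cm: "cohen_macaulay (tangent_cone g S :: 'k::field poly poly set ring)"
  shows "\<exists>F :: 'k poly poly. F \<in> rees \<and> coeff (coeff F 0) 0 = 0 \<and> (\<forall>H\<in>rees. F * H \<in> rees0
      \<longrightarrow> H \<in> rees0)"
proof -
  let ?G = "tangent_cone g S :: 'k poly poly set ring"
  let ?M = "cls ` {F :: 'k poly poly. F \<in> rees \<and> coeff (coeff F 0) 0 = 0}"
  interpret G: cring ?G by (rule tangent_cone_cring)
  \<comment> \<open>Depth equals height at M, so M contains a nonempty regular sequence, whose first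
    member serves as the regular element.\<close>
  have "1 \<le> ideal_depth ?G ?M"
    using cm tangent_cone_height[where 'k = 'k] by (simp add: cohen_macaulay_def)
  then have "0 < ideal_depth ?G ?M" by (cases "ideal_depth ?G ?M = 0") simp_all
  then obtain l where "l \<in> {enat (length xs) | xs. regular_sequence ?G xs \<and> set xs \<subseteq> ?M}" "0 < l"
    unfolding ideal_depth_def using less_Sup_iff by blast
  then obtain xs where xs: "regular_sequence ?G xs" "set xs \<subseteq> ?M" "0 < enat (length xs)" by auto
  have len: "0 < length xs" using xs(3) by (simp add: zero_enat_def)
  then have "xs ! 0 \<in> ?M" using xs(2) nth_mem[OF len] by auto
  then obtain F where F: "F \<in> rees" "coeff (coeff F 0) 0 = 0" "xs ! 0 = cls F" by blast
  \<comment> \<open>The first member of a regular sequence is tested modulo the ideal generated by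
    the empty set, that is, modulo 0.\<close>
  have "Idl\<^bsub>?G\<^esub> {} \<subseteq> {\<zero>\<^bsub>?G\<^esub>}" by (rule G.genideal_minimal[OF G.zeroideal]) simp
  moreover have "\<zero>\<^bsub>?G\<^esub> \<in> Idl\<^bsub>?G\<^esub> {}"
    by (rule additive_subgroup.zero_closed[OF ideal.axioms(1)[OF G.genideal_ideal]]) simp
  ultimately have idl: "Idl\<^bsub>?G\<^esub> {} = {\<zero>\<^bsub>?G\<^esub>}" by blast
  have reg: "y = \<zero>\<^bsub>?G\<^esub>" if "y \<in> carrier ?G" "cls F \<otimes>\<^bsub>?G\<^esub> y = \<zero>\<^bsub>?G\<^esub>" for y
    using xs(1) len that F(3) unfolding regular_sequence_def by (auto simp: idl dest!: spec[of _ 0])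
  have "H \<in> rees0" if H: "H \<in> rees" "F * H \<in> rees0" for H
    using reg[of "cls H"] H F(1) by (simp add: cls_mult cls_eq_zero_iff rees_mult)
  with F show ?thesis by blast
qed

text \<open>The regular element F need not be homogeneous, so a power of it takes the place of an
  element of high degree: all coordinates of F^N sit at exponents of order at least N. For N large
  such a power kills the class E of t^s if the order jumps, although powers of F are regular and E
  is not 0.\<close>

lemma order_add_n1:
  assumes cm: "cohen_macaulay (tangent_cone g S :: 'k::field poly poly set ring)" and s: "s \<in> S"
  shows "order (s + n1) = Suc (order s)"
proof (rule ccontr)
  assume "order (s + n1) \<noteq> Suc (order s)"
  moreover have "order s + order n1 \<le> order (s + n1)" using order_add[OF s n1_in] .
  ultimately have jump: "order s + 2 \<le> order (s + n1)" using order_n1_multiple[of 1] by simp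
  obtain F :: "'k poly poly" where F: "F \<in> rees" "coeff (coeff F 0) 0 = 0"
    and reg: "\<And>H. H \<in> rees \<Longrightarrow> F * H \<in> rees0 \<Longrightarrow> H \<in> rees0"
    using tangent_cone_regular_element[OF cm] by blast
  define E :: "'k poly poly" where "E = monom (monom 1 s) (order s)"
  have E: "E \<in> rees" unfolding E_def by (rule monom_rees[OF s order_refl])
  have Frees: "F ^ N \<in> rees" for N by (induction N) (auto intro: rees_mult F)
  \<comment> \<open>Each factor F raises the order by at least 1, because its constant term is 0 and
    nonzero elements of S have positive order.\<close>
  have deep: "N \<le> order u" if "ini (F ^ N) u \<noteq> 0" for N u
    using that
  proof (induction N arbitrary: u)
    case (Suc N)
    have "\<exists>i\<in>{..order u}. coeff (coeff F i * coeff (F ^ N) (order u - i)) u \<noteq> 0"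
      using Suc.prems unfolding ini_def power_Suc coeff_mult[of F] coeff_sum by (meson sum.neutral)
    then obtain i where i: "i \<le> order u" "coeff (coeff F i * coeff (F ^ N) (order u - i)) u \<noteq> 0"
        by auto
    from i(2) obtain a b where ab: "u = a + b" "coeff (coeff F i) a \<noteq> 0"
        "coeff (coeff (F ^ N) (order u - i)) b \<noteq> 0"
      by (rule coeff_mult_nonzeroE)
    have a: "a \<in> S" "i \<le> order a" using rees_coeffD[OF F(1) ab(2)] by auto
    have b: "b \<in> S" "order u - i \<le> order b" using rees_coeffD[OF Frees ab(3)] by auto
    have sum: "order a + order b \<le> order u" using order_add[OF a(1) b(1)] ab(1) by simp
    \<comment> \<open>The degrees i and order u - i sum to order u, while orders are superadditive.
      So both factors contribute exactly at their orders, and the induction hypothesis applies to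
      the coordinate at b.\<close>
    have eq: "order u - i = order b" "i = order a" using a b sum i(1) by linarith+
    have "N \<le> order b" using Suc.IH[of b] ab(3) eq by (simp add: ini_def)
    moreover have "a \<noteq> 0"
    proof
      assume "a = 0"
      then show False using ab(2) eq(2) F(2) by simp
    qed
    then have "1 \<le> order a" using order_pos a(1) by blast
    ultimately show ?case using sum by linarith
  qed simp
  \<comment> \<open>The threshold of \<open>order_split_n1\<close>: from this order on n_1 can be
    split off at the cost of at most one unit of order.\<close>
  let ?N = "card (UNIV :: 'n set) * n1"
  have "coeff (F ^ ?N * E) j \<in> filt (Suc j)" for j
  proof -
    have "v \<in> S \<and> Suc j \<le> order v" if nz: "coeff (coeff (F ^ ?N * E) j) v \<noteq> 0" for v
    proof -
      have "coeff (coeff (F ^ ?N * E) j) v =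
        (if order s \<le> j \<and> s \<le> v then coeff (coeff (F ^ ?N) (j - order s)) (v - s) else 0)"
        unfolding E_def by (simp add: coeff_monom_mult mult.commute[of "F ^ _"])
      with nz have js: "order s \<le> j" and sv: "s \<le> v" and c:
          "coeff (coeff (F ^ ?N) (j - order s)) (v - s) \<noteq> 0"
        by (auto split: if_splits)
      define u where "u = v - s"
      have v: "v = s + u" using sv by (simp add: u_def)
      have u: "u \<in> S" "j - order s \<le> order u" using rees_coeffD[OF Frees c] by (auto simp: u_def)
      have le: "order s + order u \<le> order v" using order_add[OF s u(1)] v by simp
      show ?thesis
      \<comment> \<open>Below the order of u, superadditivity already gives order v > j. Otherwise u
        contributes a coordinate of the power, so u = t + n_1; splitting off n_1 costs at most 1,
        but joining it to s gains at least 2.\<close>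
      proof (cases "j - order s < order u")
        case True
        then show ?thesis using le u s v by auto
      next
        case False
        then have "ini (F ^ ?N) u \<noteq> 0" using c u(2) by (simp add: ini_def u_def)
        then obtain t where t: "t \<in> S" "u = t + n1" "order u \<le> Suc (order t)"
          using order_split_n1[OF u(1) deep] by blast
        have "order (s + n1) + order t \<le> order (s + n1 + t)" by (rule order_add) (use s t in auto)
        also have "s + n1 + t = v" using v t(2) by simp
        finally show ?thesis using jump t(3) u False js v s by auto
      qed
    qed
    then show ?thesis by (simp add: filt_def)
  qed
  then have "F ^ ?N * E \<in> rees0" by (simp add: rees0_def)
  \<comment> \<open>Cancelling one factor F at a time: powers of a regular element are
    regular.\<close>
  moreover have "H \<in> rees0" if "F ^ N * H \<in> rees0" "H \<in> rees" for N H
    using that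
  proof (induction N)
    case (Suc N)
    then show ?case using reg[of "F ^ N * H"] rees_mult[OF Frees] by (simp add: mult.assoc)
  qed simp
  ultimately have "E \<in> rees0" using E by blast
  then have "ini E s = 0" using rees0_iff[OF E] s by blast
  then show False by (simp add: E_def ini_def)
qed

end

theorem theorem3p17:
  fixes g :: "'n::finite \<Rightarrow> nat" and S :: "nat set"
  assumes "numerical_semigroup S"
    and "minimally_generates g S"
    and "homogeneous_semigroup g S"
    and "cohen_macaulay (tangent_cone g S :: 'k::field poly poly set ring)"
  shows "homogeneous_type TYPE('k) g S"
proof -
  interpret generated_semigroup g S by unfold_locales (rule assms)+
  have "betti (semigroup_module g S :: (('n, 'k) pring, 'k poly) module) i =
      betti (tangent_cone_module g S :: (('n, 'k) pring, 'k poly poly set) module) i" for i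
  proof (rule betti_eq_of_specializations)
    show "specialization var1 ap_act (semigroup_module g S :: (('n, 'k) pring, 'k poly) module) (\<lambda>f.
        ap_part (coeff f))"
      by (rule specialization_semigroup_module)
    show "specialization var1 ap_act (tangent_cone_module g S :: (('n, 'k) pring, 'k poly poly set)
        module) ap_ini"
      by (rule specialization_tangent_cone_module[OF assms(3) order_add_n1[OF assms(4)]])
    show "\<exists>b D e. free_resolution (semigroup_module g S :: (('n, 'k) pring, 'k poly) module) b D e"
      unfolding semigroup_module_eq
      by (rule module_along_resolution_exists[OF semigroup_ring_cring subst1_hom])
          (simp add: subst1_surj)
    show "\<exists>b D e. free_resolution (tangent_cone_module g S :: (('n, 'k) pring, 'k poly poly set)
        module) b D e"
      unfolding tangent_cone_module_eq
      by (rule module_along_resolution_exists[OF tangent_cone_cring subst2_hom subst2_surj])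
  qed (auto simp: image_semigroup_module image_tangent_cone_module lookup_var1_zero intro:
      var1_regular)
  then show ?thesis by (simp add: homogeneous_type_def)
qed

end
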